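(* Consider the linear model $\mathbf{y}=\alpha\mathbf{1}_n+\mathbf{X}\boldsymbol{\beta}+\sigma\boldsymbol{\epsilon}$ with $n-1>p\ge 3$, and Stein's loss $L_S(\delta,\sigma^2)=\delta/\sigma^2-\log(\delta/\sigma^2)-1$. Define $$\delta^{H}=\phi^{H}(R^2)\frac{\mathrm{RSS}}{n-p-1},\qquad \phi^{H}(R^2)=\frac{n-p-1}{n-3}\,\frac{\int_0^1 t^{p/2-2}(1-R^2t)^{(n-p-3)/2}\,dt}{\int_0^1 t^{p/2-2}(1-R^2t)^{(n-p-1)/2}\,dt}.$$ Then, for every error distribution of $\boldsymbol{\epsilon}$ that is a scale mixture of normals, $\delta^H$ is minimax and is the generalized Bayes estimator of $\sigma^2$ with respect to the harmonic prior $\pi(\alpha,\boldsymbol{\beta},\sigma^2)=(\boldsymbol{\beta}'\mathbf{X}'\mathbf{X}\boldsymbol{\beta})^{-(p-2)/2}\{\sigma^2\}^{-1}$.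
   Context: Here $\mathbf{y}\in\mathbb{R}^n$ is observed, $\alpha\in\mathbb{R}$ is an unknown intercept, $\mathbf{1}_n$ is the $n$-vector of ones, $\mathbf{X}=(\mathbf{x}_1,\dots,\mathbf{x}_p)$ is a known $n\times p$ design matrix whose columns are centered ($\mathbf{x}_i'\mathbf{1}_n=0$) and linearly independent (rank $p$), $\boldsymbol{\beta}\in\mathbb{R}^p$ is unknown, and $\sigma>0$ is unknown. With $\bar y$ the mean of the entries of $\mathbf{y}$, $\mathrm{RSS}=\|(\mathbf{I}-\mathbf{X}(\mathbf{X}'\mathbf{X})^{-1}\mathbf{X}')(\mathbf{y}-\bar y\mathbf{1}_n)\|^2$ and $R^2=\|\mathbf{X}(\mathbf{X}'\mathbf{X})^{-1}\mathbf{X}'(\mathbf{y}-\bar y\mathbf{1}_n)\|^2/\|\mathbf{y}-\bar y\mathbf{1}_n\|^2$. A scale mixture of normals means $\boldsymbol{\epsilon}=\tau\mathbf{Z}$ with $\mathbf{Z}\sim N_n(\mathbf{0}_n,\mathbf{I}_n)$ independent of a positive random scalar $\tau$ with $E[\tau^2]=1$ (so $E[\boldsymbol{\epsilon}]=\mathbf{0}_n$, $\mathrm{Var}[\boldsymbol{\epsilon}]=\mathbf{I}_n$). Minimax means $\sup_{\alpha,\boldsymbol{\beta},\sigma^2}E[L_S(\delta^H,\sigma^2)]=\inf_{\delta}\sup_{\alpha,\boldsymbol{\beta},\sigma^2}E[L_S(\delta,\sigma^2)]$ for the given error distribution. The generalized Bayes estimator under Stein's loss is $\{E[1/\sigma^2\mid\mathbf{y}]\}^{-1}$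 with respect to the (improper) posterior from the sampling density and the given prior. *)

theory Defs
  imports "HOL-Probability.Probability"
begin

text \<open>Dimensions are type-indexed: y :: real^'n (so n = CARD('n)),
  X :: real^'p^'n is the n x p design matrix (rows indexed by 'n, columns by 'p),
  beta :: real^'p.\<close>

definition ones :: "real^'n" where
  "ones = (\<chi> i. 1)"

definition ybar :: "real^'n \<Rightarrow> real" where
  "ybar y = (\<Sum>i\<in>UNIV. y $ i) / real CARD('n)"

definition centered :: "real^'n \<Rightarrow> real^'n" where
  "centered y = y - ybar y *\<^sub>R ones"

definition hat :: "real^'p^'n \<Rightarrow> real^'n^'n" where
  "hat X = X ** matrix_inv (transpose X ** X) ** transpose X"

definition RSS :: "real^'p^'n \<Rightarrow> real^'n \<Rightarrow> real" where
  "RSS X y = (norm (centered y - hat X *v centered y)) ^ 2"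

definition Rsq :: "real^'p^'n \<Rightarrow> real^'n \<Rightarrow> real" where
  "Rsq X y = (norm (hat X *v centered y)) ^ 2 / (norm (centered y)) ^ 2"

definition phiH :: "nat \<Rightarrow> nat \<Rightarrow> real \<Rightarrow> real" where
  "phiH n p r =
     (real n - real p - 1) / (real n - 3) *
     (integral {0..1} (\<lambda>t. t powr (real p / 2 - 2) * (1 - r * t) powr ((real n - real p - 3) / 2)) /
      integral {0..1} (\<lambda>t. t powr (real p / 2 - 2) * (1 - r * t) powr ((real n - real p - 1) / 2)))"

definition deltaH :: "real^'p^'n \<Rightarrow> real^'n \<Rightarrow> real" where
  "deltaH X y = phiH CARD('n) CARD('p) (Rsq X y) * RSS X y / (real CARD('n) - real CARD('p) - 1)"

definition stein_loss :: "real \<Rightarrow> real \<Rightarrow> real" where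
  "stein_loss d s = d / s - ln (d / s) - 1"

definition std_normal_vec :: "(real^'n) measure" where
  "std_normal_vec = density lborel
     (\<lambda>z. ennreal ((2 * pi) powr (- real CARD('n) / 2) * exp (- (norm z ^ 2) / 2)))"

text \<open>eps = tau Z with Z ~ N(0,I) independent of tau > 0, E[tau^2] = 1.
  Such an error distribution is determined by the law T of tau, a probability
  measure on the reals.\<close>
definition scale_mixture :: "real measure \<Rightarrow> bool" where
  "scale_mixture T \<longleftrightarrow> prob_space T \<and> sets T = sets borel \<and>
     (AE \<tau> in T. 0 < \<tau>) \<and> (\<integral>\<^sup>+ \<tau>. ennreal (\<tau> ^ 2) \<partial>T) = 1"

definition risk :: "real measure \<Rightarrow> real^'p^'n \<Rightarrow> (real^'n \<Rightarrow> real) \<Rightarrow> real \<Rightarrow> real^'p \<Rightarrow> real \<Rightarrow> ennreal" where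
  "risk T X \<delta> \<alpha> \<beta> \<sigma> =
     (\<integral>\<^sup>+ \<tau>. (\<integral>\<^sup>+ z. ennreal (stein_loss (\<delta> (\<alpha> *\<^sub>R ones + X *v \<beta> + (\<sigma> * \<tau>) *\<^sub>R z)) (\<sigma> ^ 2))
        \<partial>(std_normal_vec :: (real^'n) measure)) \<partial>T)"

definition max_risk :: "real measure \<Rightarrow> real^'p^'n \<Rightarrow> (real^'n \<Rightarrow> real) \<Rightarrow> ennreal" where
  "max_risk T X \<delta> = (SUP \<alpha>. SUP \<beta>. SUP \<sigma>\<in>{0<..}. risk T X \<delta> \<alpha> \<beta> \<sigma>)"

definition estimators :: "(real^'n \<Rightarrow> real) set" where
  "estimators = {\<delta>. \<delta> \<in> borel_measurable borel \<and> (\<forall>y. 0 < \<delta> y)}"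

definition minimax :: "real measure \<Rightarrow> real^'p^'n \<Rightarrow> (real^'n \<Rightarrow> real) \<Rightarrow> bool" where
  "minimax T X \<delta> \<longleftrightarrow> max_risk T X \<delta> = (INF d\<in>estimators. max_risk T X d)"

definition samp_dens :: "real measure \<Rightarrow> real^'p^'n \<Rightarrow> real \<Rightarrow> real^'p \<Rightarrow> real \<Rightarrow> real^'n \<Rightarrow> ennreal" where
  "samp_dens T X \<alpha> \<beta> s y =
     (\<integral>\<^sup>+ \<tau>. ennreal ((2 * pi * s * \<tau> ^ 2) powr (- real CARD('n) / 2) *
        exp (- (norm (y - \<alpha> *\<^sub>R ones - X *v \<beta>) ^ 2) / (2 * s * \<tau> ^ 2))) \<partial>T)"

text \<open>Harmonic prior (beta' X' X beta)^{-(p-2)/2} (sigma^2)^{-1}, density w.r.t.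
  d alpha d beta d(sigma^2).\<close>
definition harmonic_prior :: "real^'p^'n \<Rightarrow> real^'p \<Rightarrow> real \<Rightarrow> real" where
  "harmonic_prior X \<beta> s = (\<beta> \<bullet> ((transpose X ** X) *v \<beta>)) powr (- (real CARD('p) - 2) / 2) / s"

definition post_int :: "real measure \<Rightarrow> real^'p^'n \<Rightarrow> (real \<Rightarrow> real) \<Rightarrow> real^'n \<Rightarrow> ennreal" where
  "post_int T X g y =
     (\<integral>\<^sup>+ \<alpha>. (\<integral>\<^sup>+ \<beta>. (\<integral>\<^sup>+ s\<in>{0<..}.
        ennreal (g s * harmonic_prior X \<beta> s) * samp_dens T X \<alpha> \<beta> s y \<partial>lborel)
      \<partial>(lborel :: (real^'p) measure)) \<partial>lborel)"

text \<open>delta is the generalized Bayes estimator under Stein's loss: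
  for almost every y the posterior is proper, E[1/sigma^2 | y] is finite and
  positive, and delta(y) = (E[1/sigma^2 | y])^{-1}.\<close>
definition gen_bayes_stein :: "real measure \<Rightarrow> real^'p^'n \<Rightarrow> (real^'n \<Rightarrow> real) \<Rightarrow> bool" where
  "gen_bayes_stein T X \<delta> \<longleftrightarrow>
     (AE y in (lborel :: (real^'n) measure).
        0 < post_int T X (\<lambda>s. 1) y \<and> post_int T X (\<lambda>s. 1) y < \<infinity> \<and>
        0 < post_int T X (\<lambda>s. 1 / s) y \<and> post_int T X (\<lambda>s. 1 / s) y < \<infinity> \<and>
        \<delta> y = enn2real (post_int T X (\<lambda>s. 1) y) / enn2real (post_int T X (\<lambda>s. 1 / s) y))"

end

theory Submission
  imports Defs
begin

text \<open>Write \<open>W\<close> and \<open>S\<close> for the squared norms of the fitted part and of the residual, \<open>m = n - p - 1\<close>.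
  Then \<open>\<delta>\<^sup>H = \<phi>(W / S) S / m\<close>, where \<open>\<phi>\<close> is increasing with values in \<open>[m / (n - 3), 1)\<close>; it is the
  Brewster--Zidek function with \<open>p\<close> replaced by \<open>p - 2\<close>.

  Upper bound. Given \<open>\<tau>\<close>, the noncentral law of \<open>W\<close> is a mixture of central ones, and for each of these
  an integration by parts gives \<open>E[- ln \<phi>] \<le> E[(1 - \<phi>) S / m]\<close>, that is, \<open>\<delta>\<^sup>H\<close> improves on \<open>S / m\<close> under normal
  errors. The right-hand side increases with \<open>\<tau>\<close>, since shrinking the mean moves \<open>\<phi>\<close> away from \<open>1\<close>. Because
  \<open>E[\<tau>\<^sup>2] = 1\<close>, the inequality \<open>(\<tau>\<^sup>2 - 1) (a(\<tau>) - a(1)) \<ge> 0\<close> for increasing \<open>a\<close> carries the improvement over to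
  scale mixtures.

  Lower bound. Average the risk of an arbitrary estimator over a large box in \<open>(\<alpha>, \<beta>, ln \<sigma>)\<close>. Lebesgue measure
  there is invariant under right translations of the affine group, so the average is at least, up to boundary
  effects, the risk of an estimator \<open>c(u) S\<close> with \<open>u\<close> the direction of the residual. As \<open>u\<close> is independent of \<open>S\<close>,
  this is at least the constant risk of \<open>S / m\<close>.

  Bayes property. Under the prior \<open>d\<sigma>\<^sup>2 / \<sigma>\<^sup>2\<close> the scale \<open>\<tau>\<close> is absorbed into \<open>\<sigma>\<close>. The harmonic prior on
  \<open>\<beta>\<close> is a Gamma mixture of Gaussians, and integrating out \<open>\<alpha>\<close>, \<open>\<beta>\<close>, \<open>\<sigma>\<^sup>2\<close> leaves the incomplete beta
  integrals that define \<open>\<phi>\<close>.\<close>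

section \<open>Incomplete beta integrals and the shrinkage function\<close>

text \<open>The prior and the risk bound meet at the parameter p / 2 - 1. A power -(p - 2) of
  |X\<beta>|, written as a Gamma mixture, produces this shape, whereas the central components of W
  have shapes (p + k) / 2. One \<phi> serves all of them because \<open>shrink\<close> decreases in
  its first parameter: \<phi> dominates the shrinkage function attached to each component, and this
  fixes the sign of the term that the integration by parts leaves over. In the lower bound the
  obstacle is that the noise is unbounded as a group element, so no box is nearly invariant under
  all of it. The noise is truncated to a window of size L. The location range still has to be
  enlarged by an amount exponential in the range of ln \<sigma>, so it must tend to infinity while
  the scale range is fixed. Risks may be infinite when \<tau> puts much mass near 0. Losses are
  therefore compared as sums of nonnegative integrals, and a term is cancelled only after it is
  known to be finite. The constants in front of the laws of squared norms are never evaluated: total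
  mass one, or the quotient of two posterior integrals, removes them.\<close>

definition beta_kernel :: "real \<Rightarrow> real \<Rightarrow> real \<Rightarrow> real" where
  "beta_kernel a b v = v powr (a - 1) * (1 + v) powr (- (a + b))"

definition beta_cdf :: "real \<Rightarrow> real \<Rightarrow> real \<Rightarrow> real" where
  "beta_cdf a b x = integral {0..x} (beta_kernel a b)"

text \<open>Boundary term of the integration by parts that raises the exponent of 1 + v:
  \<open>beta_cdf a b x + beta_corr a b x\<close> is (a + b) / b times the integral of
  \<open>v powr (a - 1) * (1 + v) powr (- (a + b + 1))\<close> over [0, x]. The kernel itself is the
  unnormalised density of the quotient of two independent Gamma variables with shapes a and
  b.\<close>

definition beta_corr :: "real \<Rightarrow> real \<Rightarrow> real \<Rightarrow> real" where
  "beta_corr a b x = x powr a * (1 + x) powr (- (a + b)) / b"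

text \<open>A quotient of two incomplete beta integrals times b / (a + b). With a = p / 2 - 1 and b
  = m / 2 it is \<phi> as a function of the odds x = r / (1 - r) = W / S, where r is R squared. At x
  = 0 it evaluates to 0 / 0 = 0, so monotonicity extends to that point.\<close>

definition shrink :: "real \<Rightarrow> real \<Rightarrow> real \<Rightarrow> real" where
  "shrink a b x = beta_cdf a b x / (beta_cdf a b x + beta_corr a b x)"

lemma beta_kernel_pos: "x > 0 \<Longrightarrow> beta_kernel a b x > 0"
  by (simp add: beta_kernel_def)

lemma beta_kernel_nonneg: "0 \<le> beta_kernel a b x"
  by (simp add: beta_kernel_def)

lemma beta_corr_pos: "x > 0 \<Longrightarrow> b > 0 \<Longrightarrow> beta_corr a b x > 0"
  by (simp add: beta_corr_def)

lemma beta_kernel_measurable [measurable]: "beta_kernel a b \<in> borel_measurable borel"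
  unfolding beta_kernel_def by measurable

text \<open>The second factor is at most 1, so \<open>v powr (a - 1)\<close> dominates. The
  singularity at 0 really occurs: p = 3 leads to a = 1 / 2.\<close>

lemma beta_kernel_integrable:
  assumes "a > 0" "b > 0"
  shows "beta_kernel a b integrable_on {0..x}"
proof (cases "x \<ge> 0")
  case True
  show ?thesis
  proof (rule measurable_bounded_by_integrable_imp_integrable)
    have "beta_kernel a b \<in> borel_measurable (lebesgue)"
      by (simp add: borel_measurable_if_I measurable_completion)
    then show "beta_kernel a b \<in> borel_measurable (lebesgue_on {0..x})"
      by (rule measurable_restrict_space1)
    show "(\<lambda>v. v powr (a - 1)) integrable_on {0..x}"
      using True assms by (intro integrable_on_powr_from_0) auto
    fix v assume v: "v \<in> {0..x}"
    have "(1 + v) powr (- (a + b)) \<le> (1 + v) powr 0"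
      using v assms by (intro powr_mono) auto
    then have "beta_kernel a b v \<le> v powr (a - 1) * 1"
      unfolding beta_kernel_def using v by (intro mult_left_mono) auto
    then show "norm (beta_kernel a b v) \<le> v powr (a - 1)"
      using beta_kernel_nonneg[of a b v] by simp
  qed auto
qed auto

lemma beta_cdf_continuous:
  assumes "a > 0" "b > 0"
  shows "continuous_on {0..x} (beta_cdf a b)"
  unfolding beta_cdf_def by (rule indefinite_integral_continuous_1[OF beta_kernel_integrable[OF assms]])

lemma beta_cdf_0 [simp]: "beta_cdf a b 0 = 0"
  by (simp add: beta_cdf_def)

lemma beta_cdf_deriv:
  assumes "a > 0" "b > 0" "x > 0"
  shows "(beta_cdf a b has_real_derivative beta_kernel a b x) (at x)"
proof -
  have c: "continuous (at x within ({0..x+1} - {})) (beta_kernel a b)"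
    unfolding beta_kernel_def using assms by (intro continuous_intros) auto
  have "((\<lambda>u. integral {0..u} (beta_kernel a b)) has_vector_derivative beta_kernel a b x) (at x within ({0..x+1} - {}))"
    by (rule integral_has_vector_derivative_continuous_at[OF beta_kernel_integrable])
       (use assms c in auto)
  then have "(beta_cdf a b has_vector_derivative beta_kernel a b x) (at x within {0..x+1})"
    by (simp add: beta_cdf_def[abs_def])
  then have "(beta_cdf a b has_vector_derivative beta_kernel a b x) (at x within {0<..<x+1})"
    by (rule has_vector_derivative_within_subset) auto
  then show ?thesis
    using assms at_within_open[of x "{0<..<x+1}"] by (simp add: has_real_derivative_iff_has_vector_derivative)
qed

lemma beta_cdf_mono:
  assumes "a > 0" "b > 0" "x \<le> y"
  shows "beta_cdf a b x \<le> beta_cdf a b y"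
  unfolding beta_cdf_def
  using assms(3) by (intro integral_subset_le beta_kernel_integrable assms(1,2) ballI beta_kernel_nonneg) auto

lemma beta_cdf_pos:
  assumes "a > 0" "b > 0" "x > 0"
  shows "beta_cdf a b x > 0"
proof -
  have "beta_cdf a b (x/2) < beta_cdf a b x"
  proof (rule DERIV_pos_imp_increasing_open[where f = "beta_cdf a b"])
    show "continuous_on {x/2..x} (beta_cdf a b)"
      using beta_cdf_continuous[OF assms(1,2), of x] by (rule continuous_on_subset) (use assms in auto)
    show "\<exists>y. (beta_cdf a b has_real_derivative y) (at u) \<and> 0 < y" if "x/2 < u" "u < x" for u
      using beta_cdf_deriv[of a b u] beta_kernel_pos[of u a b] that assms by auto
  qed (use assms in auto)
  moreover have "beta_cdf a b 0 \<le> beta_cdf a b (x/2)"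
    using assms by (intro beta_cdf_mono) auto
  ultimately show ?thesis by simp
qed

text \<open>Beyond 1 the kernel is at most \<open>u powr (- b - 1)\<close>, whose integral over the
  tail is 1 / b.\<close>

lemma beta_cdf_bounded:
  assumes "a > 0" "b > 0"
  obtains K where "K \<ge> 0" "\<And>x. x > 0 \<Longrightarrow> beta_cdf a b x \<le> K"
proof
  show "0 \<le> beta_cdf a b 1 + 1 / b" using beta_cdf_pos[of a b 1] assms by simp
  fix x :: real assume "x > 0"
  show "beta_cdf a b x \<le> beta_cdf a b 1 + 1 / b"
  proof (cases "x \<le> 1")
    case True
    then show ?thesis using beta_cdf_mono[OF assms True] assms by (simp add: add_increasing2)
  next
    case False
    have "beta_cdf a b x + x powr (- b) / b \<le> beta_cdf a b 1 + 1 powr (- b) / b"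
    proof (rule DERIV_nonpos_imp_nonincreasing[where f = "\<lambda>x. beta_cdf a b x + x powr (- b) / b"])
      fix u :: real assume u: "1 \<le> u" "u \<le> x"
      have "((\<lambda>x. beta_cdf a b x + x powr (- b) / b) has_real_derivative (beta_kernel a b u + (- b * u powr (- b - 1)) / b)) (at u)"
        using u assms by (intro DERIV_add DERIV_cdivide beta_cdf_deriv) (auto intro!: derivative_eq_intros)
      moreover have "beta_kernel a b u \<le> u powr (a - 1) * u powr (- (a + b))"
        unfolding beta_kernel_def using u assms by (intro mult_left_mono powr_mono2') auto
      moreover have "u powr (a - 1) * u powr (- (a + b)) = u powr (- b - 1)"
        by (subst powr_add[symmetric], rule arg_cong2[where f = "(powr)"]) simp_all
      ultimately show "\<exists>y. ((\<lambda>x. beta_cdf a b x + x powr (- b) / b) has_real_derivative y) (at u) \<and> y \<le> 0"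
        using assms by (intro exI[of _ "beta_kernel a b u + (- b * u powr (- b - 1)) / b"]) simp
    qed (use False in simp)
    moreover have "0 \<le> x powr (- b) / b" using assms by simp
    ultimately show ?thesis by simp
  qed
qed

lemma beta_corr_deriv:
  assumes "a > 0" "b > 0" "x > 0"
  shows "(beta_corr a b has_real_derivative ((a + b) / b * beta_kernel a b x / (1 + x) - beta_kernel a b x)) (at x)"
proof -
  have e: "x powr a = x * x powr (a - 1)"
    using assms by (simp add: powr_diff)
  have e2: "(1 + x) powr (- (a + b) - 1) = (1 + x) powr (- (a + b)) / (1 + x)"
    using assms by (simp add: powr_diff)
  have "(beta_corr a b has_real_derivative
      ((a * x powr (a - 1)) * (1 + x) powr (- (a + b)) + x powr a * (- (a + b) * (1 + x) powr (- (a + b) - 1))) / b) (at x)"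
    unfolding beta_corr_def[abs_def] using assms
    by (auto intro!: derivative_eq_intros)
  also have "((a * x powr (a - 1)) * (1 + x) powr (- (a + b)) + x powr a * (- (a + b) * (1 + x) powr (- (a + b) - 1))) / b
     = ((a + b) / b * beta_kernel a b x / (1 + x) - beta_kernel a b x)"
    unfolding e e2 beta_kernel_def using assms by (simp add: divide_simps) (simp add: algebra_simps)
  finally show ?thesis .
qed

lemma beta_sum_deriv:
  assumes "a > 0" "b > 0" "x > 0"
  shows "((\<lambda>x. beta_cdf a b x + beta_corr a b x) has_real_derivative ((a + b) / b * beta_kernel a b x / (1 + x))) (at x)"
  using DERIV_add[OF beta_cdf_deriv[OF assms] beta_corr_deriv[OF assms]] by simp

lemma beta_corr_continuous:
  assumes "a > 0" "b > 0"
  shows "continuous_on {0..x} (beta_corr a b)"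
  unfolding beta_corr_def[abs_def] using assms by (intro continuous_intros continuous_on_powr') auto

section \<open>Substitution of the odds r t / (1 - r t) in the incomplete beta integrals\<close>

lemma odds_scaled_deriv:
  assumes "r < 1" "0 \<le> r" "0 < t" "t < (1::real)"
  shows "((\<lambda>t. r * t / (1 - r * t)) has_real_derivative r / (1 - r * t)\<^sup>2) (at t)"
proof -
  have "r * t < 1" using assms mult_mono[of r 1 t 1] mult_less_cancel_right2[of t r]
    by (smt (verit) mult_left_le)
  then have n: "1 - r * t \<noteq> 0" by simp
  have "((\<lambda>t. r * t / (1 - r * t)) has_real_derivative (r * (1 - r * t) - r * t * (0 - r)) / ((1 - r * t) * (1 - r * t))) (at t)"
    using n by (intro DERIV_divide) (auto intro!: derivative_eq_intros)
  then show ?thesis by (simp add: power2_eq_square algebra_simps)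
qed

lemma odds_props:
  fixes r t :: real
  assumes "0 < r" "r < 1" "0 \<le> t" "t \<le> 1"
  shows "r * t < 1" "0 \<le> r * t / (1 - r * t)" "r * t / (1 - r * t) \<le> r / (1 - r)"
    "1 + r * t / (1 - r * t) = 1 / (1 - r * t)" "0 < t \<Longrightarrow> 0 < r * t / (1 - r * t)"
proof -
  show 1: "r * t < 1" using assms by (smt (verit) mult_left_le)
  then show "0 \<le> r * t / (1 - r * t)" using assms by simp
  have "r * t \<le> r" using assms by (simp add: mult_left_le)
  then show "r * t / (1 - r * t) \<le> r / (1 - r)" using 1 assms by (intro frac_le) auto
  show "1 + r * t / (1 - r * t) = 1 / (1 - r * t)" using 1 by (simp add: field_simps)
  show "0 < t \<Longrightarrow> 0 < r * t / (1 - r * t)" using 1 assms by simp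
qed

lemma odds_continuous:
  fixes r :: real
  assumes "0 < r" "r < 1"
  shows "continuous_on {0..1} (\<lambda>t. r * t / (1 - r * t))"
proof (intro continuous_intros ballI)
  fix t :: real assume "t \<in> {0..1}"
  then show "1 - r * t \<noteq> 0" using odds_props(1)[OF assms, of t] by auto
qed

lemma beta_kernel_odds:
  assumes "0 < r" "r < 1" "0 < t" "t < 1"
  shows "beta_kernel a b (r * t / (1 - r * t)) * (r / (1 - r * t)\<^sup>2) = r powr a * (t powr (a - 1) * (1 - r * t) powr (b - 1))"
proof -
  let ?u = "1 - r * t"
  have u: "?u > 0" using odds_props(1)[of r t] assms by auto
  have "beta_kernel a b (r * t / ?u) = (r * t / ?u) powr (a - 1) * (1 / ?u) powr (- (a + b))"
    using odds_props(4)[of r t] assms by (simp add: beta_kernel_def)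
  also have "\<dots> = r powr (a - 1) * t powr (a - 1) * ?u powr (- (a - 1)) * ?u powr (a + b)"
  proof -
    have "(r * t / ?u) powr (a - 1) = (r powr (a - 1) * t powr (a - 1)) / ?u powr (a - 1)"
      using u assms by (simp add: powr_divide powr_mult)
    moreover have "(1 / ?u) powr (- (a + b)) = ?u powr (a + b)"
      using u powr_minus_divide[of ?u "- (a + b)"] by (simp add: powr_divide add.commute)
    ultimately show ?thesis using u powr_minus_divide[of ?u "a - 1"] by simp
  qed
  also have "\<dots> = r powr (a - 1) * t powr (a - 1) * ?u powr (b - 1 + 2)"
    by (simp add: powr_add[symmetric] algebra_simps)
  also have "\<dots> = r powr (a - 1) * t powr (a - 1) * (?u powr (b - 1) * ?u\<^sup>2)"
    using u by (subst powr_add) (simp add: powr_numeral)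
  finally have "beta_kernel a b (r * t / ?u) * (r / ?u\<^sup>2) = (r powr (a - 1) * r) * (t powr (a - 1) * ?u powr (b - 1))"
    using u by (simp add: field_simps)
  also have "r powr (a - 1) * r = r powr a" using assms by (simp add: powr_diff)
  finally show ?thesis .
qed

text \<open>Change of variable v = r t / (1 - r t), for which 1 + v = 1 / (1 - r t) and dv = r / (1
  - r t)^2 dt, and t = 1 corresponds to r / (1 - r). Derivatives are taken only in the open
  interval, because the integrand may blow up at t = 0.\<close>

lemma incomplete_beta_integral:
  assumes "a > 0" "b > 0" "0 < r" "r < 1"
  shows "((\<lambda>t. t powr (a - 1) * (1 - r * t) powr (b - 1)) has_integral (beta_cdf a b (r / (1 - r)) / r powr a)) {0..1}"
proof -
  have "((\<lambda>t. r powr a * (t powr (a - 1) * (1 - r * t) powr (b - 1))) has_integral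
      (beta_cdf a b (r * 1 / (1 - r * 1)) - beta_cdf a b (r * 0 / (1 - r * 0)))) {0..1}"
  proof (rule fundamental_theorem_of_calculus_interior)
    show "continuous_on {0..1} (\<lambda>t. beta_cdf a b (r * t / (1 - r * t)))"
      by (rule continuous_on_compose2[OF beta_cdf_continuous[OF assms(1,2), of "r / (1 - r)"]])
         (use odds_props(2,3)[OF assms(3,4)] odds_continuous[OF assms(3,4)] in auto)
    fix t :: real assume t: "t \<in> {0<..<1}"
    have "((\<lambda>t. beta_cdf a b (r * t / (1 - r * t))) has_real_derivative
        beta_kernel a b (r * t / (1 - r * t)) * (r / (1 - r * t)\<^sup>2)) (at t)"
      by (rule DERIV_chain2[OF beta_cdf_deriv odds_scaled_deriv]) (use t assms odds_props(5) in auto)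
    then show "((\<lambda>t. beta_cdf a b (r * t / (1 - r * t))) has_vector_derivative
        r powr a * (t powr (a - 1) * (1 - r * t) powr (b - 1))) (at t)"
      using beta_kernel_odds[of r t a b] t assms
      by (simp add: has_real_derivative_iff_has_vector_derivative)
  qed auto
  from has_integral_mult_right[OF this, of "1 / r powr a"] show ?thesis
    using assms by simp
qed

text \<open>One more power of 1 - r t is a factor 1 / (1 + v), which \<open>beta_corr\<close>
  accounts for. Both integrals in \<open>phiH\<close> are thus expressed with the same parameters a
  and b.\<close>

lemma incomplete_beta_integral_Suc:
  assumes "a > 0" "b > 0" "0 < r" "r < 1"
  shows "((\<lambda>t. t powr (a - 1) * (1 - r * t) powr b) has_integral
     (b / (a + b) * (beta_cdf a b (r / (1 - r)) + beta_corr a b (r / (1 - r))) / r powr a)) {0..1}"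
proof -
  let ?S = "\<lambda>x. b / (a + b) * (beta_cdf a b x + beta_corr a b x)"
  have "((\<lambda>t. r powr a * (t powr (a - 1) * (1 - r * t) powr b)) has_integral
      (?S (r * 1 / (1 - r * 1)) - ?S (r * 0 / (1 - r * 0)))) {0..1}"
  proof (rule fundamental_theorem_of_calculus_interior)
    have c: "continuous_on {0..r / (1 - r)} ?S"
      by (intro continuous_intros beta_cdf_continuous beta_corr_continuous assms)
    show "continuous_on {0..1} (\<lambda>t. ?S (r * t / (1 - r * t)))"
      by (rule continuous_on_compose2[OF c])
         (use odds_props(2,3)[OF assms(3,4)] odds_continuous[OF assms(3,4)] in auto)
    fix t :: real assume t: "t \<in> {0<..<1}"
    let ?x = "r * t / (1 - r * t)"
    have x: "1 + ?x = 1 / (1 - r * t)" "?x > 0" "r * t < 1" using odds_props[of r t] assms t by auto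
    have "((\<lambda>t. ?S (r * t / (1 - r * t))) has_real_derivative
        (b / (a + b) * ((a + b) / b * beta_kernel a b ?x / (1 + ?x))) * (r / (1 - r * t)\<^sup>2)) (at t)"
      by (rule DERIV_chain2[where f = ?S, OF DERIV_cmult[OF beta_sum_deriv] odds_scaled_deriv]) (use t assms odds_props(5) in auto)
    also have "(b / (a + b) * ((a + b) / b * beta_kernel a b ?x / (1 + ?x))) * (r / (1 - r * t)\<^sup>2)
       = (beta_kernel a b ?x  * (r / (1 - r * t)\<^sup>2)) * (1 - r * t)"
        unfolding x(1) using assms by simp
    also have "\<dots> = r powr a * (t powr (a - 1) * ((1 - r * t) powr (b - 1) * (1 - r * t)))"
      using beta_kernel_odds[of r t a b] t assms by simp
    also have "(1 - r * t) powr (b - 1) * (1 - r * t) = (1 - r * t) powr b"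
      using x by (simp add: powr_diff)
    finally show "((\<lambda>t. ?S (r * t / (1 - r * t))) has_vector_derivative
        r powr a * (t powr (a - 1) * (1 - r * t) powr b)) (at t)"
      by (simp add: has_real_derivative_iff_has_vector_derivative)
  qed auto
  from has_integral_mult_right[OF this, of "1 / r powr a"] show ?thesis
    using assms by (simp add: beta_corr_def mult.commute[of "a + b"])
qed

text \<open>The lower bound integrates the pointwise inequality between the powers b and b - 1 of 1
  - r t; with a = p / 2 - 1 and b = m / 2 it equals m / (n - 3). The upper bound is the positivity
  of \<open>beta_corr\<close>.\<close>

lemma shrink_bounds:
  assumes "a > 0" "b > 0" "x > 0"
  shows "b / (a + b) \<le> shrink a b x" "0 < shrink a b x" "shrink a b x < 1"
proof -
  define r where "r = x / (1 + x)"
  have r: "0 < r" "r < 1" "r / (1 - r) = x" using assms by (auto simp: r_def field_simps)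
  have "b / (a + b) * (beta_cdf a b x + beta_corr a b x) / r powr a \<le> beta_cdf a b x / r powr a"
  proof (rule has_integral_le)
    show "((\<lambda>t. t powr (a - 1) * (1 - r * t) powr b) has_integral
       b / (a + b) * (beta_cdf a b x + beta_corr a b x) / r powr a) {0..1}"
      using incomplete_beta_integral_Suc[of a b r] assms r by simp
    show "((\<lambda>t. t powr (a - 1) * (1 - r * t) powr (b - 1)) has_integral beta_cdf a b x / r powr a) {0..1}"
      using incomplete_beta_integral[of a b r] assms r by simp
    fix t :: real assume t: "t \<in> {0..1}"
    then show "t powr (a - 1) * (1 - r * t) powr b \<le> t powr (a - 1) * (1 - r * t) powr (b - 1)"
      using odds_props(1)[of r t] r by (intro mult_left_mono powr_mono') auto
  qed
  then have "b / (a + b) * (beta_cdf a b x + beta_corr a b x) \<le> beta_cdf a b x"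
    using r by (subst (asm) divide_le_cancel) (auto simp: powr_gt_zero dest: order.strict_trans2)
  moreover have p: "beta_cdf a b x > 0" "beta_corr a b x > 0"
    using beta_cdf_pos beta_corr_pos assms by auto
  ultimately show "b / (a + b) \<le> shrink a b x"
    by (simp add: shrink_def pos_le_divide_eq)
  show "0 < shrink a b x" "shrink a b x < 1" using p by (auto simp: shrink_def field_simps)
qed

text \<open>\<open>shrink\<close> increases with the quotient of \<open>beta_cdf\<close> by
  \<open>beta_corr\<close>, and this quotient is b times the integral over t in [0, 1] of \<open>(1
  - r) powr (- b) * (t powr (a - 1) * (1 - r * t) powr (b - 1))\<close>, whose integrand increases
  with r and decreases with a. Monotonicity in x is needed for the passage to scale mixtures,
  monotonicity in a for the noncentral components.\<close>

lemma shrink_mono: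
  assumes a: "a > 0" "b > 0" and x: "0 < x" "x \<le> y" and a': "a \<le> a'"
  shows "shrink a' b x \<le> shrink a b y"
proof -
  define r where "r = x / (1 + x)"
  define s where "s = y / (1 + y)"
  have y: "y > 0" using x by simp
  have r: "0 < r" "r < 1" "r / (1 - r) = x" "1 / (1 - r) = 1 + x" using x by (auto simp: r_def field_simps)
  have s: "0 < s" "s < 1" "s / (1 - s) = y" "1 / (1 - s) = 1 + y" using y by (auto simp: s_def field_simps)
  have rs: "r \<le> s" using x y by (simp add: r_def s_def field_simps)
  have le: "(1 - r) powr (- b) * (beta_cdf a' b x / r powr a') \<le> (1 - s) powr (- b) * (beta_cdf a b y / s powr a)"
  proof (rule has_integral_le)
    show "((\<lambda>t. (1 - r) powr (- b) * (t powr (a' - 1) * (1 - r * t) powr (b - 1))) has_integral (1 - r) powr (- b) * (beta_cdf a' b x / r powr a')) {0..1}"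
      using incomplete_beta_integral[of a' b r] assms r by (intro has_integral_mult_right) simp
    show "((\<lambda>t. (1 - s) powr (- b) * (t powr (a - 1) * (1 - s * t) powr (b - 1))) has_integral (1 - s) powr (- b) * (beta_cdf a b y / s powr a)) {0..1}"
      using incomplete_beta_integral[of a b s] assms s by (intro has_integral_mult_right) simp
    fix t :: real assume t: "t \<in> {0..1}"
    have rt: "r * t < 1" "s * t < 1" using odds_props(1)[of r t] odds_props(1)[of s t] t r s by auto
    have "(1 - r) powr (- b) * (1 - r * t) powr (b - 1) \<le> (1 - s) powr (- b) * (1 - s * t) powr (b - 1)"
    \<comment> \<open>For b > 1 the factor \<open>(1 - r * t) powr (b - 1)\<close> decreases with r,
      so it is paired with b - 1 powers of 1 / (1 - r): the quotient (1 - r t) / (1 - r) increases.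
      For b < 1 the two factors increase separately.\<close>
    proof (cases "b \<ge> 1")
      case True
      have q: "(1 - r * t) / (1 - r) \<le> (1 - s * t) / (1 - s)"
      proof -
        have "(1 - t) * r \<le> (1 - t) * s" using rs t by (intro mult_left_mono) auto
        then show ?thesis using r s by (simp add: field_simps)
      qed
      have e: "(1 - r) powr (- b) * (1 - r * t) powr (b - 1) = ((1 - r * t) / (1 - r)) powr (b - 1) * (1 / (1 - r))"
        if "r < 1" "r * t < 1" for r
      proof -
        have "(1 - r) powr (- b) = (1 - r) powr (- (b - 1)) * (1 - r) powr (- 1)"
          by (subst powr_add[symmetric]) simp
        moreover have "(1 - r) powr (- 1) = 1 / (1 - r)" using that by (subst powr_minus_divide) simp
        moreover have "(1 - r) powr (- (b - 1)) = 1 / (1 - r) powr (b - 1)" by (rule powr_minus_divide)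
        ultimately show ?thesis using that by (simp add: powr_divide del: minus_diff_eq)
      qed
      have "((1 - r * t) / (1 - r)) powr (b - 1) * (1 / (1 - r)) \<le> ((1 - s * t) / (1 - s)) powr (b - 1) * (1 / (1 - s))"
        using True q r s rs rt by (intro mult_mono powr_mono2) (auto simp: field_simps)
      then show ?thesis using e[of r] e[of s] r s rt by simp
    next
      case False
      have "s * t \<ge> r * t" using rs t by (simp add: mult_right_mono)
      then show ?thesis using False r s rs rt assms
        by (intro mult_mono powr_mono2') auto
    qed
    moreover have "t powr (a' - 1) \<le> t powr (a - 1)"
      using t a' by (intro powr_mono') auto
    ultimately have "t powr (a' - 1) * ((1 - r) powr (- b) * (1 - r * t) powr (b - 1)) \<le> t powr (a - 1) * ((1 - s) powr (- b) * (1 - s * t) powr (b - 1))"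
      by (intro mult_mono[of "t powr (a' - 1)"]) simp_all
    then show "(1 - r) powr (- b) * (t powr (a' - 1) * (1 - r * t) powr (b - 1)) \<le> (1 - s) powr (- b) * (t powr (a - 1) * (1 - s * t) powr (b - 1))"
      by (simp add: mult_ac)
  qed
  have e: "(1 - r) powr (- b) * (beta_cdf a b x / r powr a) = beta_cdf a b x / beta_corr a b x / b"
    if "0 < x" "r = x / (1 + x)" for a x r
  proof -
    have "1 - r = 1 / (1 + x)" using that by (simp add: field_simps)
    moreover have "r powr a = x powr a * (1 + x) powr (- a)"
      using that powr_minus_divide[of "1 + x" a] by (simp add: powr_divide)
    moreover have "(1 + x) powr (- (a + b)) = (1 + x) powr (- a) * (1 + x) powr (- b)"
      by (simp add: powr_add[symmetric])
    ultimately show ?thesis using that assms powr_minus_divide[of "1 + x" a] powr_minus_divide[of "1 + x" b] powr_minus_divide[of "1 - r" b]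
      by (simp add: beta_corr_def powr_divide del: minus_add_distrib)
  qed
  have le2: "beta_cdf a' b x / beta_corr a' b x \<le> beta_cdf a b y / beta_corr a b y"
  proof -
    have "beta_cdf a' b x / beta_corr a' b x / b \<le> beta_cdf a b y / beta_corr a b y / b"
      using le e[of x r a'] e[of y s a] x y by (simp add: r_def s_def)
    then show ?thesis using a(2) by (subst (asm) divide_le_cancel) auto
  qed
  have p: "beta_cdf a' b x > 0" "beta_corr a' b x > 0" "beta_cdf a b y > 0" "beta_corr a b y > 0"
    using beta_cdf_pos beta_corr_pos assms y by auto
  have "beta_cdf a' b x * beta_corr a b y \<le> beta_cdf a b y * beta_corr a' b x"
    using le2 p by (simp add: frac_le_eq divide_le_eq pos_le_divide_eq mult.commute)
  then have "beta_cdf a' b x * (beta_cdf a b y + beta_corr a b y) \<le> beta_cdf a b y * (beta_cdf a' b x + beta_corr a' b x)"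
    by (simp add: algebra_simps)
  then show ?thesis using p by (simp add: shrink_def divide_le_eq pos_le_divide_eq mult.commute)
qed

lemma beta_cdf_measurable [measurable]:
  assumes "a > 0" "b > 0"
  shows "beta_cdf a b \<in> borel_measurable borel"
  by (rule borel_measurable_mono) (simp add: mono_def beta_cdf_mono assms)

lemma beta_corr_measurable [measurable]: "beta_corr a b \<in> borel_measurable borel"
  unfolding beta_corr_def[abs_def] by measurable

lemma shrink_measurable [measurable]:
  assumes "a > 0" "b > 0"
  shows "shrink a b \<in> borel_measurable borel"
  unfolding shrink_def[abs_def] using assms by measurable

text \<open>The sign is inferred from \<open>shrink_mono\<close>; the quotient rule supplies only
  differentiability.\<close>

lemma shrink_deriv:
  assumes "a > 0" "b > 0" "x > 0"
  obtains D where "(shrink a b has_real_derivative D) (at x)" "0 \<le> D"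
proof -
  have "beta_cdf a b x + beta_corr a b x \<noteq> 0"
    using beta_cdf_pos[OF assms] beta_corr_pos[OF assms(3,2), of a] by simp
  from DERIV_divide[OF beta_cdf_deriv[OF assms] beta_sum_deriv[OF assms] this]
  obtain D where D: "(shrink a b has_real_derivative D) (at x)"
    unfolding shrink_def[abs_def] by blast
  moreover have "0 \<le> D"
  proof (rule mono_on_imp_deriv_nonneg[OF _ D])
    show "mono_on {0<..} (shrink a b)" using assms by (auto simp: monotone_on_def intro!: shrink_mono)
    show "x \<in> interior {0<..}" using assms by (simp add: interior_open)
  qed
  ultimately show ?thesis using that by blast
qed

lemma one_minus_shrink_tendsto:
  assumes "a > 0" "b > 0"
  shows "((\<lambda>x. 1 - shrink a b x) \<longlongrightarrow> 0) at_top"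
proof (rule tendsto_sandwich)
  let ?G = "beta_cdf a b 1"
  have G: "?G > 0" using beta_cdf_pos[of a b 1] assms by simp
  show "\<forall>\<^sub>F x in at_top. 0 \<le> 1 - shrink a b x"
    using eventually_gt_at_top[of 0] by eventually_elim (use shrink_bounds(3) assms in fastforce)
  show "\<forall>\<^sub>F x in at_top. 1 - shrink a b x \<le> ((1 + x) powr (- b) / b) / ?G"
    using eventually_ge_at_top[of 1]
  proof eventually_elim
    case (elim x)
    have p: "beta_cdf a b x > 0" "beta_corr a b x > 0" "?G \<le> beta_cdf a b x"
      using beta_cdf_pos beta_corr_pos assms elim beta_cdf_mono by auto
    have "1 - shrink a b x = beta_corr a b x / (beta_cdf a b x + beta_corr a b x)"
      using p by (simp add: shrink_def field_simps)
    also have "\<dots> \<le> beta_corr a b x / ?G"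
      using p G by (intro divide_left_mono) auto
    also have "beta_corr a b x \<le> (1 + x) powr (- b) / b"
    proof -
      have "x powr a * (1 + x) powr (- (a + b)) \<le> (1 + x) powr a * (1 + x) powr (- (a + b))"
        using elim assms by (intro mult_right_mono powr_mono2) auto
      also have "\<dots> = (1 + x) powr (- b)" by (simp add: powr_add[symmetric])
      finally show ?thesis using assms by (simp add: beta_corr_def divide_right_mono)
    qed
    finally show ?case using G by (simp add: divide_right_mono)
  qed
  have "((\<lambda>x. (1 + x) powr (- b)) \<longlongrightarrow> 0) at_top"
    using assms by (intro tendsto_neg_powr filterlim_tendsto_add_at_top[OF tendsto_const]) (auto simp: filterlim_ident)
  from tendsto_divide[OF tendsto_divide[OF this tendsto_const[of b]] tendsto_const[of ?G]]
  show "((\<lambda>x. ((1 + x) powr (- b) / b) / ?G) \<longlongrightarrow> 0) at_top" using assms G by simp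
qed auto

section \<open>The risk comparison for one central component, as an inequality on the
  half-line\<close>

lemma ennreal_add_le: "ennreal (x + y) \<le> ennreal x + ennreal y"
  by (cases "0 \<le> x"; cases "0 \<le> y") (auto simp: ennreal_neg ennreal_plus[symmetric] simp del: ennreal_plus intro: ennreal_leI)

text \<open>Integration by parts in the style of Kubokawa: \<open>U\<close> is an antiderivative of the difference
  of the two integrands up to the term \<open>\<phi>' (G / \<phi>\<^sub>a - G / \<phi>)\<close>, which is nonnegative because
  \<open>\<phi>\<close> is nondecreasing and dominates \<open>\<phi>\<^sub>a\<close>.\<close>

lemma shrink_log_le_shrink_linear:
  assumes a0: "a0 > 0" "a0 \<le> a" and b: "b > 0"
  shows "(\<integral>\<^sup>+x\<in>{0<..}. ennreal (- ln (shrink a0 b x) * beta_kernel a b x) \<partial>lborel)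
    \<le> (\<integral>\<^sup>+x\<in>{0<..}. ennreal ((1 - shrink a0 b x) * ((a + b) / b / (1 + x)) * beta_kernel a b x) \<partial>lborel)"
    (is "?L \<le> ?R")
proof -
  have a: "a > 0" using a0 by simp
  note [measurable] = shrink_measurable[OF a0(1) b]
  define \<phi> where "\<phi> = shrink a0 b"
  define G where "G = beta_cdf a b"
  define q where "q = beta_corr a b"
  define f1 where "f1 = (\<lambda>x. - ln (\<phi> x) * beta_kernel a b x)"
  define f2 where "f2 = (\<lambda>x. (1 - \<phi> x) * ((a + b) / b / (1 + x)) * beta_kernel a b x)"
  \<comment> \<open>Its derivative is \<open>f1 x - f2 x + D * (G x + q x - G x / \<phi> x)\<close>
    with D the derivative of \<phi>: differentiating G + q reproduces the weight of
    \<open>f2\<close>, differentiating G the logarithmic term of \<open>f1\<close>.\<close>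
  define U where "U = (\<lambda>x. (\<phi> x - 1) * (G x + q x) - ln (\<phi> x) * G x)"
  note bnd = shrink_bounds[OF a0(1) b, folded \<phi>_def]
  have f1_nn: "0 \<le> f1 x" if "x > 0" for x
    using bnd[OF that] beta_kernel_nonneg[of a b x] by (simp add: f1_def mult_nonpos_nonneg)
  have f2_nn: "0 \<le> f2 x" if "x > 0" for x
    using bnd[OF that] beta_kernel_nonneg[of a b x] that a b by (simp add: f2_def)
  have U_deriv: "\<exists>D. (U has_real_derivative D) (at x) \<and> f1 x \<le> f2 x + D" if x: "x > 0" for x
  proof -
    obtain D where D: "(\<phi> has_real_derivative D) (at x)" "0 \<le> D"
      using shrink_deriv[OF a0(1) b x] unfolding \<phi>_def by blast
    have G': "(G has_real_derivative beta_kernel a b x) (at x)"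
      unfolding G_def by (rule beta_cdf_deriv[OF a b x])
    have Gq': "((\<lambda>x. G x + q x) has_real_derivative ((a + b) / b * beta_kernel a b x / (1 + x))) (at x)"
      unfolding G_def q_def by (rule beta_sum_deriv[OF a b x])
    have p: "0 < \<phi> x" using bnd[OF x] by simp
    have "(U has_real_derivative ((D - 0) * (G x + q x) + ((a + b) / b * beta_kernel a b x / (1 + x)) * (\<phi> x - 1))
       - ((1 / \<phi> x * D) * G x + beta_kernel a b x * ln (\<phi> x))) (at x)"
      unfolding U_def
      by (intro DERIV_diff DERIV_mult Gq' G' D(1) DERIV_const DERIV_chain2[of ln] DERIV_ln_divide p)
    moreover have "0 \<le> D * (G x + q x - G x / \<phi> x)"
    proof -
      have Gp: "G x > 0" "q x > 0" using beta_cdf_pos beta_corr_pos a b x by (auto simp: G_def q_def)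
      \<comment> \<open>The left side is \<open>shrink a b x\<close>, at the larger parameter
        a.\<close>
      have "G x / (G x + q x) \<le> \<phi> x"
        using shrink_mono[OF a0(1) b x order_refl a0(2)] by (simp add: \<phi>_def shrink_def G_def q_def)
      then have "G x / \<phi> x \<le> G x + q x" using Gp p by (simp add: field_simps)
      then show ?thesis using D by simp
    qed
    moreover have "f1 x \<le> f2 x + ((D - 0) * (G x + q x) + ((a + b) / b * beta_kernel a b x / (1 + x)) * (\<phi> x - 1)
       - ((1 / \<phi> x * D) * G x + beta_kernel a b x * ln (\<phi> x)))"
    proof -
      define c where "c = (a + b) / b / (1 + x)"
      have c: "(a + b) / b * beta_kernel a b x / (1 + x) = c * beta_kernel a b x" "f2 x = (1 - \<phi> x) * c * beta_kernel a b x"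
        by (simp_all add: c_def f2_def)
      have "\<phi> x \<noteq> 0" using p by simp
      have "f2 x + ((D - 0) * (G x + q x) + ((a + b) / b * beta_kernel a b x / (1 + x)) * (\<phi> x - 1)
       - ((1 / \<phi> x * D) * G x + beta_kernel a b x * ln (\<phi> x))) = f1 x + D * (G x + q x - G x / \<phi> x)"
        unfolding f1_def c by (simp add: algebra_simps)
      with \<open>0 \<le> D * _\<close> show ?thesis by linarith
    qed
    ultimately show ?thesis by blast
  qed
  have cont_phi: "isCont \<phi> x" if "x > 0" for x
    using shrink_deriv[OF a0(1) b that] unfolding \<phi>_def by (metis DERIV_isCont)
  have cont_k: "isCont (beta_kernel a b) x" if "x > 0" for x
    unfolding beta_kernel_def[abs_def] using that by (intro continuous_intros) auto
  have cont1: "isCont f1 x" and cont2: "isCont f2 x" if "x > 0" for x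
    unfolding f1_def f2_def using that bnd(2)[OF that] b
    by (auto intro!: continuous_intros cont_phi cont_k)
  \<comment> \<open>On a compact interval both integrals are real numbers and can be compared
    through U. The integral of \<open>f2\<close> is then enlarged to the half-line, so that only the
    left side and the boundary values of U depend on the interval.\<close>
  have step: "(\<integral>\<^sup>+x. ennreal (f1 x) * indicator {\<epsilon>..M} x \<partial>lborel) \<le> ?R + ennreal (U M - U \<epsilon>)" if e: "0 < \<epsilon>" "\<epsilon> \<le> M" for \<epsilon> M
  proof -
    obtain D where D: "\<And>x. x > 0 \<Longrightarrow> (U has_real_derivative D x) (at x)" "\<And>x. x > 0 \<Longrightarrow> f1 x \<le> f2 x + D x"
      using U_deriv by metis
    have i1: "f1 integrable_on {\<epsilon>..M}" and i2: "f2 integrable_on {\<epsilon>..M}"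
      using e by (auto intro!: integrable_continuous_real continuous_at_imp_continuous_on cont1 cont2)
    have "(D has_integral (U M - U \<epsilon>)) {\<epsilon>..M}"
      using e D(1) by (intro fundamental_theorem_of_calculus)
        (auto simp: has_real_derivative_iff_has_vector_derivative[symmetric] intro: has_field_derivative_at_within)
    from has_integral_add[OF integrable_integral[OF i2] this]
    have le: "integral {\<epsilon>..M} f1 \<le> integral {\<epsilon>..M} f2 + (U M - U \<epsilon>)"
      by (rule has_integral_le[OF integrable_integral[OF i1]]) (use D(2) e in auto)
    have n: "(\<integral>\<^sup>+x. ennreal (f x) * indicator {\<epsilon>..M} x \<partial>lborel) = ennreal (integral {\<epsilon>..M} f)"
      if "f integrable_on {\<epsilon>..M}" "\<And>x. x > 0 \<Longrightarrow> 0 \<le> f x" for f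
      using that(2) e by (intro nn_integral_has_integral_lebesgue' integrable_integral[OF that(1)]) auto
    have "ennreal (integral {\<epsilon>..M} f1) \<le> ennreal (integral {\<epsilon>..M} f2 + (U M - U \<epsilon>))"
      using le by (rule ennreal_leI)
    also have "\<dots> \<le> ennreal (integral {\<epsilon>..M} f2) + ennreal (U M - U \<epsilon>)"
      by (rule ennreal_add_le)
    also have "ennreal (integral {\<epsilon>..M} f2) = (\<integral>\<^sup>+x. ennreal (f2 x) * indicator {\<epsilon>..M} x \<partial>lborel)"
      using n[OF i2 f2_nn] by simp
    also have "\<dots> \<le> (\<integral>\<^sup>+x. ennreal (f2 x) * indicator {0<..} x \<partial>lborel)"
      using e by (intro nn_integral_mono) (auto split: split_indicator)
    finally show ?thesis using n[OF i1 f1_nn] unfolding f2_def \<phi>_def by (simp add: add_right_mono)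
  qed
  obtain K where K: "K \<ge> 0" "\<And>x. x > 0 \<Longrightarrow> G x \<le> K"
    using beta_cdf_bounded[OF a b] unfolding G_def by blast
  \<comment> \<open>Right end: - ln \<phi> is at most (1 - \<phi>) / \<phi>, G is bounded, and 1 /
    \<phi> is at most (a0 + b) / b, so the bound is a constant times 1 - \<phi>, which tends to
    0.\<close>
  have UM: "U M \<le> (1 - \<phi> M) * (K * ((a0 + b) / b))" if M: "M > 0" for M
  proof -
    have p: "G M > 0" "q M > 0" "G M \<le> K" using beta_cdf_pos beta_corr_pos a b M K by (auto simp: G_def q_def)
    have "- ln (\<phi> M) = ln (1 / \<phi> M)" using bnd[OF M] by (simp add: ln_div)
    also have "\<dots> \<le> 1 / \<phi> M - 1" using bnd[OF M] by (intro ln_le_minus_one) auto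
    finally have l: "- ln (\<phi> M) \<le> (1 - \<phi> M) / \<phi> M" using bnd[OF M] by (simp add: field_simps)
    have "U M \<le> - ln (\<phi> M) * G M"
      unfolding U_def using bnd[OF M] p by (simp add: mult_nonpos_nonneg)
    also have "\<dots> \<le> (1 - \<phi> M) / \<phi> M * G M" using l p by (intro mult_right_mono) auto
    also have "\<dots> = (1 - \<phi> M) * (G M * (1 / \<phi> M))" by simp
    also have "\<dots> \<le> (1 - \<phi> M) * (K * ((a0 + b) / b))"
    proof (intro mult_left_mono mult_mono)
      have "1 / \<phi> M \<le> 1 / (b / (a0 + b))" using bnd[OF M] a0 b by (intro divide_left_mono) auto
      then show "1 / \<phi> M \<le> (a0 + b) / b" by simp
    qed (use bnd[OF M] p K in auto)
    finally show ?thesis .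
  qed
  \<comment> \<open>Left end: ln \<phi> \<le> \<phi> - 1 cancels the terms with G and leaves at most
    q, which vanishes at 0.\<close>
  have Ue: "- U e \<le> q e" if e: "e > 0" for e
  proof -
    have p: "G e > 0" "q e > 0" using beta_cdf_pos beta_corr_pos a b e by (auto simp: G_def q_def)
    have "ln (\<phi> e) \<le> \<phi> e - 1" using bnd[OF e] by (intro ln_le_minus_one) auto
    then have "ln (\<phi> e) * G e \<le> (\<phi> e - 1) * G e" using p by (intro mult_right_mono) auto
    then have "- U e \<le> (1 - \<phi> e) * q e" unfolding U_def by (simp add: algebra_simps)
    also have "\<dots> \<le> 1 * q e" using bnd[OF e] p by (intro mult_right_mono) auto
    finally show ?thesis by simp
  qed
  define err where "err = (\<lambda>k::nat. (1 - \<phi> (real k + 1)) * (K * ((a0 + b) / b)) + q (1 / (real k + 1)))"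
  have lim1: "(\<lambda>k. \<integral>\<^sup>+x. ennreal (f1 x) * indicator {1 / (real k + 1)..real k + 1} x \<partial>lborel) \<longlonglongrightarrow> (\<integral>\<^sup>+x. ennreal (f1 x) * indicator {0<..} x \<partial>lborel)"
  proof (rule nn_integral_LIMSEQ)
    show "incseq (\<lambda>k x. ennreal (f1 x) * indicator {1 / (real k + 1)..real k + 1} x)"
    proof (intro incseq_SucI le_funI mult_left_mono)
      fix k x
      have "1 / (real (Suc k) + 1) \<le> 1 / (real k + 1)" by (intro divide_left_mono) auto
      then show "indicator {1 / (real k + 1)..real k + 1} x \<le> (indicator {1 / (real (Suc k) + 1)..real (Suc k) + 1} x :: ennreal)"
        by (auto split: split_indicator)
    qed auto
    show "(\<lambda>x. ennreal (f1 x) * indicator {1 / (real k + 1)..real k + 1} x) \<in> borel_measurable lborel" for k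
      unfolding f1_def \<phi>_def by measurable
    show "(\<lambda>k. ennreal (f1 x) * indicator {1 / (real k + 1)..real k + 1} x) \<longlonglongrightarrow> ennreal (f1 x) * indicator {0<..} x" for x
    proof (cases "x > 0")
      case True
      obtain N where N: "real N > max x (1 / x)" using reals_Archimedean2 by blast
      have "\<forall>\<^sub>F k in sequentially. ennreal (f1 x) * indicator {1 / (real k + 1)..real k + 1} x = ennreal (f1 x) * indicator {0<..} x"
        using eventually_ge_at_top[of N]
      proof eventually_elim
        case (elim k)
        then have "1 / x \<le> real k + 1" "x \<le> real k + 1" using N by auto
        then have "1 / (real k + 1) \<le> x" using True by (simp add: field_simps)
        then show ?case using True \<open>x \<le> real k + 1\<close> by simp
      qed
      then show ?thesis by (rule tendsto_eventually)
    next
      case False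
      have "\<not> 1 / (real k + 1) \<le> x" for k using False by (simp add: not_le) (smt (verit) divide_pos_pos of_nat_0_le_iff)
      then show ?thesis using False by (simp add: indicator_def)
    qed
  qed
  have "err \<longlonglongrightarrow> 0 * (K * ((a0 + b) / b)) + q 0"
    unfolding err_def
  proof (intro tendsto_intros)
    have r: "filterlim (\<lambda>k. real k + 1) at_top sequentially"
      using filterlim_tendsto_add_at_top[OF tendsto_const[of 1] filterlim_real_sequentially]
      by (simp add: add.commute)
    show "(\<lambda>k. 1 - \<phi> (real k + 1)) \<longlonglongrightarrow> 0"
      unfolding \<phi>_def by (rule filterlim_compose[OF one_minus_shrink_tendsto[OF a0(1) b] r])
    have c: "continuous_on {0..1} q" unfolding q_def by (rule beta_corr_continuous[OF a b])
    have l: "(\<lambda>k. 1 / (real k + 1)) \<longlonglongrightarrow> 0"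
      using LIMSEQ_inverse_real_of_nat by (simp add: inverse_eq_divide add.commute)
    show "(\<lambda>k. q (1 / (real k + 1))) \<longlonglongrightarrow> q 0"
      by (rule continuous_on_tendsto_compose[OF c l]) auto
  qed
  then have err0: "(\<lambda>k. ennreal (err k)) \<longlonglongrightarrow> ennreal 0" using a b
    by (intro tendsto_ennrealI) (simp add: q_def beta_corr_def)
  have lim2: "(\<lambda>k. ?R + ennreal (err k)) \<longlonglongrightarrow> ?R + ennreal 0"
    by (intro tendsto_add tendsto_const err0)
  have "(\<integral>\<^sup>+x. ennreal (f1 x) * indicator {0<..} x \<partial>lborel) \<le> ?R + ennreal 0"
  proof (rule LIMSEQ_le[OF lim1 lim2], intro exI allI impI)
    fix k :: nat
    have "U (real k + 1) - U (1 / (real k + 1)) \<le> err k"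
      using UM[of "real k + 1"] Ue[of "1 / (real k + 1)"] by (simp add: err_def)
    moreover have "1 / (real k + 1) \<le> real k + 1" by (simp add: field_simps)
    ultimately show "(\<integral>\<^sup>+x. ennreal (f1 x) * indicator {1 / (real k + 1)..real k + 1} x \<partial>lborel) \<le> ?R + ennreal (err k)"
      using step[of "1 / (real k + 1)" "real k + 1"]
      by (meson add_left_mono ennreal_leI order_trans divide_pos_pos zero_less_one of_nat_0_le_iff add_nonneg_pos)
  qed
  then show ?thesis by (simp add: f1_def \<phi>_def)
qed

section \<open>The linear model\<close>

lemma borel_measurable_linear:
  fixes f :: "'a::euclidean_space \<Rightarrow> 'b::euclidean_space"
  assumes "linear f"
  shows "f \<in> borel_measurable borel"
  using assms by (simp add: borel_measurable_continuous_onI linear_continuous_on linear_conv_bounded_linear)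

lemma nn_integral_translate:
  fixes h :: "'a::euclidean_space \<Rightarrow> ennreal"
  assumes [measurable]: "h \<in> borel_measurable borel"
  shows "(\<integral>\<^sup>+x. h (c + x) \<partial>lborel) = (\<integral>\<^sup>+x. h x \<partial>lborel)"
proof -
  have "(\<integral>\<^sup>+x. h x \<partial>distr lborel borel ((+) c)) = (\<integral>\<^sup>+x. h (c + x) \<partial>lborel)"
    by (rule nn_integral_distr) simp_all
  then show ?thesis by (simp add: lborel_distr_plus)
qed

text \<open>The uniqueness argument for Haar measure: for the unit ball \<open>B\<close>, translating first \<open>y\<close> and
  then \<open>x\<close> in \<open>\<integral>\<integral> B(x) h(f y) dy dx\<close> moves \<open>f\<close> onto the ball, which is invariant under \<open>f\<close>.\<close>

lemma nn_integral_orthogonal: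
  fixes f :: "'a::euclidean_space \<Rightarrow> 'a"
  assumes f: "orthogonal_transformation f" and [measurable]: "h \<in> borel_measurable borel"
  shows "(\<integral>\<^sup>+x. h (f x) \<partial>lborel) = (\<integral>\<^sup>+x. h x \<partial>lborel)"
proof -
  have lf: "linear f" using f by (rule orthogonal_transformation_linear)
  have [measurable]: "f \<in> borel_measurable borel" by (rule borel_measurable_linear[OF lf])
  define B :: "'a \<Rightarrow> ennreal" where "B = indicator (ball 0 1)"
  have [measurable]: "B \<in> borel_measurable borel"
    unfolding B_def by (intro borel_measurable_indicator borel_open open_ball)
  define V where "V = (\<integral>\<^sup>+x. B x \<partial>lborel)"
  have "V = emeasure lborel (ball (0::'a) 1)" by (simp add: V_def B_def)
  then have V: "V \<noteq> 0" "V \<noteq> \<infinity>"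
    using emeasure_lborel_ball_finite[of "0::'a" 1] content_ball_pos[of 1 "0::'a"]
    by (auto simp: measure_def)
  have BN: "B (- f y) = B y" for y
    by (simp add: B_def indicator_def orthogonal_transformation_norm[OF f])
  have fi: "f (inv f x) = x" for x using orthogonal_transformation_surj[OF f] by (simp add: surj_f_inv_f)
  have shift: "(\<integral>\<^sup>+y. k (f y + x) \<partial>lborel) = (\<integral>\<^sup>+y. k (f y) \<partial>lborel)"
    if [measurable]: "k \<in> borel_measurable borel" for k :: "'a \<Rightarrow> ennreal" and x
    using nn_integral_translate[of "\<lambda>y. k (f y)" "inv f x"] by (simp add: linear_add[OF lf] fi add.commute)
  have "V * (\<integral>\<^sup>+y. h (f y) \<partial>lborel) = (\<integral>\<^sup>+x. B x * (\<integral>\<^sup>+y. h (f y + x) \<partial>lborel) \<partial>lborel)"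
    unfolding V_def by (subst shift) (simp_all add: nn_integral_multc)
  also have "\<dots> = (\<integral>\<^sup>+y. (\<integral>\<^sup>+x. B x * h (f y + x) \<partial>lborel) \<partial>lborel)"
    by (subst lborel_pair.Fubini') (simp_all add: nn_integral_cmult)
  also have "\<dots> = (\<integral>\<^sup>+y. (\<integral>\<^sup>+x. B (x - f y) * h x \<partial>lborel) \<partial>lborel)"
  proof (rule nn_integral_cong)
    fix y
    show "(\<integral>\<^sup>+x. B x * h (f y + x) \<partial>lborel) = (\<integral>\<^sup>+x. B (x - f y) * h x \<partial>lborel)"
      using nn_integral_translate[of "\<lambda>x. B (x - f y) * h x" "f y"] by simp
  qed
  also have "\<dots> = (\<integral>\<^sup>+x. h x * (\<integral>\<^sup>+y. B (- (f y + - x)) \<partial>lborel) \<partial>lborel)"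
    by (subst lborel_pair.Fubini') (simp_all add: nn_integral_cmult mult.commute)
  also have "\<dots> = (\<integral>\<^sup>+x. h x * V \<partial>lborel)"
    by (subst shift[of "\<lambda>y. B (- y)"]) (simp_all add: V_def BN)
  also have "\<dots> = V * (\<integral>\<^sup>+x. h x \<partial>lborel)" by (simp add: nn_integral_multc mult.commute[of V])
  finally show ?thesis using V by (simp add: ennreal_mult_cancel_left)
qed

section \<open>Least squares: intercept, coefficients and residual as orthogonal components\<close>

definition lscoef :: "real^'p^'n \<Rightarrow> real^'n \<Rightarrow> real^'p" where
  "lscoef X y = matrix_inv (transpose X ** X) *v (transpose X *v centered y)"

definition resid :: "real^'p^'n \<Rightarrow> real^'n \<Rightarrow> real^'n" where
  "resid X y = centered y - X *v lscoef X y"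

lemma inner_matrix_vector: "(A *v x) \<bullet> y = x \<bullet> (transpose A *v y)"
  for A :: "real^'p^'n"
  by (metis dot_lmul_matrix inner_commute transpose_matrix_vector)

lemma linear_ybar: "linear (ybar :: real^'n \<Rightarrow> real)"
  by (rule linearI) (simp_all add: ybar_def sum.distrib add_divide_distrib sum_distrib_left)

lemma linear_centered: "linear (centered :: real^'n \<Rightarrow> real^'n)"
  by (rule linearI) (simp_all add: centered_def linear_add[OF linear_ybar] linear_cmul[OF linear_ybar] algebra_simps)

lemma linear_lscoef: "linear (lscoef X)"
  unfolding lscoef_def[abs_def]
  by (rule linearI) (simp_all add: linear_add[OF linear_centered] linear_cmul[OF linear_centered]
     matrix_vector_right_distrib matrix_vector_mult_scaleR)

lemma linear_resid: "linear (resid X)"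
  unfolding resid_def[abs_def]
  by (rule linearI) (simp_all add: linear_add[OF linear_centered] linear_cmul[OF linear_centered]
     linear_add[OF linear_lscoef] linear_cmul[OF linear_lscoef] matrix_vector_right_distrib matrix_vector_mult_scaleR algebra_simps)

lemmas measurable_ybar [measurable] = borel_measurable_linear[OF linear_ybar]
lemmas measurable_lscoef [measurable] = borel_measurable_linear[OF linear_lscoef]
lemmas measurable_resid [measurable] = borel_measurable_linear[OF linear_resid]
lemmas measurable_matrix_vector [measurable] = borel_measurable_linear[OF matrix_vector_mul_linear]

lemma ones_inner_ones: "(ones :: real^'n) \<bullet> ones = real CARD('n)"
  by (simp add: ones_def inner_vec_def)

lemma ones_inner: "ones \<bullet> (y :: real^'n) = real CARD('n) * ybar y"
  by (simp add: ones_def inner_vec_def ybar_def)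

locale centered_design =
  fixes X :: "real^'p^'n"
  assumes col_sums: "\<forall>j. (\<Sum>i\<in>UNIV. X $ i $ j) = 0"
    and full_rank: "rank X = CARD('p)"
begin

lemma ones_inner_range [simp]: "ones \<bullet> (X *v \<beta>) = 0"
proof -
  have "ones \<bullet> (X *v \<beta>) = (\<Sum>i\<in>UNIV. \<Sum>j\<in>UNIV. X $ i $ j * \<beta> $ j)"
    by (simp add: ones_def inner_vec_def matrix_vector_mult_def)
  also have "\<dots> = (\<Sum>j\<in>UNIV. (\<Sum>i\<in>UNIV. X $ i $ j) * \<beta> $ j)"
    by (subst sum.swap) (simp add: sum_distrib_right)
  finally show ?thesis using col_sums by simp
qed

lemma inj_design: "inj ((*v) X)"
  using full_rank by (simp add: full_rank_injective)

lemma design_zero_iff [simp]: "X *v \<beta> = 0 \<longleftrightarrow> \<beta> = 0"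
  using inj_design by (metis injD matrix_vector_mult_0_right)

lemma gram_inner: "\<beta> \<bullet> ((transpose X ** X) *v \<gamma>) = (X *v \<beta>) \<bullet> (X *v \<gamma>)"
  by (simp add: inner_matrix_vector matrix_vector_mul_assoc)

lemma gram_invertible: "invertible (transpose X ** X)"
proof -
  have "\<gamma> = 0" if "(transpose X ** X) *v \<gamma> = 0" for \<gamma>
  proof -
    have "(X *v \<gamma>) \<bullet> (X *v \<gamma>) = 0" using gram_inner[of \<gamma> \<gamma>] that by simp
    then show ?thesis by simp
  qed
  then show ?thesis
    using matrix_left_invertible_ker[of "transpose X ** X"] invertible_left_inverse by blast
qed

lemma gram_inv: "(transpose X ** X) ** matrix_inv (transpose X ** X) = mat 1"
  "matrix_inv (transpose X ** X) ** (transpose X ** X) = mat 1"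
  using someI_ex[OF gram_invertible[unfolded invertible_def]] unfolding matrix_inv_def by auto

lemma decomposition: "y = ybar y *\<^sub>R ones + X *v lscoef X y + resid X y"
  by (simp add: resid_def centered_def)

lemma transpose_resid: "transpose X *v resid X y = 0"
proof -
  have "transpose X *v (X *v lscoef X y) = ((transpose X ** X) ** matrix_inv (transpose X ** X)) *v (transpose X *v centered y)"
    by (simp add: lscoef_def matrix_vector_mul_assoc matrix_mul_assoc del: transpose_matrix_vector)
  then show ?thesis
    by (simp add: resid_def gram_inv matrix_vector_mult_diff_distrib del: transpose_matrix_vector)
qed

lemma range_inner_resid [simp]: "(X *v \<beta>) \<bullet> resid X y = 0"
  by (simp add: inner_matrix_vector transpose_resid del: transpose_matrix_vector)

lemma ones_inner_resid [simp]: "ones \<bullet> resid X y = 0"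
  by (simp add: resid_def centered_def inner_diff_right ones_inner_ones ones_inner[of y])

lemma inner_zero [simp]: "resid X y \<bullet> (X *v \<beta>) = 0" "resid X y \<bullet> ones = 0" "(X *v \<beta>) \<bullet> ones = 0"
  using range_inner_resid[of \<beta> y] ones_inner_resid[of y] ones_inner_range[of \<beta>]
  by (simp_all only: inner_commute)

text \<open>Components are found by exhibiting them: any decomposition whose remainder is orthogonal
  to \<open>ones\<close> and to the column space is the right one. The effect of location and scale
  changes and of \<open>rescale\<close> is computed in this way.\<close>

lemma decomposition_unique:
  assumes y: "y = \<alpha> *\<^sub>R ones + X *v \<beta> + r" and r: "ones \<bullet> r = 0" "\<And>\<gamma>. (X *v \<gamma>) \<bullet> r = 0"
  shows "ybar y = \<alpha>" "lscoef X y = \<beta>" "resid X y = r"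
proof -
  have "ones \<bullet> y = \<alpha> * real CARD('n)"
    by (simp add: y inner_add_right r ones_inner_ones)
  then show 1: "ybar y = \<alpha>" by (simp add: ones_inner)
  have c: "centered y = X *v \<beta> + r" unfolding centered_def 1 by (simp add: y)
  have "\<gamma> \<bullet> (transpose X *v r) = 0" for \<gamma> using r(2)[of \<gamma>] by (simp add: inner_matrix_vector del: transpose_matrix_vector)
  then have tr: "transpose X *v r = 0" by (metis inner_eq_zero_iff)
  have "lscoef X y = (matrix_inv (transpose X ** X) ** (transpose X ** X)) *v \<beta>"
    by (simp add: lscoef_def c matrix_vector_right_distrib tr matrix_vector_mul_assoc matrix_mul_assoc del: transpose_matrix_vector)
  then show 2: "lscoef X y = \<beta>" by (simp add: gram_inv)
  show "resid X y = r" by (simp add: resid_def 2 c)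
qed

lemma resid_orth: "ones \<bullet> (s *\<^sub>R resid X z) = 0" "(X *v \<gamma>) \<bullet> (s *\<^sub>R resid X z) = 0"
  by simp_all

lemma equivariance:
  fixes z :: "real^'n" and \<beta> :: "real^'p" and \<alpha> s :: real
  defines "y \<equiv> \<alpha> *\<^sub>R ones + X *v \<beta> + s *\<^sub>R z"
  shows "ybar y = \<alpha> + s * ybar z" "lscoef X y = \<beta> + s *\<^sub>R lscoef X z" "resid X y = s *\<^sub>R resid X z"
proof -
  have "y = (\<alpha> + s * ybar z) *\<^sub>R ones + X *v (\<beta> + s *\<^sub>R lscoef X z) + s *\<^sub>R resid X z"
    unfolding y_def by (subst decomposition[of z]) (simp add: algebra_simps matrix_vector_right_distrib matrix_vector_mult_scaleR)
  from decomposition_unique[OF this resid_orth]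
  show "ybar y = \<alpha> + s * ybar z" "lscoef X y = \<beta> + s *\<^sub>R lscoef X z" "resid X y = s *\<^sub>R resid X z" .
qed

lemma hat_centered: "hat X *v centered y = X *v lscoef X y"
  by (simp add: hat_def lscoef_def matrix_vector_mul_assoc matrix_mul_assoc del: transpose_matrix_vector)

lemma RSS_eq: "RSS X y = (norm (resid X y))\<^sup>2"
  by (simp add: RSS_def hat_centered resid_def)

lemma norm_decomposition:
  "(norm y)\<^sup>2 = real CARD('n) * (ybar y)\<^sup>2 + (norm (X *v lscoef X y))\<^sup>2 + (norm (resid X y))\<^sup>2"
proof -
  have "(norm y)\<^sup>2 = (ybar y *\<^sub>R ones + X *v lscoef X y + resid X y) \<bullet> (ybar y *\<^sub>R ones + X *v lscoef X y + resid X y)"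
    by (simp flip: decomposition add: power2_norm_eq_inner)
  also have "\<dots> = real CARD('n) * (ybar y)\<^sup>2 + (norm (X *v lscoef X y))\<^sup>2 + (norm (resid X y))\<^sup>2"
    by (simp add: inner_add_left inner_add_right power2_norm_eq_inner ones_inner_ones) (simp add: power2_eq_square)
  finally show ?thesis .
qed

lemma norm_centered: "(norm (centered y))\<^sup>2 = (norm (X *v lscoef X y))\<^sup>2 + (norm (resid X y))\<^sup>2"
proof -
  have "centered y = X *v lscoef X y + resid X y" by (simp add: resid_def)
  then show ?thesis
    by (simp add: power2_norm_eq_inner inner_add_left inner_add_right)
qed

text \<open>Three independent dilations, on the span of \<open>ones\<close>, on the column space and
  on the residual space. The Jacobian supplies the degrees of homogeneity for the laws of squared
  norms; with c = -1 the map is the symmetry of the fitted part.\<close>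

definition rescale :: "real \<Rightarrow> real \<Rightarrow> real \<Rightarrow> real^'n \<Rightarrow> real^'n" where
  "rescale e c d y = (e * ybar y) *\<^sub>R ones + c *\<^sub>R (X *v lscoef X y) + d *\<^sub>R resid X y"

lemma rescale_parts:
  "ybar (rescale e c d y) = e * ybar y" "lscoef X (rescale e c d y) = c *\<^sub>R lscoef X y"
  "resid X (rescale e c d y) = d *\<^sub>R resid X y"
proof -
  have "rescale e c d y = (e * ybar y) *\<^sub>R ones + X *v (c *\<^sub>R lscoef X y) + d *\<^sub>R resid X y"
    by (simp add: rescale_def matrix_vector_mult_scaleR)
  from decomposition_unique[OF this resid_orth]
  show "ybar (rescale e c d y) = e * ybar y" "lscoef X (rescale e c d y) = c *\<^sub>R lscoef X y"
    "resid X (rescale e c d y) = d *\<^sub>R resid X y" .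
qed

lemma linear_rescale: "linear (rescale e c d)"
  by (rule linearI) (simp_all add: rescale_def linear_add[OF linear_ybar] linear_cmul[OF linear_ybar]
     linear_add[OF linear_lscoef] linear_cmul[OF linear_lscoef] linear_add[OF linear_resid] linear_cmul[OF linear_resid]
     matrix_vector_right_distrib matrix_vector_mult_scaleR algebra_simps)

lemmas measurable_rescale [measurable] = borel_measurable_linear[OF linear_rescale]

text \<open>The index type of the basis is that of the coordinates, so that sending the coordinate
  axes to the basis is an orthogonal endomorphism. The index i0 belongs to \<open>ones\<close>, the
  set I to the column space, and the n - p - 1 other indices to the residual space.\<close>

lemma adapted_basis:
  obtains u :: "'n \<Rightarrow> real^'n" and i0 and I where
    "\<And>i j. u i \<bullet> u j = (if i = j then 1 else 0)" "i0 \<notin> I" "card I = CARD('p)"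
    "\<And>i. u i \<in> (if i = i0 then range (\<lambda>t. t *\<^sub>R ones) else if i \<in> I then range ((*v) X)
        else {r. ones \<bullet> r = 0 \<and> (\<forall>\<gamma>. (X *v \<gamma>) \<bullet> r = 0)})"
proof -
  define e0 :: "real^'n" where "e0 = (1 / sqrt (real CARD('n))) *\<^sub>R ones"
  define R :: "(real^'n) set" where "R = range ((*v) X)"
  define C where "C = {r :: real^'n. ones \<bullet> r = 0 \<and> (\<forall>\<gamma>. (X *v \<gamma>) \<bullet> r = 0)}"
  have e0: "e0 \<bullet> e0 = 1" by (simp add: e0_def ones_inner_ones)
  have sR: "subspace R" unfolding R_def by (intro linear_subspace_image subspace_UNIV) simp
  have dR: "dim R = CARD('p)"
    unfolding R_def using dim_image_eq[of "(*v) X" UNIV] inj_design by (simp add: dim_UNIV)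
  have sC: "subspace C" unfolding C_def by (auto simp: subspace_def inner_add_right)
  obtain B1 where B1: "B1 \<subseteq> R" "pairwise orthogonal B1" "\<And>x. x \<in> B1 \<Longrightarrow> norm x = 1" "independent B1" "card B1 = dim R" "span B1 = R"
    using orthonormal_basis_subspace[OF sR] by metis
  obtain B2 where B2: "B2 \<subseteq> C" "pairwise orthogonal B2" "\<And>x. x \<in> B2 \<Longrightarrow> norm x = 1" "independent B2" "card B2 = dim C" "span B2 = C"
    using orthonormal_basis_subspace[OF sC] by metis
  define B where "B = insert e0 (B1 \<union> B2)"
  have orth: "e0 \<bullet> x = 0" if "x \<in> B1 \<union> B2" for x
    using that B1(1) B2(1) by (auto simp: e0_def R_def C_def)
  have orth12: "x \<bullet> y = 0" if "x \<in> B1" "y \<in> B2" for x y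
    using that B1(1) B2(1) by (auto simp: R_def C_def)
  have pw: "x \<bullet> y = 0" if "x \<in> B" "y \<in> B" "x \<noteq> y" for x y
    using that orth orth12 B1(2) B2(2) unfolding B_def pairwise_def orthogonal_def
    by (metis Un_iff inner_commute insert_iff)
  have nB: "x \<bullet> x = 1" if "x \<in> B" for x
    using that e0 B1(3) B2(3) unfolding B_def by (auto simp: norm_eq_1)
  have indB: "independent B"
  proof (rule pairwise_orthogonal_independent)
    show "pairwise orthogonal B" using pw by (simp add: pairwise_def orthogonal_def)
    show "0 \<notin> B" using nB[of 0] by auto
  qed
  have finB: "finite B" using indB by (rule independent_imp_finite)
  have "y \<in> span B" for y
  proof -
    have "ones \<in> span B"
    proof -
      have "ones = sqrt (real CARD('n)) *\<^sub>R e0" by (simp add: e0_def)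
      then show ?thesis by (metis B_def insertI1 span_base span_mul)
    qed
    moreover have "X *v lscoef X y \<in> span B"
      using B1(6) span_mono[of B1 B] unfolding B_def R_def by blast
    moreover have "resid X y \<in> span B"
    proof -
      have "resid X y \<in> span B2" unfolding B2(6) by (simp add: C_def)
      moreover have "span B2 \<subseteq> span B" by (intro span_mono) (auto simp: B_def)
      ultimately show ?thesis by blast
    qed
    ultimately show ?thesis
      by (subst decomposition) (intro span_add span_mul)
  qed
  then have "span B = UNIV" by auto
  then have cB: "card B = CARD('n)"
    using indB by (metis dim_UNIV dim_span dim_eq_card_independent DIM_cart DIM_real mult.right_neutral)
  then obtain u :: "'n \<Rightarrow> real^'n" where u: "bij_betw u UNIV B"
    using finB by (metis finite_same_card_bij finite_class.finite_UNIV)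
  have uB: "u i \<in> B" for i using u by (auto simp: bij_betw_def)
  obtain i0 where i0: "u i0 = e0" using u unfolding bij_betw_def B_def by (metis insertI1 imageE)
  define I where "I = {i. u i \<in> B1}"
  have e0n: "e0 \<notin> B1 \<union> B2" using orth e0 by force
  show ?thesis
  proof
    show "u i \<bullet> u j = (if i = j then 1 else 0)" for i j
      using pw[OF uB uB, of i j] nB[OF uB, of i] u by (auto simp: bij_betw_def inj_eq)
    show "i0 \<notin> I" using e0n by (simp add: I_def i0)
    have "bij_betw u I B1"
      using u unfolding bij_betw_def I_def B_def by (auto intro: inj_on_subset)
    then show "card I = CARD('p)" using B1(5) dR by (simp add: bij_betw_same_card)
    fix i
    show "u i \<in> (if i = i0 then range (\<lambda>t. t *\<^sub>R ones) else if i \<in> I then range ((*v) X)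
        else {r. ones \<bullet> r = 0 \<and> (\<forall>\<gamma>. (X *v \<gamma>) \<bullet> r = 0)})"
    proof (cases "i = i0")
      case True
      then show ?thesis using i0 by (auto simp: e0_def)
    next
      case False
      then have "u i \<noteq> e0" using u i0 by (metis bij_betw_def injD)
      then have "i \<notin> I \<Longrightarrow> u i \<in> B2" using uB[of i] by (auto simp: B_def I_def)
      then show ?thesis using False B1(1) B2(1) by (auto simp: I_def R_def C_def)
    qed
  qed
qed

text \<open>In an adapted basis the map is diagonal, and Lebesgue measure does not notice the
  orthogonal change of basis. The Jacobian is therefore the product of the diagonal entries: e once,
  c for the p columns, d for the remaining dimensions.\<close>

lemma nn_integral_rescale:
  fixes h :: "real^'n \<Rightarrow> ennreal"
  assumes [measurable]: "h \<in> borel_measurable borel" and nz: "e \<noteq> 0" "c \<noteq> 0" "d \<noteq> 0"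
    and pn: "CARD('p) < CARD('n)"
  shows "(\<integral>\<^sup>+y. h y \<partial>lborel) =
    ennreal (\<bar>e\<bar> * \<bar>c\<bar> ^ CARD('p) * \<bar>d\<bar> ^ (CARD('n) - CARD('p) - 1)) * (\<integral>\<^sup>+y. h (rescale e c d y) \<partial>lborel)"
proof -
  obtain u :: "'n \<Rightarrow> real^'n" and i0 and I where
    u: "\<And>i j. u i \<bullet> u j = (if i = j then 1 else 0)" and i0: "i0 \<notin> I" and cI: "card I = CARD('p)"
    and us: "\<And>i. u i \<in> (if i = i0 then range (\<lambda>t. t *\<^sub>R ones) else if i \<in> I then range ((*v) X)
        else {r. ones \<bullet> r = 0 \<and> (\<forall>\<gamma>. (X *v \<gamma>) \<bullet> r = 0)})"
    by (rule adapted_basis) blast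
  define f :: "real^'n \<Rightarrow> real^'n" where "f = (\<lambda>x. \<Sum>i\<in>UNIV. x $ i *\<^sub>R u i)"
  have lf: "linear f"
    by (rule linearI) (simp_all add: f_def sum.distrib scaleR_add_left scaleR_sum_right)
  have ff: "f x \<bullet> f y = x \<bullet> y" for x y
  proof -
    have uf: "u i \<bullet> f y = y $ i" for i
      unfolding f_def by (simp add: inner_sum_right u if_distrib cong: if_cong)
    have "f x \<bullet> f y = (\<Sum>i\<in>UNIV. x $ i * (u i \<bullet> f y))"
      by (subst f_def) (simp add: inner_sum_left)
    also have "\<dots> = x \<bullet> y" unfolding uf by (simp add: inner_vec_def)
    finally show ?thesis .
  qed
  have of: "orthogonal_transformation f" using lf ff by (simp add: orthogonal_transformation_def)
  have [measurable]: "f \<in> borel_measurable borel" by (rule borel_measurable_linear[OF lf])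
  define w where "w = (\<lambda>i. if i = i0 then e else if i \<in> I then c else d)"
  define D :: "real^'n \<Rightarrow> real^'n" where "D = (\<lambda>x. \<chi> i. w i * x $ i)"
  have eig: "rescale e c d (u i) = w i *\<^sub>R u i" for i
  proof -
    consider "i = i0" | "i \<noteq> i0" "i \<in> I" | "i \<noteq> i0" "i \<notin> I" by blast
    then show ?thesis
    proof cases
      case 1
      then obtain t where t: "u i = t *\<^sub>R ones" using us[of i] by auto
      have "u i = t *\<^sub>R ones + X *v 0 + 0" using t by simp
      from decomposition_unique[OF this] show ?thesis using t 1 by (simp add: rescale_def w_def)
    next
      case 2
      then obtain t where t: "u i = X *v t" using us[of i] by auto
      have "u i = 0 *\<^sub>R ones + X *v t + 0" using t by simp
      from decomposition_unique[OF this] show ?thesis using t 2 by (simp add: rescale_def w_def)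
    next
      case 3
      then have t: "ones \<bullet> u i = 0" "\<And>\<gamma>. (X *v \<gamma>) \<bullet> u i = 0" using us[of i] by auto
      have "u i = 0 *\<^sub>R ones + X *v 0 + u i" by simp
      from decomposition_unique[OF this t] show ?thesis using 3 by (simp add: rescale_def w_def)
    qed
  qed
  have fD: "rescale e c d (f x) = f (D x)" for x
    unfolding f_def D_def
    by (simp add: linear_sum[OF linear_rescale] linear_cmul[OF linear_rescale] eig mult.commute)
  \<comment> \<open>Carries the diagonal entries over from indices to standard basis vectors, the
    form in which \<open>lborel_affine_euclidean\<close> takes them.\<close>
  define k where "k = (\<lambda>b::real^'n. \<Sum>i\<in>UNIV. if b = axis i 1 then w i else 0)"
  have k: "k (axis i 1) = w i" for i
    unfolding k_def by (simp add: axis_eq_axis)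
  have Bas: "(Basis :: (real^'n) set) = (\<lambda>i. axis i 1) ` UNIV"
    by (auto simp: Basis_vec_def)
  have inj: "inj (\<lambda>i::'n. axis i (1::real))" by (auto simp: inj_on_def axis_eq_axis)
  have knz: "\<And>j. j \<in> Basis \<Longrightarrow> k j \<noteq> 0" using nz by (auto simp: Bas k w_def split: if_splits)
  have Deq: "D = (\<lambda>x. 0 + (\<Sum>j\<in>Basis. (k j * (x \<bullet> j)) *\<^sub>R j))"
  proof
    fix x
    have "(\<Sum>j\<in>Basis. (k j * (x \<bullet> j)) *\<^sub>R j) = (\<Sum>i\<in>UNIV. (w i * x $ i) *\<^sub>R axis i 1)"
      unfolding Bas by (subst sum.reindex[OF inj]) (simp add: k inner_axis)
    also have "\<dots> = D x"
      unfolding D_def by (simp add: vec_eq_iff axis_def if_distrib cong: if_cong)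
    finally show "D x = 0 + (\<Sum>j\<in>Basis. (k j * (x \<bullet> j)) *\<^sub>R j)" by simp
  qed
  have prod: "(\<Prod>j\<in>Basis. \<bar>k j\<bar>) = \<bar>e\<bar> * \<bar>c\<bar> ^ CARD('p) * \<bar>d\<bar> ^ (CARD('n) - CARD('p) - 1)"
  proof -
    have "(\<Prod>j\<in>Basis. \<bar>k j\<bar>) = (\<Prod>i\<in>UNIV. \<bar>w i\<bar>)"
      unfolding Bas by (subst prod.reindex[OF inj]) (simp add: k)
    also have "(UNIV :: 'n set) = insert i0 (I \<union> (UNIV - insert i0 I))" by auto
    also have "(\<Prod>i\<in>\<dots>. \<bar>w i\<bar>) = \<bar>w i0\<bar> * ((\<Prod>i\<in>I. \<bar>w i\<bar>) * (\<Prod>i\<in>UNIV - insert i0 I. \<bar>w i\<bar>))"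
      using i0 by (subst prod.insert, simp, simp, subst prod.union_disjoint) auto
    also have "(\<Prod>i\<in>I. \<bar>w i\<bar>) = (\<Prod>i\<in>I. \<bar>c\<bar>)" using i0 by (intro prod.cong) (auto simp: w_def)
    also have "(\<Prod>i\<in>UNIV - insert i0 I. \<bar>w i\<bar>) = (\<Prod>i\<in>UNIV - insert i0 I. \<bar>d\<bar>)"
      by (intro prod.cong) (auto simp: w_def)
    also have "(\<Prod>i\<in>UNIV - insert i0 I. \<bar>d\<bar>) = \<bar>d\<bar> ^ (CARD('n) - CARD('p) - 1)"
      using i0 by (simp add: card_Diff_subset cI)
    finally show ?thesis by (simp add: w_def cI)
  qed
  have "lborel = density (distr lborel borel D) (\<lambda>_. (\<Prod>j\<in>Basis. \<bar>k j\<bar>))"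
    unfolding Deq by (rule lborel_affine_euclidean[OF knz])
  then have "(\<integral>\<^sup>+x. h (f x) \<partial>lborel) = (\<integral>\<^sup>+x. h (f x) \<partial>density (distr lborel borel D) (\<lambda>_. (\<Prod>j\<in>Basis. \<bar>k j\<bar>)))"
    by simp
  also have "\<dots> = (\<Prod>j\<in>Basis. \<bar>k j\<bar>) * (\<integral>\<^sup>+x. h (f (D x)) \<partial>lborel)"
  proof -
    have [measurable]: "D \<in> borel_measurable borel"
      by (rule borel_measurable_linear) (auto simp: D_def linear_iff vec_eq_iff algebra_simps)
    show ?thesis
      by (simp add: nn_integral_density nn_integral_cmult nn_integral_distr)
  qed
  also have "(\<integral>\<^sup>+x. h (f (D x)) \<partial>lborel) = (\<integral>\<^sup>+y. h (rescale e c d y) \<partial>lborel)"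
    by (simp flip: fD) (rule nn_integral_orthogonal[OF of], simp)
  also have "(\<integral>\<^sup>+x. h (f x) \<partial>lborel) = (\<integral>\<^sup>+y. h y \<partial>lborel)"
    by (rule nn_integral_orthogonal[OF of]) simp
  finally show ?thesis by (simp add: prod)
qed

end

section \<open>Laws determined by homogeneity\<close>

text \<open>Lower orthants generate the Borel sets and are closed under intersection. The measures
  may have infinite total mass, but the orthants below k times \<open>One\<close> exhaust the space
  and are of finite measure.\<close>

lemma measure_eqI_atMost:
  fixes M N :: "'a::ordered_euclidean_space measure"
  assumes M: "sets M = sets borel" and N: "sets N = sets borel"
    and eq: "\<And>a. emeasure M {..a} = emeasure N {..a}" and fin: "\<And>a. emeasure M {..a} \<noteq> \<infinity>"
  shows "M = N"
proof (rule measure_eqI_generator_eq[where E = "range (\<lambda>a::'a. {..a})" and A = "\<lambda>k. {..real k *\<^sub>R One}"])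
  have inf: "{..a} \<inter> {..b} = {..inf a b}" for a b :: 'a by auto
  show "Int_stable (range (\<lambda>a::'a. {..a}))"
    by (auto simp: Int_stable_def inf)
  have s: "sets (borel :: 'a measure) = sigma_sets UNIV (range (\<lambda>a::'a. {..a}))"
    by (subst borel_eq_atMost) (rule sets_measure_of, simp)
  show "sets M = sigma_sets UNIV (range (\<lambda>a::'a. {..a}))" "sets N = sigma_sets UNIV (range (\<lambda>a::'a. {..a}))"
    using M N s by simp_all
  show "(\<Union>k. {..real k *\<^sub>R One}) = (UNIV :: 'a set)"
  proof (intro equalityI subsetI UNIV_I)
    fix x :: 'a
    obtain k where k: "norm x \<le> real k" using real_arch_simple by blast
    have "x \<bullet> i \<le> (real k *\<^sub>R One) \<bullet> i" if "i \<in> Basis" for i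
      using Basis_le_norm[OF that, of x] k that by simp
    then have "x \<le> real k *\<^sub>R One" unfolding eucl_le[of x] by blast
    then show "x \<in> (\<Union>k. {..real k *\<^sub>R One})" by auto
  qed
qed (use eq fin in auto)

lemma nn_integral_powr_atMost:
  fixes c t :: real
  assumes "c > 0"
  shows "(\<integral>\<^sup>+w. ennreal (w powr (c - 1)) * indicator {0<..} w * indicator {..t} w \<partial>lborel) = ennreal ((max t 0) powr c / c)"
proof -
  have "((\<lambda>w. w powr (c - 1)) has_integral ((max t 0) powr (c - 1 + 1) / (c - 1 + 1))) {0..max t 0}"
    using assms by (intro has_integral_powr_from_0) auto
  from nn_integral_has_integral_lebesgue'[OF _ this]
  have "(\<integral>\<^sup>+w. ennreal (w powr (c - 1)) * indicator {0..max t 0} w \<partial>lborel) = ennreal ((max t 0) powr c / c)"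
    by simp
  also have "(\<integral>\<^sup>+w. ennreal (w powr (c - 1)) * indicator {0..max t 0} w \<partial>lborel) =
      (\<integral>\<^sup>+w. ennreal (w powr (c - 1)) * indicator {0<..} w * indicator {..t} w \<partial>lborel)"
    by (intro nn_integral_cong) (auto simp: indicator_def max_def)
  finally show ?thesis .
qed

definition powr_density :: "real \<Rightarrow> real \<Rightarrow> ennreal" where
  "powr_density c w = ennreal (w powr (c - 1)) * indicator {0<..} w"

lemma powr_density_measurable [measurable]: "powr_density c \<in> borel_measurable borel"
  unfolding powr_density_def by measurable

lemma nn_integral_powr_density_atMost:
  "c > 0 \<Longrightarrow> (\<integral>\<^sup>+w. powr_density c w * indicator {..t} w \<partial>lborel) = ennreal ((max t 0) powr c / c)"
  unfolding powr_density_def by (rule nn_integral_powr_atMost)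

text \<open>A measure on the quadrant that is homogeneous of degree \<open>a\<close> in the first and \<open>b\<close> in the
  second coordinate is determined by its value on the unit square. Applied to the law of squared
  norms of orthogonal projections, this replaces polar coordinates.\<close>

lemma homogeneous_law:
  fixes q :: "'a \<Rightarrow> ennreal" and V1 V2 :: "'a \<Rightarrow> real"
  assumes [measurable]: "q \<in> borel_measurable M" "V1 \<in> borel_measurable M" "V2 \<in> borel_measurable M"
    and pos: "AE y in M. 0 < V1 y \<and> 0 < V2 y"
    and a: "a > 0" and b: "b > 0"
    and hom: "\<And>s t. s > 0 \<Longrightarrow> t > 0 \<Longrightarrow>
      (\<integral>\<^sup>+y. q y * indicator {..s} (V1 y) * indicator {..t} (V2 y) \<partial>M) = ennreal (s powr a * t powr b) * K"
    and K: "K \<noteq> \<infinity>"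
    and F [measurable]: "case_prod F \<in> borel_measurable borel"
  shows "(\<integral>\<^sup>+y. F (V1 y) (V2 y) * q y \<partial>M) =
    (K * ennreal (a * b)) * (\<integral>\<^sup>+w. (\<integral>\<^sup>+v. F w v * powr_density b v \<partial>lborel) * powr_density a w \<partial>lborel)"
proof -
  have Fw [measurable]: "F w \<in> borel_measurable borel" for w
    using measurable_compose[of "\<lambda>v. (w, v)" borel borel "case_prod F" borel] F by simp
  \<comment> \<open>The law of the two functionals under the weight q, to be identified with the
    product density in R. Integrating the powers a - 1 and b - 1 over the rectangle with corner (s,
    t) gives \<open>s powr a * t powr b\<close> divided by a b, hence the factor
    \<open>a * b\<close> in R.\<close>
  define L where "L = distr (density M q) borel (\<lambda>y. (V1 y, V2 y))"
  define R where "R = density lborel (\<lambda>(w, v). K * ennreal (a * b) * (powr_density a w * powr_density b v))"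
  have F' [measurable]: "case_prod F \<in> borel_measurable (borel \<Otimes>\<^sub>M borel)"
    by (simp add: borel_prod)
  have dm: "(\<lambda>(w, v). K * ennreal (a * b) * (powr_density a w * powr_density b v)) \<in> borel_measurable (borel :: (real \<times> real) measure)"
    unfolding borel_prod[symmetric] by measurable
  have Rint: "(\<integral>\<^sup>+x. G x \<partial>R) = (\<integral>\<^sup>+w. (\<integral>\<^sup>+v. K * ennreal (a * b) * (powr_density a w * powr_density b v) * G (w, v) \<partial>lborel) \<partial>lborel)"
    if G: "G \<in> borel_measurable (borel :: (real \<times> real) measure)" for G
  proof -
    have [measurable]: "G \<in> borel_measurable (borel \<Otimes>\<^sub>M borel)" using G by (simp add: borel_prod)
    have "(\<integral>\<^sup>+x. G x \<partial>R) = (\<integral>\<^sup>+x. (case x of (w, v) \<Rightarrow> K * ennreal (a * b) * (powr_density a w * powr_density b v)) * G x \<partial>lborel)"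
      unfolding R_def using dm G by (subst nn_integral_density) auto
    also have "\<dots> = (\<integral>\<^sup>+x. (case x of (w, v) \<Rightarrow> K * ennreal (a * b) * (powr_density a w * powr_density b v)) * G x \<partial>(lborel \<Otimes>\<^sub>M lborel))"
      by (simp add: lborel_prod)
    also have "\<dots> = (\<integral>\<^sup>+w. (\<integral>\<^sup>+v. K * ennreal (a * b) * (powr_density a w * powr_density b v) * G (w, v) \<partial>lborel) \<partial>lborel)"
      by (subst lborel.nn_integral_fst[symmetric]) (auto simp: case_prod_beta')
    finally show ?thesis .
  qed
  have Lint: "(\<integral>\<^sup>+x. G x \<partial>L) = (\<integral>\<^sup>+y. q y * G (V1 y, V2 y) \<partial>M)"
    if G [measurable]: "G \<in> borel_measurable (borel :: (real \<times> real) measure)" for G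
    unfolding L_def by (subst nn_integral_distr) (auto simp: nn_integral_density)
  have Rat: "emeasure R {..x} = ennreal ((max (fst x) 0) powr a * (max (snd x) 0) powr b) * K" for x
  proof -
    have "emeasure R {..x} = (\<integral>\<^sup>+y. indicator {..x} y \<partial>R)" by (simp add: R_def)
    also have "\<dots> = (\<integral>\<^sup>+w. (\<integral>\<^sup>+v. (K * ennreal (a * b)) * (powr_density a w * powr_density b v) * indicator {..x} (w, v) \<partial>lborel) \<partial>lborel)"
      by (rule Rint) simp
    also have "\<dots> = (\<integral>\<^sup>+w. (\<integral>\<^sup>+v. (K * ennreal (a * b)) * (powr_density a w * indicator {..fst x} w) * (powr_density b v * indicator {..snd x} v) \<partial>lborel) \<partial>lborel)"
      by (intro nn_integral_cong) (auto simp: indicator_def less_eq_prod_def mult_ac)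
    also have "\<dots> = (K * ennreal (a * b)) * ennreal ((max (fst x) 0) powr a / a) * ennreal ((max (snd x) 0) powr b / b)"
      by (simp add: nn_integral_cmult nn_integral_multc nn_integral_powr_density_atMost a b)
    also have "\<dots> = K * ennreal ((a * b) * ((max (fst x) 0) powr a / a) * ((max (snd x) 0) powr b / b))"
      using a b by (subst (1 2) ennreal_mult) (simp_all add: mult.assoc)
    also have "(a * b) * ((max (fst x) 0) powr a / a) * ((max (snd x) 0) powr b / b) = (max (fst x) 0) powr a * (max (snd x) 0) powr b"
      using a b by simp
    finally show ?thesis by (simp add: mult.commute)
  qed
  have Lat: "emeasure L {..x} = ennreal ((max (fst x) 0) powr a * (max (snd x) 0) powr b) * K" for x
  proof -
    have "emeasure L {..x} = (\<integral>\<^sup>+y. indicator {..x} y \<partial>L)" by (simp add: L_def)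
    also have "\<dots> = (\<integral>\<^sup>+y. q y * indicator {..x} (V1 y, V2 y) \<partial>M)" by (rule Lint) simp
    also have "\<dots> = (\<integral>\<^sup>+y. q y * indicator {..fst x} (V1 y) * indicator {..snd x} (V2 y) \<partial>M)"
      by (intro nn_integral_cong) (auto simp: indicator_def less_eq_prod_def)
    also have "\<dots> = ennreal ((max (fst x) 0) powr a * (max (snd x) 0) powr b) * K"
    proof (cases "fst x > 0 \<and> snd x > 0")
      case True
      then show ?thesis using hom[of "fst x" "snd x"] by simp
    next
      case False
      have "(\<integral>\<^sup>+y. q y * indicator {..fst x} (V1 y) * indicator {..snd x} (V2 y) \<partial>M) = (\<integral>\<^sup>+y. 0 \<partial>M)"
        by (rule nn_integral_cong_AE) (use pos in eventually_elim, use False in \<open>auto simp: indicator_def\<close>)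
      then show ?thesis using False a b by (auto simp: max_def)
    qed
    finally show ?thesis .
  qed
  have "L = R"
  proof (rule measure_eqI_atMost)
    show "sets L = sets borel" "sets R = sets borel" by (simp_all add: L_def R_def)
    show "emeasure L {..x} = emeasure R {..x}" for x using Lat Rat by simp
    show "emeasure L {..x} \<noteq> \<infinity>" for x using Lat[of x] K by (simp add: ennreal_mult_eq_top_iff)
  qed
  have "(\<integral>\<^sup>+y. F (V1 y) (V2 y) * q y \<partial>M) = (\<integral>\<^sup>+x. case_prod F x \<partial>L)"
    by (subst Lint) (auto simp: mult.commute)
  also have "\<dots> = (\<integral>\<^sup>+w. (\<integral>\<^sup>+v. (K * ennreal (a * b)) * (powr_density a w * powr_density b v) * F w v \<partial>lborel) \<partial>lborel)"
    unfolding \<open>L = R\<close> by (subst Rint) auto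
  also have "\<dots> = (\<integral>\<^sup>+w. (\<integral>\<^sup>+v. (K * ennreal (a * b)) * (powr_density a w * (F w v * powr_density b v)) \<partial>lborel) \<partial>lborel)"
    by (simp add: mult_ac)
  also have "\<dots> = (K * ennreal (a * b)) * (\<integral>\<^sup>+w. (\<integral>\<^sup>+v. F w v * powr_density b v \<partial>lborel) * powr_density a w \<partial>lborel)"
    by (simp add: nn_integral_cmult nn_integral_multc mult.commute[of "powr_density a _"])
  finally show ?thesis .
qed

section \<open>Gaussian errors\<close>

lemma nn_integral_gamma:
  assumes c: "c > 0" and l: "l > 0"
  shows "(\<integral>\<^sup>+v. ennreal (exp (- l * v)) * powr_density c v \<partial>lborel) = ennreal (Gamma c * l powr (- c))"
proof -
  have "ennreal (Gamma c) = (\<integral>\<^sup>+t. ennreal (indicator {0..} t * t powr (c - 1) / exp t) \<partial>lborel)"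
    by (rule Gamma_conv_nn_integral_real[OF c])
  also have "\<dots> = ennreal l * (\<integral>\<^sup>+v. ennreal (indicator {0..} (l * v) * (l * v) powr (c - 1) / exp (l * v)) \<partial>lborel)"
    using l by (subst nn_integral_real_affine[where c = l and t = 0]) auto
  also have "(\<integral>\<^sup>+v. ennreal (indicator {0..} (l * v) * (l * v) powr (c - 1) / exp (l * v)) \<partial>lborel)
      = (\<integral>\<^sup>+v. ennreal (l powr (c - 1)) * (ennreal (exp (- l * v)) * powr_density c v) \<partial>lborel)"
    by (intro nn_integral_cong)
       (use l in \<open>auto simp: powr_density_def indicator_def powr_mult exp_minus divide_inverse ennreal_mult[symmetric] zero_le_mult_iff mult_ac not_less\<close>)
  also have "\<dots> = ennreal (l powr (c - 1)) * (\<integral>\<^sup>+v. ennreal (exp (- l * v)) * powr_density c v \<partial>lborel)"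
    by (rule nn_integral_cmult) measurable
  finally have "ennreal (Gamma c) = ennreal (l * l powr (c - 1)) * (\<integral>\<^sup>+v. ennreal (exp (- l * v)) * powr_density c v \<partial>lborel)"
    using l by (simp add: ennreal_mult mult.assoc)
  also have "l * l powr (c - 1) = l powr c" using l by (simp add: powr_diff)
  finally have "ennreal (l powr (- c)) * ennreal (Gamma c) =
     ennreal (l powr (- c) * l powr c) * (\<integral>\<^sup>+v. ennreal (exp (- l * v)) * powr_density c v \<partial>lborel)"
    by (simp add: ennreal_mult mult.assoc)
  also have "l powr (- c) * l powr c = 1" using l by (simp add: powr_minus)
  finally show ?thesis using Gamma_real_pos[OF c] by (simp add: ennreal_mult' mult.commute)
qed

lemma nn_integral_std_normal_vec:
  fixes f :: "real^'n \<Rightarrow> ennreal"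
  assumes [measurable]: "f \<in> borel_measurable borel"
  shows "(\<integral>\<^sup>+z. f z \<partial>std_normal_vec) =
    ennreal ((2 * pi) powr (- real CARD('n) / 2)) * (\<integral>\<^sup>+z. ennreal (exp (- (norm z)\<^sup>2 / 2)) * f z \<partial>lborel)"
  unfolding std_normal_vec_def
  by (simp add: nn_integral_density ennreal_mult nn_integral_cmult[symmetric] mult.assoc)

lemma space_std_normal_vec [simp]: "space std_normal_vec = UNIV"
  and sets_std_normal_vec [simp, measurable_cong]: "sets std_normal_vec = sets borel"
  by (simp_all add: std_normal_vec_def)

lemma prob_space_std_normal_vec: "prob_space (std_normal_vec :: (real^'n) measure)"
proof
  let ?c = "(2 * pi) powr (- real CARD('n) / 2)"
  have e: "?c * exp (- (norm z)\<^sup>2 / 2) = (\<Prod>b\<in>Basis. std_normal_density (z \<bullet> b))" for z :: "real^'n"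
  proof -
    have "(\<Prod>b\<in>Basis. std_normal_density (z \<bullet> b)) = (\<Prod>b\<in>(Basis :: (real^'n) set). 1 / sqrt (2 * pi)) * exp (\<Sum>b\<in>Basis. - (z \<bullet> b)\<^sup>2 / 2)"
      by (simp add: std_normal_density_def prod_dividef exp_sum power_one_over)
    also have "(\<Prod>b\<in>(Basis :: (real^'n) set). 1 / sqrt (2 * pi)) = (1 / sqrt (2 * pi)) ^ CARD('n)"
      by simp
    also have "\<dots> = ?c"
    proof -
      have "1 / sqrt (2 * pi) = (2 * pi) powr (- 1 / 2)"
        by (simp add: powr_minus_divide powr_half_sqrt)
      then show ?thesis by (simp add: powr_power)
    qed
    also have "(\<Sum>b\<in>Basis. - (z \<bullet> b)\<^sup>2 / 2) = - (norm z)\<^sup>2 / 2"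
    proof -
      have "(norm z)\<^sup>2 = (\<Sum>b\<in>Basis. (z \<bullet> b)\<^sup>2)"
        unfolding power2_norm_eq_inner by (subst euclidean_inner) (simp add: power2_eq_square)
      then show ?thesis by (simp add: sum_negf sum_divide_distrib[symmetric])
    qed
    finally show ?thesis by simp
  qed
  have "emeasure (std_normal_vec :: (real^'n) measure) UNIV = (\<integral>\<^sup>+z. 1 \<partial>(std_normal_vec :: (real^'n) measure))"
    by simp
  also have "\<dots> = (\<integral>\<^sup>+z. (\<Prod>b\<in>Basis. ennreal (std_normal_density (z \<bullet> b))) \<partial>(lborel :: (real^'n) measure))"
    by (subst nn_integral_std_normal_vec) (simp_all add: nn_integral_cmult[symmetric] ennreal_mult[symmetric] prod_ennreal flip: e)
  also have "\<dots> = (\<Prod>b\<in>(Basis :: (real^'n) set). \<integral>\<^sup>+x. ennreal (std_normal_density x) \<partial>lborel)"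
    by (rule nn_integral_lborel_prod) auto
  also have "(\<integral>\<^sup>+x. ennreal (std_normal_density x) \<partial>lborel) = 1"
    using prob_space.emeasure_space_1[OF prob_space_normal_density[of 1 0]]
    by (simp add: emeasure_density)
  finally show "emeasure (std_normal_vec :: (real^'n) measure) (space std_normal_vec) = 1" by simp
qed

interpretation std_normal: prob_space "std_normal_vec :: (real^'n) measure"
  by (rule prob_space_std_normal_vec)

lemma emeasure_std_normal_UNIV [simp]: "emeasure (std_normal_vec :: (real^'n) measure) UNIV = 1"
  using std_normal.emeasure_space_1 by (metis space_std_normal_vec)

lemma AE_std_normal_vec:
  "AE z in lborel. P z \<Longrightarrow> AE z in (std_normal_vec :: (real^'n) measure). P z"
  by (subst std_normal_vec_def, subst AE_density) auto

lemma AE_not_hyperplane: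
  fixes a :: "real^'n"
  assumes "a \<noteq> 0"
  shows "AE z in lborel. a \<bullet> z \<noteq> c"
proof -
  have "negligible {z. a \<bullet> z = c}" using assms by (intro negligible_hyperplane) auto
  moreover have "{z. a \<bullet> z = c} \<in> sets borel" by (intro borel_closed closed_hyperplane)
  ultimately have "{z. a \<bullet> z = c} \<in> null_sets lborel"
    by (simp add: negligible_iff_null_sets null_sets_completion_iff)
  then show ?thesis by (rule AE_I') auto
qed

text \<open>Unnormalised expectation of F(W, S) for independent chi-square variables with 2 a and 2
  b degrees of freedom.\<close>

definition gauss_pair :: "real \<Rightarrow> real \<Rightarrow> (real \<Rightarrow> real \<Rightarrow> ennreal) \<Rightarrow> ennreal" where
  "gauss_pair a b F = (\<integral>\<^sup>+w. (\<integral>\<^sup>+v. (ennreal (exp (- (w + v) / 2)) * F w v) * powr_density b v \<partial>lborel)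
     * powr_density a w \<partial>lborel)"

section \<open>Normal errors: central laws of the squared norms, independence of the residual
  direction\<close>

locale wide_design = centered_design X for X :: "real^'p^'n" +
  assumes wide: "CARD('p) < CARD('n) - 1"
begin

definition dof :: real where "dof = real CARD('n) - real CARD('p) - 1"

lemma dof_eq: "real (CARD('n) - CARD('p) - 1) = dof" "dof \<ge> 1" "dof > 0"
  using wide by (auto simp: dof_def)

definition Vfit :: "real^'n \<Rightarrow> real" where "Vfit y = (norm (X *v lscoef X y))\<^sup>2"
definition Vres :: "real^'n \<Rightarrow> real" where "Vres y = (norm (resid X y))\<^sup>2"
definition Vloc :: "real^'n \<Rightarrow> real" where "Vloc y = real CARD('n) * (ybar y)\<^sup>2 + Vfit y"

lemma V_measurable [measurable]: "Vfit \<in> borel_measurable borel" "Vres \<in> borel_measurable borel" "Vloc \<in> borel_measurable borel"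
  unfolding Vfit_def[abs_def] Vres_def[abs_def] Vloc_def[abs_def] by measurable

lemma norm_V: "(norm y)\<^sup>2 = real CARD('n) * (ybar y)\<^sup>2 + Vfit y + Vres y" "(norm y)\<^sup>2 = Vloc y + Vres y"
  using norm_decomposition[of y] by (simp_all add: Vfit_def Vres_def Vloc_def)

lemma V_nonneg: "0 \<le> Vfit y" "0 \<le> Vres y" "0 \<le> Vloc y"
  by (simp_all add: Vfit_def Vres_def Vloc_def)

lemma V_rescale: "Vfit (rescale e c d y) = c\<^sup>2 * Vfit y" "Vres (rescale e c d y) = d\<^sup>2 * Vres y"
  "Vloc (rescale c c d y) = c\<^sup>2 * Vloc y"
  by (simp_all add: Vfit_def Vres_def Vloc_def rescale_parts matrix_vector_mult_scaleR power_mult_distrib algebra_simps)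

text \<open>Since p + 1 < n, some vector of the adapted basis lies in the residual space, and a
  vanishing residual forces z into the hyperplane orthogonal to it.\<close>

lemma AE_Vres: "AE z in lborel. 0 < Vres z"
proof -
  obtain u :: "'n \<Rightarrow> real^'n" and i0 and I where
    u: "\<And>i j. u i \<bullet> u j = (if i = j then 1 else 0)" and i0: "i0 \<notin> I" and cI: "card I = CARD('p)"
    and us: "\<And>i. u i \<in> (if i = i0 then range (\<lambda>t. t *\<^sub>R ones) else if i \<in> I then range ((*v) X)
        else {r. ones \<bullet> r = 0 \<and> (\<forall>\<gamma>. (X *v \<gamma>) \<bullet> r = 0)})"
    by (rule adapted_basis) blast
  have "card (insert i0 I) < CARD('n)" using wide i0 cI by simp
  then have "insert i0 I \<noteq> UNIV" by auto
  then obtain i where i: "i \<notin> insert i0 I" by auto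
  then have r: "ones \<bullet> u i = 0" "\<And>\<gamma>. (X *v \<gamma>) \<bullet> u i = 0" using us[of i] by auto
  have "u i \<noteq> 0" using u[of i i] by auto
  from AE_not_hyperplane[OF this, of 0] show ?thesis
  proof eventually_elim
    case (elim z)
    have "u i \<bullet> z = u i \<bullet> resid X z"
      using r by (subst decomposition[of z]) (simp add: inner_add_right inner_commute)
    then show ?case using elim by (auto simp: Vres_def)
  qed
qed

lemma AE_fit: "AE z in lborel. lscoef X z + \<gamma> \<noteq> 0"
proof -
  \<comment> \<open>Any nonzero coefficient vector will do. It gives a hyperplane containing every z
    with \<open>lscoef X z + \<gamma> = 0\<close>.\<close>
  define e :: "real^'p" where "e = axis undefined 1"
  have "X *v e \<noteq> 0" by (simp add: e_def axis_eq_0_iff)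
  from AE_not_hyperplane[OF this, of "- ((X *v e) \<bullet> (X *v \<gamma>))"] show ?thesis
  proof eventually_elim
    case (elim z)
    have "(X *v e) \<bullet> z = (X *v e) \<bullet> (X *v lscoef X z)"
      by (subst decomposition[of z]) (simp add: inner_add_right)
    then show ?case using elim by (auto simp: eq_neg_iff_add_eq_0 matrix_vector_right_distrib[symmetric] inner_add_right[symmetric])
  qed
qed

lemma AE_V: "AE z in lborel. 0 < Vfit z \<and> 0 < Vres z \<and> 0 < Vloc z"
  using AE_Vres AE_fit[of 0]
proof eventually_elim
  case (elim z)
  then have "0 < Vfit z" by (simp add: Vfit_def)
  moreover have "0 \<le> real CARD('n) * (ybar z)\<^sup>2" by simp
  ultimately show ?case using elim unfolding Vloc_def by (metis add_nonneg_pos)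
qed

definition direction :: "real^'n \<Rightarrow> real^'n" where
  "direction y = (1 / norm (resid X y)) *\<^sub>R resid X y"

lemma direction_measurable [measurable]: "direction \<in> borel_measurable borel"
  unfolding direction_def[abs_def] by measurable

lemma direction_rescale: "d > 0 \<Longrightarrow> direction (rescale e c d y) = direction y"
  by (simp add: direction_def rescale_parts)

lemma finite_cball_V: "(\<integral>\<^sup>+y. indicator {..1} (Vloc y) * indicator {..1} (Vres y) \<partial>lborel) < \<infinity>"
proof -
  have "(\<integral>\<^sup>+y. indicator {..1} (Vloc y) * indicator {..1} (Vres y) \<partial>lborel) \<le> (\<integral>\<^sup>+y. indicator (cball (0::real^'n) 2) y \<partial>lborel)"
  proof (intro nn_integral_mono)
    fix y :: "real^'n"
    have "norm y \<le> 2" if "Vloc y \<le> 1" "Vres y \<le> 1"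
    proof -
      have "(norm y)\<^sup>2 \<le> 2\<^sup>2" using norm_V(2)[of y] that by simp
      then show ?thesis by (rule power2_le_imp_le) simp
    qed
    then show "indicator {..1} (Vloc y) * indicator {..1} (Vres y) \<le> (indicator (cball 0 2) y :: ennreal)"
      by (auto simp: indicator_def)
  qed
  also have "\<dots> = emeasure lborel (cball (0::real^'n) 2)" by (rule nn_integral_indicator) simp
  also have "\<dots> < \<infinity>" using emeasure_lborel_cball_finite by (simp add: less_top)
  finally show ?thesis .
qed

text \<open>A restriction on the residual direction survives positive dilations, so the restricted
  measure has the same homogeneity as the full one. The set D enters only through the constant C;
  apart from the Gaussian weight this is already the independence of direction and squared
  norms.\<close>

lemma loc_res_law:
  assumes D [measurable]: "D \<in> sets borel"
  obtains C where "C \<noteq> \<infinity>" "\<And>F. case_prod F \<in> borel_measurable borel \<Longrightarrow>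
    (\<integral>\<^sup>+y. F (Vloc y) (Vres y) * indicator D (direction y) \<partial>lborel) =
    C * (\<integral>\<^sup>+w. (\<integral>\<^sup>+v. F w v * powr_density (dof / 2) v \<partial>lborel) * powr_density ((real CARD('p) + 1) / 2) w \<partial>lborel)"
proof -
  define K where "K = (\<integral>\<^sup>+y. indicator D (direction y) * indicator {..1} (Vloc y) * indicator {..1} (Vres y) \<partial>lborel)"
  have "K \<le> (\<integral>\<^sup>+y. indicator {..1} (Vloc y) * indicator {..1} (Vres y) \<partial>lborel)"
    unfolding K_def by (intro nn_integral_mono) (auto simp: indicator_def)
  then have K: "K \<noteq> \<infinity>" using finite_cball_V by auto
  show ?thesis
  proof
    show "K * ennreal ((real CARD('p) + 1) / 2 * (dof / 2)) \<noteq> \<infinity>"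
      using K by (simp add: ennreal_mult_eq_top_iff)
    fix F :: "real \<Rightarrow> real \<Rightarrow> ennreal" assume F: "case_prod F \<in> borel_measurable borel"
    show "(\<integral>\<^sup>+y. F (Vloc y) (Vres y) * indicator D (direction y) \<partial>lborel) =
      K * ennreal ((real CARD('p) + 1) / 2 * (dof / 2)) * (\<integral>\<^sup>+w. (\<integral>\<^sup>+v. F w v * powr_density (dof / 2) v \<partial>lborel) * powr_density ((real CARD('p) + 1) / 2) w \<partial>lborel)"
    proof (rule homogeneous_law[OF _ _ _ _ _ _ _ K F])
      show "AE y in lborel. 0 < Vloc y \<and> 0 < Vres y" using AE_V by eventually_elim auto
      fix s t :: real assume s: "s > 0" and t: "t > 0"
      have "(\<integral>\<^sup>+y. indicator D (direction y) * indicator {..s} (Vloc y) * indicator {..t} (Vres y) \<partial>lborel) =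
        ennreal (\<bar>sqrt s\<bar> * \<bar>sqrt s\<bar> ^ CARD('p) * \<bar>sqrt t\<bar> ^ (CARD('n) - CARD('p) - 1)) *
        (\<integral>\<^sup>+y. indicator D (direction (rescale (sqrt s) (sqrt s) (sqrt t) y)) * indicator {..s} (Vloc (rescale (sqrt s) (sqrt s) (sqrt t) y)) * indicator {..t} (Vres (rescale (sqrt s) (sqrt s) (sqrt t) y)) \<partial>lborel)"
        by (rule nn_integral_rescale) (use s t wide in auto)
      also have "(\<integral>\<^sup>+y. indicator D (direction (rescale (sqrt s) (sqrt s) (sqrt t) y)) * indicator {..s} (Vloc (rescale (sqrt s) (sqrt s) (sqrt t) y)) * indicator {..t} (Vres (rescale (sqrt s) (sqrt s) (sqrt t) y)) \<partial>lborel) = K"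
        unfolding K_def using s t by (intro nn_integral_cong) (auto simp: direction_rescale V_rescale indicator_def)
      also have "\<bar>sqrt s\<bar> * \<bar>sqrt s\<bar> ^ CARD('p) * \<bar>sqrt t\<bar> ^ (CARD('n) - CARD('p) - 1) = s powr ((real CARD('p) + 1) / 2) * t powr (dof / 2)"
      proof -
        have "\<bar>sqrt s\<bar> * \<bar>sqrt s\<bar> ^ CARD('p) = sqrt s powr (real (Suc CARD('p)))"
          using s by (subst powr_realpow) auto
        moreover have "\<bar>sqrt t\<bar> ^ (CARD('n) - CARD('p) - 1) = sqrt t powr dof"
          using t by (subst dof_eq(1)[symmetric], subst powr_realpow) auto
        ultimately show ?thesis using s t by (simp add: powr_half_sqrt[symmetric] powr_powr add.commute)
      qed
      finally show "(\<integral>\<^sup>+y. indicator D (direction y) * indicator {..s} (Vloc y) * indicator {..t} (Vres y) \<partial>lborel) =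
        ennreal (s powr ((real CARD('p) + 1) / 2) * t powr (dof / 2)) * K" .
    qed (use dof_eq in \<open>auto simp: add_pos_pos\<close>)
  qed
qed

definition gauss_loc_res :: "(real \<Rightarrow> real \<Rightarrow> ennreal) \<Rightarrow> ennreal" where
  "gauss_loc_res = gauss_pair ((real CARD('p) + 1) / 2) (dof / 2)"

lemma std_normal_loc_res:
  assumes D [measurable]: "D \<in> sets borel"
  obtains C where "C \<noteq> \<infinity>" "\<And>F. case_prod F \<in> borel_measurable borel \<Longrightarrow>
    (\<integral>\<^sup>+z. F (Vloc z) (Vres z) * indicator D (direction z) \<partial>std_normal_vec) = C * gauss_loc_res F"
proof -
  obtain C where C: "C \<noteq> \<infinity>" "\<And>F. case_prod F \<in> borel_measurable borel \<Longrightarrow>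
    (\<integral>\<^sup>+y. F (Vloc y) (Vres y) * indicator D (direction y) \<partial>lborel) =
    C * (\<integral>\<^sup>+w. (\<integral>\<^sup>+v. F w v * powr_density (dof / 2) v \<partial>lborel) * powr_density ((real CARD('p) + 1) / 2) w \<partial>lborel)"
    using loc_res_law[OF D] by blast
  show ?thesis
  proof
    show "ennreal ((2 * pi) powr (- real CARD('n) / 2)) * C \<noteq> \<infinity>" using C(1) by (simp add: ennreal_mult_eq_top_iff)
    fix F :: "real \<Rightarrow> real \<Rightarrow> ennreal" assume F: "case_prod F \<in> borel_measurable borel"
    have [measurable]: "(\<lambda>z. F (Vloc z) (Vres z)) \<in> borel_measurable borel"
      using measurable_compose[of "\<lambda>z. (Vloc z, Vres z)" borel borel "case_prod F" borel] F by simp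
    have F': "case_prod (\<lambda>w v. ennreal (exp (- (w + v) / 2)) * F w v) \<in> borel_measurable borel"
      using F unfolding borel_prod[symmetric] by measurable
    have "(\<integral>\<^sup>+z. F (Vloc z) (Vres z) * indicator D (direction z) \<partial>std_normal_vec) =
      ennreal ((2 * pi) powr (- real CARD('n) / 2)) *
      (\<integral>\<^sup>+y. (ennreal (exp (- (Vloc y + Vres y) / 2)) * F (Vloc y) (Vres y)) * indicator D (direction y) \<partial>lborel)"
      by (subst nn_integral_std_normal_vec) (simp_all add: norm_V(2) mult.assoc)
    also have "\<dots> = ennreal ((2 * pi) powr (- real CARD('n) / 2)) * C * gauss_loc_res F"
      by (subst C(2)[OF F']) (simp add: gauss_loc_res_def gauss_pair_def mult.assoc)
    finally show "(\<integral>\<^sup>+z. F (Vloc z) (Vres z) * indicator D (direction z) \<partial>std_normal_vec) =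
      ennreal ((2 * pi) powr (- real CARD('n) / 2)) * C * gauss_loc_res F" .
  qed
qed

text \<open>The constant in \<open>std_normal_loc_res\<close> depends on D alone and the remaining
  factor on F alone. The choices F = 1 and D = UNIV supply the normalisation.\<close>

lemma direction_indep:
  assumes D [measurable]: "D \<in> sets borel" and F: "case_prod F \<in> borel_measurable borel"
  shows "(\<integral>\<^sup>+z. F (Vloc z) (Vres z) * indicator D (direction z) \<partial>std_normal_vec) =
    (\<integral>\<^sup>+z. F (Vloc z) (Vres z) \<partial>std_normal_vec) * (\<integral>\<^sup>+z. indicator D (direction z) \<partial>std_normal_vec)"
proof -
  obtain C where C: "\<And>F. case_prod F \<in> borel_measurable borel \<Longrightarrow>
    (\<integral>\<^sup>+z. F (Vloc z) (Vres z) * indicator D (direction z) \<partial>std_normal_vec) = C * gauss_loc_res F"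
    using std_normal_loc_res[OF D] by blast
  obtain C1 where C1: "\<And>F. case_prod F \<in> borel_measurable borel \<Longrightarrow>
    (\<integral>\<^sup>+z. F (Vloc z) (Vres z) * indicator UNIV (direction z) \<partial>std_normal_vec) = C1 * gauss_loc_res F"
    using std_normal_loc_res[OF borel_open[OF open_UNIV]] by blast
  have one: "C1 * gauss_loc_res (\<lambda>_ _. 1) = 1"
    using C1[of "\<lambda>_ _. 1"] by simp
  have "(\<integral>\<^sup>+z. F (Vloc z) (Vres z) \<partial>std_normal_vec) * (\<integral>\<^sup>+z. indicator D (direction z) \<partial>std_normal_vec)
     = (C1 * gauss_loc_res F) * (C * gauss_loc_res (\<lambda>_ _. 1))"
    using C1[OF F] C[of "\<lambda>_ _. 1"] by simp
  also have "\<dots> = (C * gauss_loc_res F) * (C1 * gauss_loc_res (\<lambda>_ _. 1))" by (simp add: mult_ac)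
  finally show ?thesis using C[OF F] one by simp
qed

text \<open>Only the quotient of two Gamma integrals in v matters, and it is dof because Gamma (b +
  1) = b Gamma b with b = m / 2. The constant C and the integral A over w are removed by the case F
  = 1, where the total mass is 1.\<close>

lemma expectation_Vres: "(\<integral>\<^sup>+z. ennreal (Vres z) \<partial>std_normal_vec) = ennreal dof"
proof -
  obtain C where C: "\<And>F. case_prod F \<in> borel_measurable borel \<Longrightarrow>
    (\<integral>\<^sup>+z. F (Vloc z) (Vres z) * indicator UNIV (direction z) \<partial>std_normal_vec) = C * gauss_loc_res F"
    using std_normal_loc_res[OF borel_open[OF open_UNIV]] by blast
  define A where "A = (\<integral>\<^sup>+w. ennreal (exp (- w / 2)) * powr_density ((real CARD('p) + 1) / 2) w \<partial>lborel)"
  have b: "dof / 2 > 0" using dof_eq by simp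
  have ex: "ennreal (exp (- (w + v) / 2)) = ennreal (exp (- w / 2)) * ennreal (exp (- (1 / 2) * v))" for w v :: real
    by (simp add: ennreal_mult[symmetric] exp_add[symmetric] add_divide_distrib)
  have one: "gauss_loc_res (\<lambda>_ _. 1) = ennreal (Gamma (dof / 2) * (1 / 2) powr (- (dof / 2))) * A"
  proof -
    have "gauss_loc_res (\<lambda>_ _. 1) = (\<integral>\<^sup>+w. (\<integral>\<^sup>+v. ennreal (exp (- w / 2)) * (ennreal (exp (- (1 / 2) * v)) * powr_density (dof / 2) v) \<partial>lborel)
        * powr_density ((real CARD('p) + 1) / 2) w \<partial>lborel)"
      unfolding gauss_loc_res_def gauss_pair_def
      by (simp only: ex mult.assoc mult_1)
    also have "\<dots> = (\<integral>\<^sup>+w. (ennreal (exp (- w / 2)) * ennreal (Gamma (dof / 2) * (1 / 2) powr (- (dof / 2))))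
        * powr_density ((real CARD('p) + 1) / 2) w \<partial>lborel)"
      by (subst nn_integral_cmult, measurable, subst nn_integral_gamma[OF b]) simp_all
    also have "\<dots> = ennreal (Gamma (dof / 2) * (1 / 2) powr (- (dof / 2))) * A"
      unfolding A_def by (subst nn_integral_cmult[symmetric]) (simp_all add: mult_ac)
    finally show ?thesis .
  qed
  have two: "gauss_loc_res (\<lambda>_ v. ennreal v) = ennreal (Gamma (dof / 2 + 1) * (1 / 2) powr (- (dof / 2 + 1))) * A"
  proof -
    have e: "ennreal v * powr_density (dof / 2) v = powr_density (dof / 2 + 1) v" for v
      by (auto simp: powr_density_def indicator_def ennreal_mult[symmetric] powr_diff)
    have "gauss_loc_res (\<lambda>_ v. ennreal v) = (\<integral>\<^sup>+w. (\<integral>\<^sup>+v. ennreal (exp (- w / 2)) * (ennreal (exp (- (1 / 2) * v)) * powr_density (dof / 2 + 1) v) \<partial>lborel)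
        * powr_density ((real CARD('p) + 1) / 2) w \<partial>lborel)"
      unfolding gauss_loc_res_def gauss_pair_def
      by (simp only: ex mult.assoc e)
    also have "\<dots> = (\<integral>\<^sup>+w. (ennreal (exp (- w / 2)) * ennreal (Gamma (dof / 2 + 1) * (1 / 2) powr (- (dof / 2 + 1))))
        * powr_density ((real CARD('p) + 1) / 2) w \<partial>lborel)"
      using b by (subst nn_integral_cmult, measurable, subst nn_integral_gamma) simp_all
    also have "\<dots> = ennreal (Gamma (dof / 2 + 1) * (1 / 2) powr (- (dof / 2 + 1))) * A"
      unfolding A_def by (subst nn_integral_cmult[symmetric]) (simp_all add: mult_ac)
    finally show ?thesis .
  qed
  have g: "Gamma (dof / 2 + 1) * (1 / 2) powr (- (dof / 2 + 1)) = dof * (Gamma (dof / 2) * (1 / 2) powr (- (dof / 2)))"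
  proof -
    have "Gamma (dof / 2 + 1) = dof / 2 * Gamma (dof / 2)" using b by (intro Gamma_plus1) (auto elim!: nonpos_Ints_cases)
    moreover have "(1 / 2) powr (- (dof / 2 + 1)) = (1 / 2) powr (- (dof / 2)) * (2::real)"
      by (simp add: powr_diff)
    ultimately show ?thesis by simp
  qed
  have "(\<integral>\<^sup>+z. ennreal (Vres z) \<partial>std_normal_vec) = C * gauss_loc_res (\<lambda>_ v. ennreal v)"
  proof -
    have "case_prod (\<lambda>(_::real) v. ennreal v) \<in> borel_measurable borel"
      unfolding borel_prod[symmetric] by measurable
    from C[OF this] show ?thesis by simp
  qed
  also have "\<dots> = ennreal dof * (C * gauss_loc_res (\<lambda>_ _. 1))"
    unfolding one two g using dof_eq(3) by (subst ennreal_mult) (simp_all add: mult_ac Gamma_real_pos less_imp_le)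
  also have "C * gauss_loc_res (\<lambda>_ _. 1) = 1"
    using C[of "\<lambda>_ _. 1"] by simp
  finally show ?thesis by simp
qed

end

section \<open>Upper bound for the risk\<close>

lemma gauss_pair_cong:
  assumes "\<And>w v. w > 0 \<Longrightarrow> v > 0 \<Longrightarrow> F w v = G w v"
  shows "gauss_pair a b F = gauss_pair a b G"
  unfolding gauss_pair_def
proof (rule nn_integral_cong)
  fix w :: real
  show "(\<integral>\<^sup>+v. (ennreal (exp (- (w + v) / 2)) * F w v) * powr_density b v \<partial>lborel) * powr_density a w =
    (\<integral>\<^sup>+v. (ennreal (exp (- (w + v) / 2)) * G w v) * powr_density b v \<partial>lborel) * powr_density a w"
  proof (cases "w > 0")
    case True
    have "(ennreal (exp (- (w + v) / 2)) * F w v) * powr_density b v = (ennreal (exp (- (w + v) / 2)) * G w v) * powr_density b v" for v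
      using assms[OF True, of v] by (cases "v > 0") (simp_all add: powr_density_def)
    then show ?thesis by simp
  qed (simp add: powr_density_def)
qed

text \<open>After the substitution w = v x the integral over v is a Gamma integral of shape a + b +
  j and rate (1 + x) / 2. The case j = 0 serves the logarithmic term, j = 1 the term linear in
  S.\<close>

lemma gauss_pair_ratio:
  assumes a: "a > 0" and b: "b > 0" and j: "j \<ge> 0" and [measurable]: "f \<in> borel_measurable borel"
  shows "gauss_pair a b (\<lambda>w v. f (w / v) * ennreal (v powr j)) =
    ennreal (2 powr (a + b + j) * Gamma (a + b + j)) * (\<integral>\<^sup>+x. f x * ennreal ((1 + x) powr (- (a + b + j))) * powr_density a x \<partial>lborel)"
proof -
  define c where "c = a + b + j"
  have c: "c > 0" using a b j by (simp add: c_def)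
  have "gauss_pair a b (\<lambda>w v. f (w / v) * ennreal (v powr j)) =
    (\<integral>\<^sup>+w. (\<integral>\<^sup>+v. (ennreal (exp (- (w + v) / 2)) * (f (w / v) * ennreal (v powr j))) * powr_density b v * powr_density a w \<partial>lborel) \<partial>lborel)"
    unfolding gauss_pair_def by (simp add: nn_integral_multc)
  also have "\<dots> = (\<integral>\<^sup>+v. (\<integral>\<^sup>+w. (ennreal (exp (- (w + v) / 2)) * (f (w / v) * ennreal (v powr j))) * powr_density b v * powr_density a w \<partial>lborel) \<partial>lborel)"
    by (rule lborel_pair.Fubini') measurable
  also have "\<dots> = (\<integral>\<^sup>+v. (\<integral>\<^sup>+x. f x * powr_density a x * (ennreal (exp (- ((1 + x) / 2) * v)) * powr_density c v) \<partial>lborel) \<partial>lborel)"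
  proof (rule nn_integral_cong)
    fix v :: real
    show "(\<integral>\<^sup>+w. (ennreal (exp (- (w + v) / 2)) * (f (w / v) * ennreal (v powr j))) * powr_density b v * powr_density a w \<partial>lborel)
      = (\<integral>\<^sup>+x. f x * powr_density a x * (ennreal (exp (- ((1 + x) / 2) * v)) * powr_density c v) \<partial>lborel)"
    proof (cases "v > 0")
      case False
      then show ?thesis by (simp add: powr_density_def)
    next
      case v: True
      have "(\<integral>\<^sup>+w. (ennreal (exp (- (w + v) / 2)) * (f (w / v) * ennreal (v powr j))) * powr_density b v * powr_density a w \<partial>lborel)
        = ennreal v * (\<integral>\<^sup>+x. (ennreal (exp (- (v * x + v) / 2)) * (f (v * x / v) * ennreal (v powr j))) * powr_density b v * powr_density a (v * x) \<partial>lborel)"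
        using v by (subst nn_integral_real_affine[where c = v and t = 0]) auto
      also have "\<dots> = (\<integral>\<^sup>+x. ennreal v * ((ennreal (exp (- (v * x + v) / 2)) * (f (v * x / v) * ennreal (v powr j))) * powr_density b v * powr_density a (v * x)) \<partial>lborel)"
        by (rule nn_integral_cmult[symmetric]) measurable
      also have "\<dots> = (\<integral>\<^sup>+x. f x * powr_density a x * (ennreal (exp (- ((1 + x) / 2) * v)) * powr_density c v) \<partial>lborel)"
      proof (rule nn_integral_cong)
        fix x :: real
        have pd: "powr_density a (v * x) = ennreal (v powr (a - 1)) * powr_density a x"
          using v by (auto simp: powr_density_def indicator_def powr_mult ennreal_mult[symmetric] zero_less_mult_iff)
        have pc: "powr_density c v = ennreal v * ennreal (v powr j) * ennreal (v powr (a - 1)) * powr_density b v"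
        proof -
          have "v powr (c - 1) = v powr (1 + j + (a - 1) + (b - 1))"
            unfolding c_def by (rule arg_cong2[where f = "(powr)"]) simp_all
          also have "\<dots> = v * v powr j * v powr (a - 1) * v powr (b - 1)"
            using v by (simp only: powr_add powr_one)
          finally show ?thesis using v by (simp add: powr_density_def ennreal_mult)
        qed
        have ex: "- (v * x + v) / 2 = - ((1 + x) / 2) * v" by (simp add: algebra_simps)
        show "ennreal v * ((ennreal (exp (- (v * x + v) / 2)) * (f (v * x / v) * ennreal (v powr j))) * powr_density b v * powr_density a (v * x))
          = f x * powr_density a x * (ennreal (exp (- ((1 + x) / 2) * v)) * powr_density c v)"
          unfolding pd pc ex using v by (simp add: mult_ac)
      qed
      finally show ?thesis .
    qed
  qed
  also have "\<dots> = (\<integral>\<^sup>+x. (\<integral>\<^sup>+v. f x * powr_density a x * (ennreal (exp (- ((1 + x) / 2) * v)) * powr_density c v) \<partial>lborel) \<partial>lborel)"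
    by (rule lborel_pair.Fubini') measurable
  also have "\<dots> = (\<integral>\<^sup>+x. ennreal (2 powr c * Gamma c) * (f x * ennreal ((1 + x) powr (- c)) * powr_density a x) \<partial>lborel)"
  proof (rule nn_integral_cong)
    fix x :: real
    have *: "(\<integral>\<^sup>+v. f x * powr_density a x * (ennreal (exp (- ((1 + x) / 2) * v)) * powr_density c v) \<partial>lborel) =
      f x * powr_density a x * (\<integral>\<^sup>+v. ennreal (exp (- ((1 + x) / 2) * v)) * powr_density c v \<partial>lborel)"
      by (rule nn_integral_cmult) measurable
    show "(\<integral>\<^sup>+v. f x * powr_density a x * (ennreal (exp (- ((1 + x) / 2) * v)) * powr_density c v) \<partial>lborel) =
      ennreal (2 powr c * Gamma c) * (f x * ennreal ((1 + x) powr (- c)) * powr_density a x)"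
    proof (cases "x > 0")
      case True
      have "((1 + x) / 2) powr (- c) = 2 powr c * (1 + x) powr (- c)"
        using True by (simp add: powr_divide powr_minus_divide)
      then have "Gamma c * ((1 + x) / 2) powr (- c) = (2 powr c * Gamma c) * (1 + x) powr (- c)" by simp
      then have "(\<integral>\<^sup>+v. ennreal (exp (- ((1 + x) / 2) * v)) * powr_density c v \<partial>lborel) = ennreal ((2 powr c * Gamma c) * (1 + x) powr (- c))"
      proof -
        have "(\<integral>\<^sup>+v. ennreal (exp (- ((1 + x) / 2) * v)) * powr_density c v \<partial>lborel) = ennreal (Gamma c * ((1 + x) / 2) powr (- c))"
          by (rule nn_integral_gamma[OF c]) (use True in simp)
        also note \<open>Gamma c * ((1 + x) / 2) powr (- c) = _\<close>
        finally show ?thesis .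
      qed
      then show ?thesis using Gamma_real_pos[OF c] unfolding *
        by (subst (asm) ennreal_mult) (auto simp: mult_ac)
    qed (simp add: powr_density_def)
  qed
  also have "\<dots> = ennreal (2 powr c * Gamma c) * (\<integral>\<^sup>+x. f x * ennreal ((1 + x) powr (- c)) * powr_density a x \<partial>lborel)"
    by (rule nn_integral_cmult) measurable
  finally show ?thesis by (simp add: c_def)
qed

text \<open>Given W / S = x, the variable S is Gamma with shape a + b and rate (1 + x) / 2, so the
  conditional mean of S / (2 b) is (a + b) / (b (1 + x)). This is the weight on the right of
  \<open>shrink_log_le_shrink_linear\<close>; in the calculation it appears as the factor 2 (a + b)
  between the constants for j = 1 and j = 0.\<close>

lemma gauss_pair_shrink_le:
  assumes a0: "a0 > 0" "a0 \<le> a" and b: "b > 0"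
  shows "gauss_pair a b (\<lambda>w v. ennreal (- ln (shrink a0 b (w / v))))
    \<le> gauss_pair a b (\<lambda>w v. ennreal ((1 - shrink a0 b (w / v)) * v / (2 * b)))" (is "?L \<le> ?R")
proof -
  have a: "a > 0" using a0 by simp
  have ab: "a + b > 0" using a b by simp
  note [measurable] = shrink_measurable[OF a0(1) b]
  define c where "c = 2 powr (a + b) * Gamma (a + b)"
  have c: "c \<ge> 0" using Gamma_real_pos[OF ab] by (simp add: c_def)
  have "?L = gauss_pair a b (\<lambda>w v. ennreal (- ln (shrink a0 b (w / v))) * ennreal (v powr 0))"
    by (rule gauss_pair_cong) simp
  also have "\<dots> = ennreal c * (\<integral>\<^sup>+x. ennreal (- ln (shrink a0 b x)) * ennreal ((1 + x) powr (- (a + b))) * powr_density a x \<partial>lborel)"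
    using gauss_pair_ratio[OF a b, of 0 "\<lambda>x. ennreal (- ln (shrink a0 b x))"] by (simp add: c_def)
  also have "\<dots> = ennreal c * (\<integral>\<^sup>+x\<in>{0<..}. ennreal (- ln (shrink a0 b x) * beta_kernel a b x) \<partial>lborel)"
  proof (rule arg_cong2[where f = "(*)", OF refl nn_integral_cong])
    fix x :: real
    show "ennreal (- ln (shrink a0 b x)) * ennreal ((1 + x) powr (- (a + b))) * powr_density a x
      = ennreal (- ln (shrink a0 b x) * beta_kernel a b x) * indicator {0<..} x"
    proof (cases "x > 0")
      case True
      have "- ln (shrink a0 b x) \<ge> 0" using shrink_bounds[OF a0(1) b True] by simp
      then have "ennreal (- ln (shrink a0 b x) * beta_kernel a b x) = ennreal (- ln (shrink a0 b x)) * ennreal (beta_kernel a b x)"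
        by (rule ennreal_mult) (rule beta_kernel_nonneg)
      then show ?thesis using True
        by (simp add: powr_density_def beta_kernel_def ennreal_mult mult_ac)
    qed (simp add: powr_density_def)
  qed
  also have "\<dots> \<le> ennreal c * (\<integral>\<^sup>+x\<in>{0<..}. ennreal ((1 - shrink a0 b x) * ((a + b) / b / (1 + x)) * beta_kernel a b x) \<partial>lborel)"
    by (intro mult_left_mono shrink_log_le_shrink_linear[OF a0 b]) simp
  also have "\<dots> = ennreal (2 powr (a + b + 1) * Gamma (a + b + 1)) *
      (\<integral>\<^sup>+x. ennreal ((1 - shrink a0 b x) / (2 * b)) * ennreal ((1 + x) powr (- (a + b + 1))) * powr_density a x \<partial>lborel)"
  proof -
    have G: "2 powr (a + b + 1) * Gamma (a + b + 1) = c * (2 * (a + b))"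
      using ab by (simp add: c_def powr_add Gamma_plus1 nonpos_Ints_def)
    have "ennreal (c * (2 * (a + b))) * (\<integral>\<^sup>+x. ennreal ((1 - shrink a0 b x) / (2 * b)) * ennreal ((1 + x) powr (- (a + b + 1))) * powr_density a x \<partial>lborel)
      = ennreal c * (\<integral>\<^sup>+x. ennreal (2 * (a + b)) * (ennreal ((1 - shrink a0 b x) / (2 * b)) * ennreal ((1 + x) powr (- (a + b + 1))) * powr_density a x) \<partial>lborel)"
      using c ab by (subst ennreal_mult) (auto simp: mult.assoc nn_integral_cmult)
    also have "\<dots> = ennreal c * (\<integral>\<^sup>+x\<in>{0<..}. ennreal ((1 - shrink a0 b x) * ((a + b) / b / (1 + x)) * beta_kernel a b x) \<partial>lborel)"
    proof (rule arg_cong2[where f = "(*)", OF refl nn_integral_cong])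
      fix x :: real
      show "ennreal (2 * (a + b)) * (ennreal ((1 - shrink a0 b x) / (2 * b)) * ennreal ((1 + x) powr (- (a + b + 1))) * powr_density a x)
        = ennreal ((1 - shrink a0 b x) * ((a + b) / b / (1 + x)) * beta_kernel a b x) * indicator {0<..} x"
      proof (cases "x > 0")
        case True
        have "(1 + x) powr (- (a + b + 1)) = (1 + x) powr (- (a + b)) / (1 + x)"
          using True by (simp add: powr_diff)
        moreover have "2 * c * (s / (2 * b) * (P / (1 + x)) * Q) = s * (c / b / (1 + x)) * (Q * P)" for s P Q c
          by simp
        ultimately have "2 * (a + b) * ((1 - shrink a0 b x) / (2 * b) * (1 + x) powr (- (a + b + 1)) * x powr (a - 1))
          = (1 - shrink a0 b x) * ((a + b) / b / (1 + x)) * beta_kernel a b x"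
          by (simp only: beta_kernel_def)
        then show ?thesis using True shrink_bounds[OF a0(1) b True] ab b
          by (simp add: powr_density_def ennreal_mult[symmetric] del: minus_add_distrib)
      qed (simp add: powr_density_def)
    qed
    finally show ?thesis by (simp only: G)
  qed
  also have "\<dots> = gauss_pair a b (\<lambda>w v. ennreal ((1 - shrink a0 b (w / v)) / (2 * b)) * ennreal (v powr 1))"
    by (rule gauss_pair_ratio[symmetric, OF a b]) auto
  also have "\<dots> = ?R"
    by (rule gauss_pair_cong) (use shrink_bounds[OF a0(1) b] b in \<open>auto simp: ennreal_mult[symmetric] less_imp_le\<close>)
  finally show ?thesis .
qed

section \<open>The noncentral law of the fitted part as a mixture of central laws\<close>

definition cosh_coeff :: "nat \<Rightarrow> real \<Rightarrow> real" where
  "cosh_coeff k u = (if even k then u ^ k / fact k else 0)"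

text \<open>With even powers only, every term is nonnegative whatever the sign of u, so the series
  may be interchanged with nonnegative integrals.\<close>

lemma cosh_coeff_nonneg: "0 \<le> cosh_coeff k u"
  by (simp add: cosh_coeff_def zero_le_even_power)

lemma suminf_cosh_coeff: "(\<Sum>k. ennreal (cosh_coeff k u)) = ennreal (cosh u)"
proof -
  have "(\<lambda>k. cosh_coeff k u) sums cosh u"
    using cosh_converges[of u] unfolding cosh_coeff_def by (simp add: divide_inverse mult.commute cong: if_cong)
  then have s: "summable (\<lambda>k. cosh_coeff k u)" "(\<Sum>k. cosh_coeff k u) = cosh u"
    by (rule sums_summable, rule sums_unique[symmetric])
  show ?thesis
    using suminf_ennreal2[OF cosh_coeff_nonneg s(1)] s(2) by (simp only:)
qed

text \<open>A divergent integral, times the positive normalising constant, would give the normal law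
  infinite mass.\<close>

lemma finite_gauss: "(\<integral>\<^sup>+z. ennreal (exp (- (norm z)\<^sup>2 / 2)) \<partial>(lborel :: (real^'n) measure)) < \<infinity>"
proof (rule ccontr)
  assume "\<not> ?thesis"
  then have "(\<integral>\<^sup>+z. ennreal (exp (- (norm z)\<^sup>2 / 2)) \<partial>(lborel :: (real^'n) measure)) = top"
    by (simp add: less_top[symmetric])
  then show False
    using nn_integral_std_normal_vec[of "\<lambda>_::real^'n. 1"] by (simp add: ennreal_mult_top)
qed

context wide_design
begin

text \<open>The k-th power of an inner product with the fitted part is homogeneous of degree k,
  which raises the shape from p / 2 to (p + k) / 2. The Gaussian factor in the intercept stays in
  the weight and the intercept is not dilated, because bounds on the two squared norms leave it
  unbounded.\<close>

lemma fit_res_law: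
  obtains C where "C \<noteq> \<infinity>" "\<And>F. case_prod F \<in> borel_measurable borel \<Longrightarrow>
    (\<integral>\<^sup>+y. F (Vfit y) (Vres y) * ennreal (exp (- real CARD('n) * (ybar y)\<^sup>2 / 2) * cosh_coeff k ((X *v \<gamma>) \<bullet> y)) \<partial>lborel) =
    C * (\<integral>\<^sup>+w. (\<integral>\<^sup>+v. F w v * powr_density (dof / 2) v \<partial>lborel) * powr_density ((real CARD('p) + real k) / 2) w \<partial>lborel)"
proof -
  define q where "q = (\<lambda>y. ennreal (exp (- real CARD('n) * (ybar y)\<^sup>2 / 2) * cosh_coeff k ((X *v \<gamma>) \<bullet> y)))"
  have [measurable]: "q \<in> borel_measurable borel" unfolding q_def cosh_coeff_def by measurable
  define K where "K = (\<integral>\<^sup>+y. q y * indicator {..1} (Vfit y) * indicator {..1} (Vres y) \<partial>lborel)"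
  have inner: "(X *v \<gamma>) \<bullet> y = (X *v \<gamma>) \<bullet> (X *v lscoef X y)" for y
    by (subst decomposition[of y]) (simp add: inner_add_right)
  have "K \<le> (\<integral>\<^sup>+y. ennreal (exp 1 * (norm (X *v \<gamma>)) ^ k) * ennreal (exp (- (norm y)\<^sup>2 / 2)) \<partial>(lborel :: (real^'n) measure))"
    unfolding K_def
  proof (rule nn_integral_mono)
    fix y :: "real^'n"
    show "q y * indicator {..1} (Vfit y) * indicator {..1} (Vres y) \<le> ennreal (exp 1 * (norm (X *v \<gamma>)) ^ k) * ennreal (exp (- (norm y)\<^sup>2 / 2))"
    proof (cases "Vfit y \<le> 1 \<and> Vres y \<le> 1")
      case True
      \<comment> \<open>When both squared norms are at most 1, the square of |y| exceeds that of the
        intercept part by at most 2; half of this is the 1 in the exponent.\<close>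
      have "exp (- real CARD('n) * (ybar y)\<^sup>2 / 2) \<le> exp (1 - (norm y)\<^sup>2 / 2)"
        using True norm_V(1)[of y] by (simp add: field_simps)
      also have "\<dots> = exp 1 * exp (- (norm y)\<^sup>2 / 2)" by (simp add: exp_add[symmetric])
      finally have 1: "exp (- real CARD('n) * (ybar y)\<^sup>2 / 2) \<le> exp 1 * exp (- (norm y)\<^sup>2 / 2)" .
      have "norm (X *v lscoef X y) \<le> 1"
        using True by (simp add: Vfit_def abs_square_le_1)
      then have "\<bar>(X *v \<gamma>) \<bullet> y\<bar> \<le> norm (X *v \<gamma>)"
        unfolding inner[of y] using Cauchy_Schwarz_ineq2[of "X *v \<gamma>" "X *v lscoef X y"] mult_left_mono[of "norm (X *v lscoef X y)" 1 "norm (X *v \<gamma>)"] by simp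
      then have "\<bar>(X *v \<gamma>) \<bullet> y\<bar> ^ k \<le> norm (X *v \<gamma>) ^ k" by (intro power_mono) auto
      moreover have "cosh_coeff k ((X *v \<gamma>) \<bullet> y) \<le> \<bar>(X *v \<gamma>) \<bullet> y\<bar> ^ k"
      proof -
        have "\<bar>u\<bar> ^ k / fact k \<le> \<bar>u\<bar> ^ k" for u :: real
          by (simp add: divide_le_eq mult_left_le fact_ge_1 mult_le_cancel_left1)
        from this[of "(X *v \<gamma>) \<bullet> y"] show ?thesis
          by (cases "even k") (simp_all add: cosh_coeff_def power_even_abs)
      qed
      ultimately have "exp (- real CARD('n) * (ybar y)\<^sup>2 / 2) * cosh_coeff k ((X *v \<gamma>) \<bullet> y) \<le> (exp 1 * exp (- (norm y)\<^sup>2 / 2)) * (norm (X *v \<gamma>)) ^ k"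
        using 1 by (intro mult_mono) (auto simp: cosh_coeff_nonneg)
      then show ?thesis using True unfolding q_def by (simp add: ennreal_mult[symmetric] mult_ac)
    qed (auto simp: indicator_def)
  qed
  also have "\<dots> = ennreal (exp 1 * (norm (X *v \<gamma>)) ^ k) * (\<integral>\<^sup>+y. ennreal (exp (- (norm y)\<^sup>2 / 2)) \<partial>(lborel :: (real^'n) measure))"
    by (rule nn_integral_cmult) measurable
  also have "\<dots> < \<infinity>" using finite_gauss[where 'n = 'n] by (simp add: ennreal_mult_less_top)
  finally have K: "K \<noteq> \<infinity>" by simp
  show ?thesis
  proof
    show "K * ennreal ((real CARD('p) + real k) / 2 * (dof / 2)) \<noteq> \<infinity>" using K by (simp add: ennreal_mult_eq_top_iff)
    fix F :: "real \<Rightarrow> real \<Rightarrow> ennreal" assume F: "case_prod F \<in> borel_measurable borel"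
    have "(\<integral>\<^sup>+y. F (Vfit y) (Vres y) * q y \<partial>lborel) =
      K * ennreal ((real CARD('p) + real k) / 2 * (dof / 2)) * (\<integral>\<^sup>+w. (\<integral>\<^sup>+v. F w v * powr_density (dof / 2) v \<partial>lborel) * powr_density ((real CARD('p) + real k) / 2) w \<partial>lborel)"
    proof (rule homogeneous_law[OF _ _ _ _ _ _ _ K F])
      show "AE y in lborel. 0 < Vfit y \<and> 0 < Vres y" using AE_V by eventually_elim auto
      fix s t :: real assume s: "s > 0" and t: "t > 0"
      have q: "q (rescale 1 (sqrt s) (sqrt t) y) = ennreal (sqrt s ^ k) * q y" for y
      proof -
        have "(X *v \<gamma>) \<bullet> rescale 1 (sqrt s) (sqrt t) y = sqrt s * ((X *v \<gamma>) \<bullet> y)"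
          unfolding inner[of "rescale 1 (sqrt s) (sqrt t) y"] inner[of y] by (simp add: rescale_parts matrix_vector_mult_scaleR)
        then have "cosh_coeff k ((X *v \<gamma>) \<bullet> rescale 1 (sqrt s) (sqrt t) y) = sqrt s ^ k * cosh_coeff k ((X *v \<gamma>) \<bullet> y)"
          by (simp add: cosh_coeff_def power_mult_distrib)
        then show ?thesis using s by (simp add: q_def rescale_parts ennreal_mult[symmetric] cosh_coeff_nonneg mult_ac)
      qed
      have "(\<integral>\<^sup>+y. q y * indicator {..s} (Vfit y) * indicator {..t} (Vres y) \<partial>lborel) =
        ennreal (\<bar>1\<bar> * \<bar>sqrt s\<bar> ^ CARD('p) * \<bar>sqrt t\<bar> ^ (CARD('n) - CARD('p) - 1)) *
        (\<integral>\<^sup>+y. q (rescale 1 (sqrt s) (sqrt t) y) * indicator {..s} (Vfit (rescale 1 (sqrt s) (sqrt t) y)) * indicator {..t} (Vres (rescale 1 (sqrt s) (sqrt t) y)) \<partial>lborel)"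
        by (rule nn_integral_rescale) (use s t wide in auto)
      also have "(\<integral>\<^sup>+y. q (rescale 1 (sqrt s) (sqrt t) y) * indicator {..s} (Vfit (rescale 1 (sqrt s) (sqrt t) y)) * indicator {..t} (Vres (rescale 1 (sqrt s) (sqrt t) y)) \<partial>lborel)
        = (\<integral>\<^sup>+y. ennreal (sqrt s ^ k) * (q y * indicator {..1} (Vfit y) * indicator {..1} (Vres y)) \<partial>lborel)"
        using s t by (intro nn_integral_cong) (auto simp: q V_rescale indicator_def)
      also have "\<dots> = ennreal (sqrt s ^ k) * K" unfolding K_def by (rule nn_integral_cmult) measurable
      also have "ennreal (\<bar>1\<bar> * \<bar>sqrt s\<bar> ^ CARD('p) * \<bar>sqrt t\<bar> ^ (CARD('n) - CARD('p) - 1)) * (ennreal (sqrt s ^ k) * K)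
        = ennreal (sqrt s ^ (CARD('p) + k) * sqrt t ^ (CARD('n) - CARD('p) - 1)) * K"
        using s t by (simp add: ennreal_mult power_add mult_ac)
      also have "sqrt s ^ (CARD('p) + k) * sqrt t ^ (CARD('n) - CARD('p) - 1) = s powr ((real CARD('p) + real k) / 2) * t powr (dof / 2)"
      proof -
        have "sqrt s ^ (CARD('p) + k) = sqrt s powr (real (CARD('p) + k))"
          using s by (subst powr_realpow) auto
        moreover have "sqrt t ^ (CARD('n) - CARD('p) - 1) = sqrt t powr dof"
          using t by (subst dof_eq(1)[symmetric], subst powr_realpow) auto
        ultimately show ?thesis using s t by (simp add: powr_half_sqrt[symmetric] powr_powr add.commute)
      qed
      finally show "(\<integral>\<^sup>+y. q y * indicator {..s} (Vfit y) * indicator {..t} (Vres y) \<partial>lborel) =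
        ennreal (s powr ((real CARD('p) + real k) / 2) * t powr (dof / 2)) * K" .
    qed (use dof_eq in \<open>auto simp: add_pos_nonneg\<close>)
    then show "(\<integral>\<^sup>+y. F (Vfit y) (Vres y) * ennreal (exp (- real CARD('n) * (ybar y)\<^sup>2 / 2) * cosh_coeff k ((X *v \<gamma>) \<bullet> y)) \<partial>lborel) =
      K * ennreal ((real CARD('p) + real k) / 2 * (dof / 2)) * (\<integral>\<^sup>+w. (\<integral>\<^sup>+v. F w v * powr_density (dof / 2) v \<partial>lborel) * powr_density ((real CARD('p) + real k) / 2) w \<partial>lborel)"
      unfolding q_def .
  qed
qed

text \<open>Only the even terms of the exponential series survive, by the symmetry of the fitted part.\<close>

lemma noncentral_mixture:
  obtains C :: "nat \<Rightarrow> ennreal" where "\<And>F. case_prod F \<in> borel_measurable borel \<Longrightarrow>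
    (\<integral>\<^sup>+z. F (Vfit (X *v \<gamma> + z)) (Vres z) \<partial>std_normal_vec) = (\<Sum>k. C k * gauss_pair ((real CARD('p) + real k) / 2) (dof / 2) F)"
proof -
  define \<theta> where "\<theta> = X *v \<gamma>"
  define c0 where "c0 = (2 * pi) powr (- real CARD('n) / 2)"
  \<comment> \<open>The constants are chosen before F is fixed: the same weights have to serve both
    sides of the later comparison.\<close>
  have "\<forall>k. \<exists>C. \<forall>F. case_prod F \<in> borel_measurable borel \<longrightarrow>
    (\<integral>\<^sup>+y. F (Vfit y) (Vres y) * ennreal (exp (- real CARD('n) * (ybar y)\<^sup>2 / 2) * cosh_coeff k (\<theta> \<bullet> y)) \<partial>lborel) =
    C * (\<integral>\<^sup>+w. (\<integral>\<^sup>+v. F w v * powr_density (dof / 2) v \<partial>lborel) * powr_density ((real CARD('p) + real k) / 2) w \<partial>lborel)"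
    (is "\<forall>k. \<exists>C. ?P k C")
  proof
    fix k show "\<exists>C. ?P k C" unfolding \<theta>_def by (rule fit_res_law[of k \<gamma>]) blast
  qed
  from choice[OF this] obtain C where C': "\<forall>k. ?P k (C k)" ..
  note C = C'[rule_format]
  have Vt: "Vres (\<theta> + z) = Vres z" for z
    using equivariance[of 0 \<gamma> 1 z] by (simp add: Vres_def \<theta>_def)
  have inner: "\<theta> \<bullet> y = \<theta> \<bullet> (X *v lscoef X y)" for y
    unfolding \<theta>_def by (subst decomposition[of y]) (simp add: inner_add_right)
  show ?thesis
  proof
    fix F :: "real \<Rightarrow> real \<Rightarrow> ennreal" assume F: "case_prod F \<in> borel_measurable borel"
    have Fm [measurable]: "(\<lambda>z. F (Vfit z) (Vres z)) \<in> borel_measurable borel"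
      using measurable_compose[of "\<lambda>z. (Vfit z, Vres z)" borel borel "case_prod F" borel] F by simp
    define d where "d = c0 * exp (- (norm \<theta>)\<^sup>2 / 2)"
    have d: "d \<ge> 0" by (simp add: d_def c0_def)
    define E where "E = (\<integral>\<^sup>+z. F (Vfit (\<theta> + z)) (Vres z) \<partial>std_normal_vec)"
    \<comment> \<open>Translation by \<theta> moves the mean into the density, which up to a
      constant becomes the centred one times \<open>exp (\<theta> \<bullet> z)\<close>.\<close>
    have E: "E = ennreal d * (\<integral>\<^sup>+z. F (Vfit z) (Vres z) * ennreal (exp (- (norm z)\<^sup>2 / 2) * exp (\<theta> \<bullet> z)) \<partial>lborel)"
    proof -
      have "E = (\<integral>\<^sup>+z. F (Vfit (\<theta> + z)) (Vres (\<theta> + z)) \<partial>std_normal_vec)" by (simp add: E_def Vt)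
      also have "\<dots> = ennreal c0 * (\<integral>\<^sup>+z. ennreal (exp (- (norm z)\<^sup>2 / 2)) * F (Vfit (\<theta> + z)) (Vres (\<theta> + z)) \<partial>lborel)"
        unfolding c0_def by (rule nn_integral_std_normal_vec) measurable
      also have "(\<integral>\<^sup>+z. ennreal (exp (- (norm z)\<^sup>2 / 2)) * F (Vfit (\<theta> + z)) (Vres (\<theta> + z)) \<partial>lborel)
        = (\<integral>\<^sup>+z. ennreal (exp (- (norm (z - \<theta>))\<^sup>2 / 2)) * F (Vfit z) (Vres z) \<partial>lborel)"
        using nn_integral_translate[of "\<lambda>z. ennreal (exp (- (norm (z - \<theta>))\<^sup>2 / 2)) * F (Vfit z) (Vres z)" \<theta>] by simp
      also have "\<dots> = (\<integral>\<^sup>+z. ennreal (exp (- (norm \<theta>)\<^sup>2 / 2)) * (F (Vfit z) (Vres z) * ennreal (exp (- (norm z)\<^sup>2 / 2) * exp (\<theta> \<bullet> z))) \<partial>lborel)"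
      proof (rule nn_integral_cong)
        fix z
        have "- (norm (z - \<theta>))\<^sup>2 / 2 = - (norm \<theta>)\<^sup>2 / 2 + (- (norm z)\<^sup>2 / 2 + \<theta> \<bullet> z)"
          by (simp add: power2_norm_eq_inner inner_diff_left inner_diff_right inner_commute)
        then have "exp (- (norm (z - \<theta>))\<^sup>2 / 2) = exp (- (norm \<theta>)\<^sup>2 / 2) * (exp (- (norm z)\<^sup>2 / 2) * exp (\<theta> \<bullet> z))"
          by (simp add: exp_add[symmetric])
        then show "ennreal (exp (- (norm (z - \<theta>))\<^sup>2 / 2)) * F (Vfit z) (Vres z) =
          ennreal (exp (- (norm \<theta>)\<^sup>2 / 2)) * (F (Vfit z) (Vres z) * ennreal (exp (- (norm z)\<^sup>2 / 2) * exp (\<theta> \<bullet> z)))"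
          by (simp add: ennreal_mult mult_ac)
      qed
      also have "\<dots> = ennreal (exp (- (norm \<theta>)\<^sup>2 / 2)) * (\<integral>\<^sup>+z. F (Vfit z) (Vres z) * ennreal (exp (- (norm z)\<^sup>2 / 2) * exp (\<theta> \<bullet> z)) \<partial>lborel)"
        by (rule nn_integral_cmult) measurable
      finally show ?thesis by (simp add: d_def ennreal_mult mult.assoc c0_def)
    qed
    \<comment> \<open>Reflection of the fitted part alone preserves all squared norms and changes
      the sign of \<open>\<theta> \<bullet> z\<close>; averaging the two expressions for E produces
      cosh.\<close>
    have "(\<integral>\<^sup>+z. F (Vfit z) (Vres z) * ennreal (exp (- (norm z)\<^sup>2 / 2) * exp (\<theta> \<bullet> z)) \<partial>lborel)
      = ennreal (\<bar>1\<bar> * \<bar>-1\<bar> ^ CARD('p) * \<bar>1\<bar> ^ (CARD('n) - CARD('p) - 1)) *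
        (\<integral>\<^sup>+z. F (Vfit (rescale 1 (-1) 1 z)) (Vres (rescale 1 (-1) 1 z)) * ennreal (exp (- (norm (rescale 1 (-1) 1 z))\<^sup>2 / 2) * exp (\<theta> \<bullet> rescale 1 (-1) 1 z)) \<partial>lborel)"
      by (rule nn_integral_rescale) (use wide in auto)
    also have "\<dots> = (\<integral>\<^sup>+z. F (Vfit z) (Vres z) * ennreal (exp (- (norm z)\<^sup>2 / 2) * exp (- (\<theta> \<bullet> z))) \<partial>lborel)"
    proof -
      have "\<theta> \<bullet> rescale 1 (-1) 1 z = - (\<theta> \<bullet> z)" for z
        unfolding inner[of "rescale 1 (-1) 1 z"] inner[of z] by (simp only: rescale_parts matrix_vector_mult_scaleR inner_scaleR_right)
      then show ?thesis by (simp add: V_rescale norm_V(1) rescale_parts)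
    qed
    finally have E': "E = ennreal d * (\<integral>\<^sup>+z. F (Vfit z) (Vres z) * ennreal (exp (- (norm z)\<^sup>2 / 2) * exp (- (\<theta> \<bullet> z))) \<partial>lborel)"
      using E by simp
    have "2 * E = E + E" by (simp add: mult_2)
    also have "\<dots> = ennreal d * ((\<integral>\<^sup>+z. F (Vfit z) (Vres z) * ennreal (exp (- (norm z)\<^sup>2 / 2) * exp (\<theta> \<bullet> z)) \<partial>lborel)
       + (\<integral>\<^sup>+z. F (Vfit z) (Vres z) * ennreal (exp (- (norm z)\<^sup>2 / 2) * exp (- (\<theta> \<bullet> z))) \<partial>lborel))"
      by (simp only: distrib_left E[symmetric] E'[symmetric])
    also have "\<dots> = ennreal d * (\<integral>\<^sup>+z. F (Vfit z) (Vres z) * ennreal (exp (- (norm z)\<^sup>2 / 2) * exp (\<theta> \<bullet> z))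
       + F (Vfit z) (Vres z) * ennreal (exp (- (norm z)\<^sup>2 / 2) * exp (- (\<theta> \<bullet> z))) \<partial>lborel)"
      by (subst nn_integral_add) simp_all
    also have "\<dots> = ennreal d * (\<integral>\<^sup>+z. 2 * (F (Vfit z) (Vres z) * (ennreal (exp (- (norm z)\<^sup>2 / 2)) * ennreal (cosh (\<theta> \<bullet> z)))) \<partial>lborel)"
    proof (rule arg_cong2[where f = "(*)", OF refl nn_integral_cong])
      fix z
      have "exp (- (norm z)\<^sup>2 / 2) * exp (\<theta> \<bullet> z) + exp (- (norm z)\<^sup>2 / 2) * exp (- (\<theta> \<bullet> z)) = 2 * (exp (- (norm z)\<^sup>2 / 2) * cosh (\<theta> \<bullet> z))"
        by (simp add: cosh_field_def algebra_simps)
      then have "ennreal (exp (- (norm z)\<^sup>2 / 2) * exp (\<theta> \<bullet> z)) + ennreal (exp (- (norm z)\<^sup>2 / 2) * exp (- (\<theta> \<bullet> z)))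
         = 2 * (ennreal (exp (- (norm z)\<^sup>2 / 2)) * ennreal (cosh (\<theta> \<bullet> z)))"
        by (simp add: ennreal_plus[symmetric] ennreal_mult[symmetric] cosh_real_nonneg ennreal_numeral[symmetric] del: ennreal_plus ennreal_numeral)
      then show "F (Vfit z) (Vres z) * ennreal (exp (- (norm z)\<^sup>2 / 2) * exp (\<theta> \<bullet> z)) + F (Vfit z) (Vres z) * ennreal (exp (- (norm z)\<^sup>2 / 2) * exp (- (\<theta> \<bullet> z)))
        = 2 * (F (Vfit z) (Vres z) * (ennreal (exp (- (norm z)\<^sup>2 / 2)) * ennreal (cosh (\<theta> \<bullet> z))))"
        by (simp only: distrib_left[symmetric]) (simp add: mult_ac)
    qed
    also have "\<dots> = 2 * (ennreal d * (\<integral>\<^sup>+z. F (Vfit z) (Vres z) * (ennreal (exp (- (norm z)\<^sup>2 / 2)) * ennreal (cosh (\<theta> \<bullet> z))) \<partial>lborel))"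
      by (subst nn_integral_cmult) (simp_all add: mult_ac cosh_def)
    finally have "E = ennreal d * (\<integral>\<^sup>+z. F (Vfit z) (Vres z) * (ennreal (exp (- (norm z)\<^sup>2 / 2)) * ennreal (cosh (\<theta> \<bullet> z))) \<partial>lborel)"
      by (simp add: ennreal_mult_cancel_left)
    also have "\<dots> = ennreal d * (\<integral>\<^sup>+z. (\<Sum>k. (ennreal (exp (- (Vfit z + Vres z) / 2)) * F (Vfit z) (Vres z)) *
        ennreal (exp (- real CARD('n) * (ybar z)\<^sup>2 / 2) * cosh_coeff k (\<theta> \<bullet> z))) \<partial>lborel)"
    proof (rule arg_cong2[where f = "(*)", OF refl nn_integral_cong])
      fix z
      have e: "exp (- (norm z)\<^sup>2 / 2) = exp (- (Vfit z + Vres z) / 2) * exp (- real CARD('n) * (ybar z)\<^sup>2 / 2)"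
        by (simp add: exp_add[symmetric] norm_V(1) add_divide_distrib)
      show "F (Vfit z) (Vres z) * (ennreal (exp (- (norm z)\<^sup>2 / 2)) * ennreal (cosh (\<theta> \<bullet> z)))
       = (\<Sum>k. (ennreal (exp (- (Vfit z + Vres z) / 2)) * F (Vfit z) (Vres z)) *
        ennreal (exp (- real CARD('n) * (ybar z)\<^sup>2 / 2) * cosh_coeff k (\<theta> \<bullet> z)))"
        unfolding e by (simp add: ennreal_mult cosh_coeff_nonneg suminf_cosh_coeff ennreal_suminf_cmult mult_ac)
    qed
    also have "\<dots> = ennreal d * (\<Sum>k. \<integral>\<^sup>+z. (ennreal (exp (- (Vfit z + Vres z) / 2)) * F (Vfit z) (Vres z)) *
        ennreal (exp (- real CARD('n) * (ybar z)\<^sup>2 / 2) * cosh_coeff k (\<theta> \<bullet> z)) \<partial>lborel)"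
      by (subst nn_integral_suminf) (simp_all add: cosh_coeff_def)
    also have "\<dots> = ennreal d * (\<Sum>k. C k * gauss_pair ((real CARD('p) + real k) / 2) (dof / 2) F)"
    proof -
      have F': "case_prod (\<lambda>w v. ennreal (exp (- (w + v) / 2)) * F w v) \<in> borel_measurable borel"
        using F unfolding borel_prod[symmetric] by measurable
      show ?thesis by (simp only: C[OF F'] gauss_pair_def)
    qed
    also have "\<dots> = (\<Sum>k. ennreal d * C k * gauss_pair ((real CARD('p) + real k) / 2) (dof / 2) F)"
      by (simp add: ennreal_suminf_cmult mult.assoc)
    finally show "(\<integral>\<^sup>+z. F (Vfit (X *v \<gamma> + z)) (Vres z) \<partial>std_normal_vec) =
      (\<Sum>k. (ennreal (c0 * exp (- (norm \<theta>)\<^sup>2 / 2)) * C k) * gauss_pair ((real CARD('p) + real k) / 2) (dof / 2) F)"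
      by (simp add: E_def \<theta>_def d_def)
  qed
qed

text \<open>The mixture weights are nonnegative and common to both integrands, so the comparison may
  be made component by component. The k-th component has shape (p + k) / 2, which exceeds p / 2 -
  1.\<close>

lemma expectation_shrink_le:
  assumes p3: "3 \<le> CARD('p)"
  shows "(\<integral>\<^sup>+z. ennreal (- ln (shrink (real CARD('p) / 2 - 1) (dof / 2) (Vfit (X *v \<gamma> + z) / Vres z))) \<partial>std_normal_vec)
    \<le> (\<integral>\<^sup>+z. ennreal ((1 - shrink (real CARD('p) / 2 - 1) (dof / 2) (Vfit (X *v \<gamma> + z) / Vres z)) * Vres z / dof) \<partial>std_normal_vec)"
proof -
  define a0 where "a0 = real CARD('p) / 2 - 1"
  define b where "b = dof / 2"
  have a0: "a0 > 0" and b: "b > 0" using p3 dof_eq by (auto simp: a0_def b_def)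
  note [measurable] = shrink_measurable[OF a0 b]
  obtain C where C: "\<And>F. case_prod F \<in> borel_measurable borel \<Longrightarrow>
    (\<integral>\<^sup>+z. F (Vfit (X *v \<gamma> + z)) (Vres z) \<partial>std_normal_vec) = (\<Sum>k. C k * gauss_pair ((real CARD('p) + real k) / 2) (dof / 2) F)"
    using noncentral_mixture[of \<gamma>] by blast
  have m1: "case_prod (\<lambda>w v. ennreal (- ln (shrink a0 b (w / v)))) \<in> borel_measurable borel"
    unfolding borel_prod[symmetric] by measurable
  have m2: "case_prod (\<lambda>w v. ennreal ((1 - shrink a0 b (w / v)) * v / (2 * b))) \<in> borel_measurable borel"
    unfolding borel_prod[symmetric] by measurable
  have "(\<Sum>k. C k * gauss_pair ((real CARD('p) + real k) / 2) b (\<lambda>w v. ennreal (- ln (shrink a0 b (w / v)))))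
    \<le> (\<Sum>k. C k * gauss_pair ((real CARD('p) + real k) / 2) b (\<lambda>w v. ennreal ((1 - shrink a0 b (w / v)) * v / (2 * b))))"
    by (intro suminf_le summableI mult_left_mono gauss_pair_shrink_le a0 b) (auto simp: a0_def)
  then show ?thesis
    using C[OF m1] C[OF m2] by (simp add: a0_def b_def)
qed

text \<open>Reflecting in the bisector of \<open>t\<theta>\<close> and \<open>t'\<theta>\<close> exchanges the two Gaussian densities, and on
  the side where the density around \<open>t\<theta>\<close> is larger it increases the squared norm of the fitted part.\<close>

lemma expectation_antimono_shift:
  assumes F: "case_prod F \<in> borel_measurable borel"
    and anti: "\<And>w w' v. 0 \<le> w \<Longrightarrow> w \<le> w' \<Longrightarrow> 0 \<le> v \<Longrightarrow> F w' v \<le> (F w v :: ennreal)"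
    and t: "0 \<le> t" "t \<le> t'"
  shows "(\<integral>\<^sup>+z. F (Vfit (X *v (t' *\<^sub>R \<gamma>) + z)) (Vres z) \<partial>std_normal_vec)
    \<le> (\<integral>\<^sup>+z. F (Vfit (X *v (t *\<^sub>R \<gamma>) + z)) (Vres z) \<partial>std_normal_vec)"
proof (cases "\<gamma> = 0")
  case True
  then show ?thesis by simp
next
  case False
  define \<theta> where "\<theta> = X *v \<gamma>"
  define N where "N = \<theta> \<bullet> \<theta>"
  have "\<theta> \<noteq> 0" using False by (simp add: \<theta>_def)
  then have N: "N > 0" by (simp add: N_def)
  define f where "f = (\<lambda>z. F (Vfit z) (Vres z))"
  have [measurable]: "f \<in> borel_measurable borel" unfolding f_def
    using measurable_compose[of "\<lambda>z. (Vfit z, Vres z)" borel borel "case_prod F" borel] F by simp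
  define g where "g = (\<lambda>t z. ennreal (exp (- (norm (z - t *\<^sub>R \<theta>))\<^sup>2 / 2)))"
  have [measurable]: "g t \<in> borel_measurable borel" for t unfolding g_def by measurable
  \<comment> \<open>Displacement along \<theta> of the reflection R that exchanges t\<theta> and
    t'\<theta>. For t < t' it is nonnegative exactly when z is at least as near to t\<theta> as to
    t'\<theta>.\<close>
  define \<kappa> where "\<kappa> = (\<lambda>z. t + t' - 2 * (\<theta> \<bullet> z) / N)"
  define R where "R = (\<lambda>z. z + \<kappa> z *\<^sub>R \<theta>)"
  have inner: "\<theta> \<bullet> y = \<theta> \<bullet> (X *v lscoef X y)" for y
    unfolding \<theta>_def by (subst decomposition[of y]) (simp add: inner_add_right)
  have shift: "(\<integral>\<^sup>+z. F (Vfit (X *v (t *\<^sub>R \<gamma>) + z)) (Vres z) \<partial>std_normal_vec)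
    = ennreal ((2 * pi) powr (- real CARD('n) / 2)) * (\<integral>\<^sup>+z. f z * g t z \<partial>lborel)" for t
  proof -
    have V: "Vres (X *v (t *\<^sub>R \<gamma>) + z) = Vres z" for z
      using equivariance[of 0 "t *\<^sub>R \<gamma>" 1 z] by (simp add: Vres_def)
    have "(\<integral>\<^sup>+z. F (Vfit (X *v (t *\<^sub>R \<gamma>) + z)) (Vres z) \<partial>std_normal_vec) = (\<integral>\<^sup>+z. f (t *\<^sub>R \<theta> + z) \<partial>std_normal_vec)"
      unfolding f_def using V by (simp add: \<theta>_def matrix_vector_mult_scaleR)
    also have "\<dots> = ennreal ((2 * pi) powr (- real CARD('n) / 2)) * (\<integral>\<^sup>+z. ennreal (exp (- (norm z)\<^sup>2 / 2)) * f (t *\<^sub>R \<theta> + z) \<partial>lborel)"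
      by (rule nn_integral_std_normal_vec) measurable
    also have "(\<integral>\<^sup>+z. ennreal (exp (- (norm z)\<^sup>2 / 2)) * f (t *\<^sub>R \<theta> + z) \<partial>lborel) = (\<integral>\<^sup>+z. f z * g t z \<partial>lborel)"
      using nn_integral_translate[of "\<lambda>z. f z * g t z" "t *\<^sub>R \<theta>"] by (simp add: g_def mult.commute)
    finally show ?thesis .
  qed
  have R_int: "(\<integral>\<^sup>+z. h (R z) \<partial>lborel) = (\<integral>\<^sup>+z. h z \<partial>lborel)" if [measurable]: "h \<in> borel_measurable borel" for h
  proof -
    define r where "r = (\<lambda>z. z - (2 * (\<theta> \<bullet> z) / N) *\<^sub>R \<theta>)"
    have "linear r" unfolding r_def
      by (rule linearI) (simp_all add: inner_add_right algebra_simps add_divide_distrib)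
    moreover have "r v \<bullet> r w = v \<bullet> w" for v w
    proof -
      have "r v \<bullet> r w = v \<bullet> w - 2 * (\<theta> \<bullet> w) / N * (\<theta> \<bullet> v) - 2 * (\<theta> \<bullet> v) / N * (\<theta> \<bullet> w) + (2 * (\<theta> \<bullet> v) / N) * (2 * (\<theta> \<bullet> w) / N) * N"
        unfolding r_def N_def by (simp add: inner_diff_left inner_diff_right inner_commute)
      then show ?thesis using N by simp
    qed
    ultimately have o: "orthogonal_transformation r" by (simp add: orthogonal_transformation_def)
    have Rr: "R z = (t + t') *\<^sub>R \<theta> + r z" for z
      by (simp add: R_def r_def \<kappa>_def algebra_simps)
    have "(\<integral>\<^sup>+z. h (R z) \<partial>lborel) = (\<integral>\<^sup>+z. h ((t + t') *\<^sub>R \<theta> + z) \<partial>lborel)"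
      unfolding Rr by (rule nn_integral_orthogonal[OF o]) measurable
    then show ?thesis by (simp add: nn_integral_translate)
  qed
  have [measurable]: "R \<in> borel_measurable borel" unfolding R_def \<kappa>_def by measurable
  have \<kappa>N: "\<kappa> z * N = (t + t') * N - 2 * (\<theta> \<bullet> z)" for z
    using N by (simp add: \<kappa>_def field_simps)
  have nsq: "(norm (z + c *\<^sub>R \<theta>))\<^sup>2 = (norm z)\<^sup>2 + 2 * c * (\<theta> \<bullet> z) + c\<^sup>2 * N" for z c
    unfolding power2_norm_eq_inner N_def
    by (simp add: inner_add_left inner_add_right inner_commute power2_eq_square algebra_simps)
  have normR: "(norm (R z - s *\<^sub>R \<theta>))\<^sup>2 = (norm (z - (t + t' - s) *\<^sub>R \<theta>))\<^sup>2" for z s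
  proof -
    have "R z - s *\<^sub>R \<theta> = z + (\<kappa> z - s) *\<^sub>R \<theta>" by (simp add: R_def algebra_simps)
    then have "(norm (R z - s *\<^sub>R \<theta>))\<^sup>2 = (norm z)\<^sup>2 + 2 * (\<kappa> z - s) * (\<theta> \<bullet> z) + (\<kappa> z - s)\<^sup>2 * N"
      using nsq by simp
    moreover have "(norm (z - (t + t' - s) *\<^sub>R \<theta>))\<^sup>2 = (norm z)\<^sup>2 + 2 * (s - t - t') * (\<theta> \<bullet> z) + (s - t - t')\<^sup>2 * N"
      using nsq[of z "s - t - t'"] by (simp add: algebra_simps)
    moreover have "2 * (\<theta> \<bullet> z) = (t + t' - \<kappa> z) * N" using \<kappa>N[of z] by (simp add: algebra_simps)
    then have "2 * (\<kappa> z - s) * (\<theta> \<bullet> z) + (\<kappa> z - s)\<^sup>2 * N = 2 * (s - t - t') * (\<theta> \<bullet> z) + (s - t - t')\<^sup>2 * N"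
      by algebra
    ultimately show ?thesis by simp
  qed
  have gR: "g t (R z) = g t' z" "g t' (R z) = g t z" for z
    using normR[of z t] normR[of z t'] by (simp_all add: g_def)
  have VresR: "Vres (R z) = Vres z" for z
    using equivariance[of 0 "\<kappa> z *\<^sub>R \<gamma>" 1 z] by (simp add: Vres_def R_def \<theta>_def matrix_vector_mult_scaleR add.commute)
  \<comment> \<open>Since t + t' is nonnegative, the sign of \<open>\<kappa> z\<close> decides
    whether the reflection increases the fitted norm. The same sign orders the two densities, so the
    two monotonicities match.\<close>
  have VfitR: "Vfit (R z) = Vfit z + \<kappa> z * (t + t') * N" for z
  proof -
    have "lscoef X (R z) = lscoef X z + \<kappa> z *\<^sub>R \<gamma>"
      using equivariance(2)[of 0 "\<kappa> z *\<^sub>R \<gamma>" 1 z] by (simp add: R_def \<theta>_def matrix_vector_mult_scaleR add.commute)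
    then have "X *v lscoef X (R z) = X *v lscoef X z + \<kappa> z *\<^sub>R \<theta>"
      by (simp add: \<theta>_def matrix_vector_right_distrib matrix_vector_mult_scaleR)
    then have "Vfit (R z) = Vfit z + 2 * \<kappa> z * (\<theta> \<bullet> z) + (\<kappa> z)\<^sup>2 * N"
      unfolding Vfit_def inner[of z] by (simp add: nsq)
    moreover have "2 * (\<theta> \<bullet> z) = (t + t' - \<kappa> z) * N" using \<kappa>N[of z] by (simp add: algebra_simps)
    then have "2 * \<kappa> z * (\<theta> \<bullet> z) + (\<kappa> z)\<^sup>2 * N = \<kappa> z * (t + t') * N" by algebra
    ultimately show ?thesis by simp
  qed
  have g_le: "norm (z - t *\<^sub>R \<theta>) \<le> norm (z - t' *\<^sub>R \<theta>) \<longleftrightarrow> 0 \<le> (t' - t) * \<kappa> z" for z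
  proof -
    have "(norm (z - t' *\<^sub>R \<theta>))\<^sup>2 - (norm (z - t *\<^sub>R \<theta>))\<^sup>2 = (t' - t) * ((t + t') * N - 2 * (\<theta> \<bullet> z))"
      using nsq[of z "- t"] nsq[of z "- t'"] by (simp add: power2_eq_square algebra_simps)
    also have "\<dots> = (t' - t) * \<kappa> z * N" by (simp only: \<kappa>N[symmetric] mult.assoc)
    finally have e: "(norm (z - t' *\<^sub>R \<theta>))\<^sup>2 - (norm (z - t *\<^sub>R \<theta>))\<^sup>2 = (t' - t) * \<kappa> z * N" .
    have "norm (z - t *\<^sub>R \<theta>) \<le> norm (z - t' *\<^sub>R \<theta>) \<longleftrightarrow> 0 \<le> (norm (z - t' *\<^sub>R \<theta>))\<^sup>2 - (norm (z - t *\<^sub>R \<theta>))\<^sup>2"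
      by (simp add: power2_le_iff_abs_le)
    then show ?thesis unfolding e using N by (simp add: zero_le_mult_iff)
  qed
  \<comment> \<open>Rearrangement inequality without subtraction, as the values may be infinite: for
    b = a + x and d = c + y the excess is x y.\<close>
  have rearr: "a * d + b * c \<le> a * c + b * d" if "a \<le> b \<and> c \<le> d \<or> b \<le> a \<and> d \<le> c" for a b c d :: ennreal
  proof -
    have *: "a * d + b * c \<le> a * c + b * d" if ab: "a \<le> b" and cd: "c \<le> d" for a b c d :: ennreal
    proof -
      obtain x where x: "b = a + x" using ab by (auto simp: le_iff_add)
      obtain y where y: "d = c + y" using cd by (auto simp: le_iff_add)
      have "a * c + b * d = (a * d + b * c) + x * y" unfolding x y by (simp add: algebra_simps)
      then show ?thesis by simp
    qed
    from that show ?thesis using *[of a b c d] *[of b a d c] by (auto simp: add_ac)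
  qed
  have pw: "f z * g t' z + f (R z) * g t' (R z) \<le> f z * g t z + f (R z) * g t (R z)" for z
  proof (cases "t = t'")
    case False
    then have tt: "t' - t > 0" "t + t' > 0" using t by auto
    show ?thesis
    proof (cases "\<kappa> z \<ge> 0")
      case True
      have "Vfit z \<le> Vfit (R z)" using VfitR[of z] True tt N by simp
      then have "f (R z) \<le> f z" unfolding f_def VresR by (intro anti) (auto simp: V_nonneg)
      moreover have "norm (z - t *\<^sub>R \<theta>) \<le> norm (z - t' *\<^sub>R \<theta>)" using g_le True tt by simp
      then have "g t' z \<le> g t z" by (simp add: g_def ennreal_leI power_mono)
      ultimately show ?thesis unfolding gR using rearr[of "f (R z)" "f z" "g t' z" "g t z"] by (simp add: add.commute)
    next
      case False
      have "Vfit (R z) \<le> Vfit z" using VfitR[of z] False tt N by (simp add: mult_nonpos_nonneg)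
      then have "f z \<le> f (R z)" unfolding f_def VresR by (intro anti) (auto simp: V_nonneg)
      moreover have "norm (z - t' *\<^sub>R \<theta>) \<le> norm (z - t *\<^sub>R \<theta>)" using g_le[of z] False tt by (auto simp: zero_le_mult_iff)
      then have "g t z \<le> g t' z" by (simp add: g_def ennreal_leI power_mono)
      ultimately show ?thesis unfolding gR using rearr[of "f z" "f (R z)" "g t z" "g t' z"] by (simp add: add.commute)
    qed
  qed simp
  \<comment> \<open>Each point is paired with its mirror image, so that the pointwise inequality for
    pairs can be integrated.\<close>
  have dbl: "2 * (\<integral>\<^sup>+z. f z * g s z \<partial>lborel) = (\<integral>\<^sup>+z. f z * g s z + f (R z) * g s (R z) \<partial>lborel)" for s
    using R_int[of "\<lambda>z. f z * g s z"] by (subst nn_integral_add) (simp_all add: mult_2)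
  have "2 * (\<integral>\<^sup>+z. f z * g t' z \<partial>lborel) \<le> 2 * (\<integral>\<^sup>+z. f z * g t z \<partial>lborel)"
    unfolding dbl by (intro nn_integral_mono pw)
  then have "(\<integral>\<^sup>+z. f z * g t' z \<partial>lborel) \<le> (\<integral>\<^sup>+z. f z * g t z \<partial>lborel)"
    by (simp add: ennreal_mult_le_mult_iff)
  then show ?thesis unfolding shift by (intro mult_left_mono) auto
qed

section \<open>From normal errors to scale mixtures\<close>

definition base_risk :: "real measure \<Rightarrow> ennreal" where
  "base_risk T = (\<integral>\<^sup>+\<tau>. (\<integral>\<^sup>+z. ennreal (stein_loss (\<tau>\<^sup>2 * Vres z / dof) 1) \<partial>std_normal_vec) \<partial>T)"

text \<open>An everywhere positive version of \<delta>: on the null set where a squared norm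
  vanishes it takes the value 1, so that it belongs to \<open>estimators\<close>.\<close>

definition est :: "real^'n \<Rightarrow> real" where
  "est y = (if 0 < Vfit y \<and> 0 < Vres y then shrink (real CARD('p) / 2 - 1) (dof / 2) (Vfit y / Vres y) * Vres y / dof else 1)"

lemma est_pos:
  assumes "3 \<le> CARD('p)"
  shows "0 < est y"
  using shrink_bounds(2)[of "real CARD('p) / 2 - 1" "dof / 2" "Vfit y / Vres y"] assms dof_eq by (simp add: est_def)

lemma est_measurable:
  assumes "3 \<le> CARD('p)"
  shows "est \<in> borel_measurable borel"
proof -
  have [measurable]: "shrink (real CARD('p) / 2 - 1) (dof / 2) \<in> borel_measurable borel"
    using assms dof_eq by (intro shrink_measurable) auto
  show ?thesis unfolding est_def[abs_def] by measurable
qed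

text \<open>After division by the noise scale s the fitted part is centred at
  \<open>(1 / s) *\<^sub>R \<beta>\<close>: more noise means less noncentrality.\<close>

lemma V_model:
  assumes "s > 0"
  shows "Vfit (\<alpha> *\<^sub>R ones + X *v \<beta> + s *\<^sub>R z) = s\<^sup>2 * Vfit (X *v ((1 / s) *\<^sub>R \<beta>) + z)"
    "Vres (\<alpha> *\<^sub>R ones + X *v \<beta> + s *\<^sub>R z) = s\<^sup>2 * Vres z"
proof -
  have "X *v lscoef X (\<alpha> *\<^sub>R ones + X *v \<beta> + s *\<^sub>R z) = s *\<^sub>R (X *v lscoef X (X *v ((1 / s) *\<^sub>R \<beta>) + z))"
    using equivariance(2)[of \<alpha> \<beta> s z] equivariance(2)[of 0 "(1 / s) *\<^sub>R \<beta>" 1 z] assms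
    by (simp add: matrix_vector_right_distrib matrix_vector_mult_scaleR scaleR_add_right)
  then show "Vfit (\<alpha> *\<^sub>R ones + X *v \<beta> + s *\<^sub>R z) = s\<^sup>2 * Vfit (X *v ((1 / s) *\<^sub>R \<beta>) + z)"
    by (simp add: Vfit_def power_mult_distrib)
  show "Vres (\<alpha> *\<^sub>R ones + X *v \<beta> + s *\<^sub>R z) = s\<^sup>2 * Vres z"
    using equivariance(3)[of \<alpha> \<beta> s z] by (simp add: Vres_def power_mult_distrib)
qed

lemma AE_model: "AE z in lborel. 0 < Vfit (X *v \<gamma> + z) \<and> 0 < Vres z"
  using AE_fit[of \<gamma>] AE_Vres
proof eventually_elim
  case (elim z)
  have "lscoef X (X *v \<gamma> + z) = \<gamma> + lscoef X z" using equivariance(2)[of 0 \<gamma> 1 z] by simp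
  then have "X *v lscoef X (X *v \<gamma> + z) \<noteq> 0" using elim by (simp add: add.commute)
  then show ?case using elim by (simp add: Vfit_def)
qed

text \<open>In terms of x = \<tau>^2 S / m the losses of \<phi> x and of x differ by - ln \<phi> -
  (1 - \<phi>) x, which is the identity L + \<tau>^2 A = R + B below. For a fixed \<tau> < 1 the
  bound B \<le> A does not yield B \<le> \<tau>^2 A; only the average over \<tau> does.\<close>

theorem risk_est_le:
  assumes p3: "3 \<le> CARD('p)" and T: "scale_mixture T" and \<sigma>: "\<sigma> > 0"
  shows "risk T X est \<alpha> \<beta> \<sigma> \<le> base_risk T"
proof -
  define a0 where "a0 = real CARD('p) / 2 - 1"
  define b where "b = dof / 2"
  have a0: "a0 > 0" and b: "b > 0" using p3 dof_eq by (auto simp: a0_def b_def)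
  note [measurable] = shrink_measurable[OF a0 b] est_measurable[OF p3]
  interpret T: prob_space T using T by (simp add: scale_mixture_def)
  have sT [measurable_cong]: "sets T = sets borel" and posT: "AE \<tau> in T. 0 < \<tau>" and T2: "(\<integral>\<^sup>+\<tau>. ennreal (\<tau>\<^sup>2) \<partial>T) = 1"
    using T by (auto simp: scale_mixture_def)
  have spT: "space T = UNIV" using sets_eq_imp_space_eq[OF sT] by simp
  define \<phi> where "\<phi> = (\<lambda>\<tau> z. shrink a0 b (Vfit (X *v ((1 / (\<sigma> * \<tau>)) *\<^sub>R \<beta>) + z) / Vres z))"
  have [measurable]: "(\<lambda>(\<tau>, z). \<phi> \<tau> z) \<in> borel_measurable (borel \<Otimes>\<^sub>M borel)" unfolding \<phi>_def by measurable
  define A where "A = (\<lambda>\<tau>. \<integral>\<^sup>+z. ennreal ((1 - \<phi> \<tau> z) * Vres z / dof) \<partial>std_normal_vec)"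
  define B where "B = (\<lambda>\<tau>. \<integral>\<^sup>+z. ennreal (- ln (\<phi> \<tau> z)) \<partial>std_normal_vec)"
  define L where "L = (\<lambda>\<tau>. \<integral>\<^sup>+z. ennreal (stein_loss (est (\<alpha> *\<^sub>R ones + X *v \<beta> + (\<sigma> * \<tau>) *\<^sub>R z)) (\<sigma>\<^sup>2)) \<partial>std_normal_vec)"
  define R where "R = (\<lambda>\<tau>. \<integral>\<^sup>+z. ennreal (stein_loss (\<tau>\<^sup>2 * Vres z / dof) 1) \<partial>std_normal_vec)"
  have [measurable]: "A \<in> borel_measurable borel" "B \<in> borel_measurable borel" "L \<in> borel_measurable borel" "R \<in> borel_measurable borel"
    unfolding A_def B_def L_def R_def stein_loss_def by measurable
  have good: "AE z in (std_normal_vec :: (real^'n) measure). 0 < Vfit (X *v \<gamma> + z) \<and> 0 < Vres z" for \<gamma>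
    by (rule AE_std_normal_vec[OF AE_model])
  have BA: "B \<tau> \<le> A \<tau>" for \<tau>
    unfolding A_def B_def \<phi>_def a0_def b_def by (rule expectation_shrink_le[OF p3])
  \<comment> \<open>From 0 < \<phi> and E[S / m] = 1. Finiteness of A is needed for the
    cancellations at the end.\<close>
  have A1: "A \<tau> \<le> 1" for \<tau>
  proof -
    have "A \<tau> \<le> (\<integral>\<^sup>+z. ennreal (1 / dof) * ennreal (Vres z) \<partial>std_normal_vec)"
      unfolding A_def
    proof (intro nn_integral_mono_AE, use good in eventually_elim)
      fix z :: "real^'n" assume z: "0 < Vfit (X *v ((1 / (\<sigma> * \<tau>)) *\<^sub>R \<beta>) + z) \<and> 0 < Vres z"
      then have "0 < \<phi> \<tau> z" unfolding \<phi>_def by (intro shrink_bounds a0 b) simp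
      then have "(1 - \<phi> \<tau> z) * Vres z / dof \<le> 1 / dof * Vres z"
        using z dof_eq by (simp add: divide_right_mono mult_left_le_one_le algebra_simps)
      then show "ennreal ((1 - \<phi> \<tau> z) * Vres z / dof) \<le> ennreal (1 / dof) * ennreal (Vres z)"
        using dof_eq z by (simp add: ennreal_mult[symmetric] ennreal_leI)
    qed
    also have "\<dots> = ennreal (1 / dof) * ennreal dof" by (simp add: nn_integral_cmult expectation_Vres)
    also have "\<dots> = 1" using dof_eq by (simp add: ennreal_mult[symmetric])
    finally show ?thesis .
  qed
  have id: "L \<tau> + ennreal (\<tau>\<^sup>2) * A \<tau> = R \<tau> + B \<tau>" if \<tau>: "\<tau> > 0" for \<tau>
  proof -
    have "L \<tau> + ennreal (\<tau>\<^sup>2) * A \<tau> = (\<integral>\<^sup>+z. ennreal (stein_loss (est (\<alpha> *\<^sub>R ones + X *v \<beta> + (\<sigma> * \<tau>) *\<^sub>R z)) (\<sigma>\<^sup>2))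
       + ennreal (\<tau>\<^sup>2) * ennreal ((1 - \<phi> \<tau> z) * Vres z / dof) \<partial>std_normal_vec)"
      unfolding L_def A_def stein_loss_def by (subst nn_integral_add) (simp_all add: nn_integral_cmult)
    also have "\<dots> = (\<integral>\<^sup>+z. ennreal (stein_loss (\<tau>\<^sup>2 * Vres z / dof) 1) + ennreal (- ln (\<phi> \<tau> z)) \<partial>std_normal_vec)"
    proof (intro nn_integral_cong_AE, use good in eventually_elim)
      fix z :: "real^'n" assume z: "0 < Vfit (X *v ((1 / (\<sigma> * \<tau>)) *\<^sub>R \<beta>) + z) \<and> 0 < Vres z"
      define x where "x = \<tau>\<^sup>2 * Vres z / dof"
      have x: "x > 0" using z \<tau> dof_eq by (simp add: x_def)
      have ph: "0 < \<phi> \<tau> z" "\<phi> \<tau> z < 1" unfolding \<phi>_def using z by (auto intro!: shrink_bounds a0 b)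
      have st: "\<sigma> * \<tau> > 0" using \<sigma> \<tau> by simp
      have "est (\<alpha> *\<^sub>R ones + X *v \<beta> + (\<sigma> * \<tau>) *\<^sub>R z) = \<phi> \<tau> z * x * \<sigma>\<^sup>2"
        unfolding est_def V_model[OF st] using z st \<sigma> \<tau> by (simp add: \<phi>_def x_def a0_def b_def power_mult_distrib mult_ac)
      then have l: "stein_loss (est (\<alpha> *\<^sub>R ones + X *v \<beta> + (\<sigma> * \<tau>) *\<^sub>R z)) (\<sigma>\<^sup>2) = \<phi> \<tau> z * x - (ln (\<phi> \<tau> z) + ln x) - 1"
        using \<sigma> ph x by (simp add: stein_loss_def ln_mult)
      have nn1: "\<phi> \<tau> z * x - (ln (\<phi> \<tau> z) + ln x) - 1 \<ge> 0"
        using ln_le_minus_one[of "\<phi> \<tau> z * x"] ph x by (simp add: ln_mult)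
      have base: "stein_loss x 1 = x - ln x - 1" by (simp add: stein_loss_def)
      have nn2: "x - ln x - 1 \<ge> 0" using ln_le_minus_one[of x] x by simp
      have a: "ennreal (\<tau>\<^sup>2) * ennreal ((1 - \<phi> \<tau> z) * Vres z / dof) = ennreal ((1 - \<phi> \<tau> z) * x)"
        using ph z dof_eq by (simp add: ennreal_mult[symmetric] x_def mult_ac)
      have nn3: "(1 - \<phi> \<tau> z) * x \<ge> 0" "- ln (\<phi> \<tau> z) \<ge> 0" using ph x by auto
      show "ennreal (stein_loss (est (\<alpha> *\<^sub>R ones + X *v \<beta> + (\<sigma> * \<tau>) *\<^sub>R z)) (\<sigma>\<^sup>2)) + ennreal (\<tau>\<^sup>2) * ennreal ((1 - \<phi> \<tau> z) * Vres z / dof)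
        = ennreal (stein_loss (\<tau>\<^sup>2 * Vres z / dof) 1) + ennreal (- ln (\<phi> \<tau> z))"
        unfolding l a x_def[symmetric] base
        using nn1 nn2 nn3 by (simp add: ennreal_plus[symmetric] del: ennreal_plus) (simp add: algebra_simps)
    qed
    also have "\<dots> = R \<tau> + B \<tau>"
      unfolding R_def B_def stein_loss_def by (subst nn_integral_add) simp_all
    finally show ?thesis .
  qed
  have mono: "A \<tau> \<le> A \<tau>'" if "0 < \<tau>" "\<tau> \<le> \<tau>'" for \<tau> \<tau>'
  proof -
    define F where "F = (\<lambda>w v. ennreal ((1 - shrink a0 b (w / v)) * v / dof))"
    have F: "case_prod F \<in> borel_measurable borel"
      unfolding borel_prod[symmetric] F_def by measurable
    have A: "A \<tau> = (\<integral>\<^sup>+z. F (Vfit (X *v ((1 / \<tau>) *\<^sub>R ((1 / \<sigma>) *\<^sub>R \<beta>)) + z)) (Vres z) \<partial>std_normal_vec)" for \<tau>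
      by (simp add: A_def F_def \<phi>_def mult.commute)
    show ?thesis unfolding A
    proof (rule expectation_antimono_shift[OF F])
      show "0 \<le> 1 / \<tau>'" "1 / \<tau>' \<le> 1 / \<tau>" using that by (auto simp: frac_le)
      fix w w' v :: real assume w: "0 \<le> w" "w \<le> w'" and v: "0 \<le> v"
      have "shrink a0 b (w / v) \<le> shrink a0 b (w' / v)"
      \<comment> \<open>Division by zero gives 0 and \<open>shrink\<close> is 0 there, the least
        possible value, so monotonicity holds on the closed quadrant.\<close>
      proof (cases "v = 0 \<or> w = 0")
        case True
        then have "shrink a0 b (w / v) = 0" by (auto simp: shrink_def)
        moreover have "0 \<le> shrink a0 b (w' / v)"
          using shrink_bounds(2)[OF a0 b, of "w' / v"] w v by (cases "w' / v = 0") (auto simp: shrink_def less_imp_le)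
        ultimately show ?thesis by simp
      next
        case False
        then show ?thesis using w v by (intro shrink_mono a0 b) (auto simp: divide_right_mono)
      qed
      then show "F w' v \<le> F w v"
        unfolding F_def using v dof_eq by (intro ennreal_leI divide_right_mono mult_right_mono) auto
    qed
  qed
  \<comment> \<open>The inequality (\<tau>^2 - 1) (A \<tau> - A 1) \<ge> 0 with its negative terms
    moved to the other side.\<close>
  have cross: "A \<tau> + ennreal (\<tau>\<^sup>2) * A 1 \<le> ennreal (\<tau>\<^sup>2) * A \<tau> + A 1" if \<tau>: "\<tau> > 0" for \<tau>
  proof -
    obtain x where x: "A \<tau> = ennreal x" "0 \<le> x" using A1[of \<tau>] by (cases "A \<tau>") (auto simp: top_unique)
    obtain y where y: "A 1 = ennreal y" "0 \<le> y" using A1[of 1] by (cases "A 1") (auto simp: top_unique)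
    have "0 \<le> (\<tau>\<^sup>2 - 1) * (x - y)"
    proof (cases "\<tau> \<ge> 1")
      case True
      then have "y \<le> x" using mono[of 1 \<tau>] x y by simp
      moreover have "\<tau>\<^sup>2 \<ge> 1" using True by (simp add: one_le_power)
      ultimately show ?thesis by simp
    next
      case False
      then have "x \<le> y" using mono[of \<tau> 1] x y \<tau> by simp
      moreover have "\<tau>\<^sup>2 \<le> 1" using False \<tau> by (simp add: power_le_one)
      ultimately show ?thesis by (simp add: mult_nonpos_nonpos)
    qed
    then have "x + \<tau>\<^sup>2 * y \<le> \<tau>\<^sup>2 * x + y" by (simp add: algebra_simps)
    then show ?thesis using x y
      by (simp add: ennreal_mult[symmetric] ennreal_plus[symmetric] ennreal_leI del: ennreal_plus)
  qed
  have fin: "(\<integral>\<^sup>+\<tau>. ennreal (\<tau>\<^sup>2) * A \<tau> \<partial>T) \<noteq> \<infinity>"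
  proof -
    have "(\<integral>\<^sup>+\<tau>. ennreal (\<tau>\<^sup>2) * A \<tau> \<partial>T) \<le> (\<integral>\<^sup>+\<tau>. ennreal (\<tau>\<^sup>2) * 1 \<partial>T)"
      by (intro nn_integral_mono mult_left_mono A1) simp
    then show ?thesis using T2 by (auto simp: top_unique)
  qed
  \<comment> \<open>Because E[\<tau>^2] = 1, the integral of \<tau>^2 A(1) is A(1), and it cancels
    against the same term on the right.\<close>
  have "(\<integral>\<^sup>+\<tau>. A \<tau> \<partial>T) + A 1 = (\<integral>\<^sup>+\<tau>. A \<tau> + ennreal (\<tau>\<^sup>2) * A 1 \<partial>T)"
    by (subst nn_integral_add) (simp_all add: nn_integral_multc T2)
  also have "\<dots> \<le> (\<integral>\<^sup>+\<tau>. ennreal (\<tau>\<^sup>2) * A \<tau> + A 1 \<partial>T)"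
    by (rule nn_integral_mono_AE) (use posT in eventually_elim, rule cross)
  also have "\<dots> = (\<integral>\<^sup>+\<tau>. ennreal (\<tau>\<^sup>2) * A \<tau> \<partial>T) + A 1"
    by (subst nn_integral_add) (simp_all add: T.emeasure_space_1)
  finally have IA: "(\<integral>\<^sup>+\<tau>. A \<tau> \<partial>T) \<le> (\<integral>\<^sup>+\<tau>. ennreal (\<tau>\<^sup>2) * A \<tau> \<partial>T)"
    using A1[of 1] by (subst (asm) (1 2) add.commute) (auto simp: ennreal_add_left_cancel_le top_unique)
  have "(\<integral>\<^sup>+\<tau>. L \<tau> \<partial>T) + (\<integral>\<^sup>+\<tau>. ennreal (\<tau>\<^sup>2) * A \<tau> \<partial>T) = (\<integral>\<^sup>+\<tau>. L \<tau> + ennreal (\<tau>\<^sup>2) * A \<tau> \<partial>T)"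
    by (subst nn_integral_add) simp_all
  also have "\<dots> = (\<integral>\<^sup>+\<tau>. R \<tau> + B \<tau> \<partial>T)"
    by (rule nn_integral_cong_AE) (use posT in eventually_elim, rule id)
  also have "\<dots> = (\<integral>\<^sup>+\<tau>. R \<tau> \<partial>T) + (\<integral>\<^sup>+\<tau>. B \<tau> \<partial>T)"
    by (subst nn_integral_add) simp_all
  also have "\<dots> \<le> (\<integral>\<^sup>+\<tau>. R \<tau> \<partial>T) + (\<integral>\<^sup>+\<tau>. ennreal (\<tau>\<^sup>2) * A \<tau> \<partial>T)"
    using nn_integral_mono[of T B A] BA IA by (intro add_left_mono) (meson order_trans)
  finally have "(\<integral>\<^sup>+\<tau>. L \<tau> \<partial>T) \<le> (\<integral>\<^sup>+\<tau>. R \<tau> \<partial>T)"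
    using fin by (subst (asm) (1 2) add.commute) (auto simp: ennreal_add_left_cancel_le)
  then show ?thesis by (simp add: risk_def L_def base_risk_def R_def)
qed

end

section \<open>Lower bound for the maximum risk\<close>

context wide_design
begin

text \<open>The joint law is a product, as rectangles show, so by Fubini the direction of z may be
  replaced by that of an independent copy z'.\<close>

lemma direction_indep_integral:
  assumes F: "F \<in> borel_measurable ((borel \<Otimes>\<^sub>M borel) \<Otimes>\<^sub>M borel)"
  shows "(\<integral>\<^sup>+z. F ((Vloc z, Vres z), direction z) \<partial>std_normal_vec) =
    (\<integral>\<^sup>+z'. (\<integral>\<^sup>+z. F ((Vloc z, Vres z), direction z') \<partial>std_normal_vec) \<partial>std_normal_vec)"
proof -
  let ?N = "std_normal_vec :: (real^'n) measure"
  define M1 where "M1 = distr ?N (borel \<Otimes>\<^sub>M borel) (\<lambda>z. (Vloc z, Vres z))"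
  define M2 where "M2 = distr ?N borel direction"
  define M where "M = distr ?N ((borel \<Otimes>\<^sub>M borel) \<Otimes>\<^sub>M borel) (\<lambda>z. ((Vloc z, Vres z), direction z))"
  interpret M1: prob_space M1 unfolding M1_def by (rule std_normal.prob_space_distr) measurable
  interpret M2: prob_space M2 unfolding M2_def by (rule std_normal.prob_space_distr) measurable
  interpret P: pair_sigma_finite M1 M2 ..
  have s [measurable_cong]: "sets M1 = sets (borel \<Otimes>\<^sub>M borel)" "sets M2 = sets borel" by (simp_all add: M1_def M2_def)
  have "M1 \<Otimes>\<^sub>M M2 = M"
  proof (rule pair_measure_eqI)
    show "sigma_finite_measure M1" "sigma_finite_measure M2" by unfold_locales
    show "sets (M1 \<Otimes>\<^sub>M M2) = sets M"
      unfolding M_def sets_distr by (rule sets_pair_measure_cong) (simp_all add: s)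
    fix A B assume "A \<in> sets M1" "B \<in> sets M2"
    then have A [measurable]: "A \<in> sets (borel \<Otimes>\<^sub>M borel)" and B [measurable]: "B \<in> sets borel" by (simp_all add: s)
    have mA: "case_prod (\<lambda>w v. indicator A (w, v) :: ennreal) \<in> borel_measurable borel"
      using A unfolding borel_prod[symmetric] by simp
    have "emeasure M (A \<times> B) = (\<integral>\<^sup>+z. indicator (A \<times> B) ((Vloc z, Vres z), direction z) \<partial>?N)"
      unfolding M_def by (subst nn_integral_indicator[symmetric], simp, subst nn_integral_distr) simp_all
    also have "\<dots> = (\<integral>\<^sup>+z. indicator A (Vloc z, Vres z) * indicator B (direction z) \<partial>?N)"
      by (simp add: indicator_times)
    also have "\<dots> = (\<integral>\<^sup>+z. indicator A (Vloc z, Vres z) \<partial>?N) * (\<integral>\<^sup>+z. indicator B (direction z) \<partial>?N)"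
      by (rule direction_indep[OF B mA])
    also have "(\<integral>\<^sup>+z. indicator A (Vloc z, Vres z) \<partial>?N) = emeasure M1 A"
      unfolding M1_def by (subst nn_integral_indicator[symmetric], simp, subst nn_integral_distr) simp_all
    also have "(\<integral>\<^sup>+z. indicator B (direction z) \<partial>?N) = emeasure M2 B"
      unfolding M2_def by (subst nn_integral_indicator[symmetric], simp, subst nn_integral_distr) simp_all
    finally show "emeasure M1 A * emeasure M2 B = emeasure M (A \<times> B)" by simp
  qed
  have "(\<integral>\<^sup>+z. F ((Vloc z, Vres z), direction z) \<partial>?N) = (\<integral>\<^sup>+x. F x \<partial>M)"
    unfolding M_def using F by (subst nn_integral_distr) simp_all
  also have "\<dots> = (\<integral>\<^sup>+u. (\<integral>\<^sup>+y. F (y, u) \<partial>M1) \<partial>M2)"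
    unfolding \<open>M1 \<Otimes>\<^sub>M M2 = M\<close>[symmetric] using F by (subst P.nn_integral_snd[symmetric]) (simp_all cong: measurable_cong_sets)
  also have "\<dots> = (\<integral>\<^sup>+u. (\<integral>\<^sup>+z. F ((Vloc z, Vres z), u) \<partial>?N) \<partial>M2)"
    unfolding M1_def using F by (subst nn_integral_distr) simp_all
  also have "\<dots> = (\<integral>\<^sup>+z'. (\<integral>\<^sup>+z. F ((Vloc z, Vres z), direction z') \<partial>?N) \<partial>?N)"
    unfolding M2_def using F by (subst nn_integral_distr) simp_all
  finally show ?thesis .
qed

section \<open>Location shifts and scale changes as a group acting on the data\<close>

definition loc :: "real^'n \<Rightarrow> real \<times> (real^'p)" where "loc y = (ybar y, lscoef X y)"
definition fit :: "real \<times> (real^'p) \<Rightarrow> real^'n" where "fit v = fst v *\<^sub>R ones + X *v snd v"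

lemma linear_fit: "linear fit"
  by (rule linearI) (simp_all add: fit_def algebra_simps matrix_vector_right_distrib matrix_vector_mult_scaleR)

lemmas measurable_fit [measurable] = borel_measurable_linear[OF linear_fit]

lemma norm_fit_loc: "(norm (fit (loc y)))\<^sup>2 = Vloc y"
  by (simp add: fit_def loc_def Vloc_def Vfit_def power2_norm_eq_inner inner_add_left inner_add_right ones_inner_ones)
     (simp add: power2_eq_square)

text \<open>A linear injection of a finite-dimensional space is bounded below. The constant turns a
  bound on the fitted mean into a bound on the pair (\<alpha>, \<beta>).\<close>

lemma fit_bounded_below:
  obtains C where "C > 0" "\<And>v. norm v \<le> C * norm (fit v)"
proof -
  have "v = 0" if "fit v = 0" for v
  proof -
    have "0 = fst v *\<^sub>R ones + X *v snd v + 0" using that by (simp add: fit_def)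
    have z: "ybar (0 :: real^'n) = 0" "lscoef X 0 = 0"
      by (rule linear_0[OF linear_ybar], rule linear_0[OF linear_lscoef])
    from decomposition_unique[OF \<open>0 = _\<close>] have "fst v = 0" "snd v = 0" unfolding z by simp_all
    then show "v = 0" by (simp add: prod_eq_iff)
  qed
  then have "inj fit" using linear_fit by (simp add: linear_injective_0)
  from linear_inj_bounded_below_pos[OF linear_fit this]
  obtain B where B: "0 < B" "\<And>v. B * norm v \<le> norm (fit v)" by blast
  show ?thesis
  proof
    show "1 / B > 0" using B by simp
    show "norm v \<le> 1 / B * norm (fit v)" for v using B(2)[of v] B(1) by (simp add: field_simps)
  qed
qed

text \<open>Exhibits the data as the group element with location \<open>loc y\<close> and scale
  \<open>sqrt (Vres y)\<close> applied to the invariant \<open>direction y\<close>.\<close>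

lemma polar_decomposition: "y = fit (loc y) + sqrt (Vres y) *\<^sub>R direction y"
proof -
  have "sqrt (Vres y) *\<^sub>R direction y = resid X y" by (simp add: Vres_def direction_def)
  then show ?thesis using decomposition[of y] by (simp add: fit_def loc_def)
qed

text \<open>The noise \<tau> z, seen as a group element, stays in a bounded set: its fitted mean has
  norm at most L, and the logarithm of its scale \<open>\<tau> * sqrt (Vres z)\<close> lies in
  [-L, L]. Both conditions are stated for squares, hence \<open>2 * L\<close>.\<close>

definition window :: "real \<Rightarrow> real \<Rightarrow> real^'n \<Rightarrow> bool" where
  "window L \<tau> z \<longleftrightarrow> 0 < \<tau> \<and> \<tau>\<^sup>2 * Vloc z \<le> L\<^sup>2 \<and> exp (- 2 * L) \<le> \<tau>\<^sup>2 * Vres z \<and> \<tau>\<^sup>2 * Vres z \<le> exp (2 * L)"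

definition windowed_risk :: "real measure \<Rightarrow> real \<Rightarrow> real \<Rightarrow> ennreal" where
  "windowed_risk T L c = (\<integral>\<^sup>+\<tau>. (\<integral>\<^sup>+z. indicator {z. window L \<tau> z} z * ennreal (stein_loss (c * (\<tau>\<^sup>2 * Vres z)) 1) \<partial>std_normal_vec) \<partial>T)"

lemma window_measurable [measurable]:
  "(\<lambda>(\<tau>, z). indicator {z. window L \<tau> z} z :: ennreal) \<in> borel_measurable (borel \<Otimes>\<^sub>M borel)"
proof -
  have "Measurable.pred (borel \<Otimes>\<^sub>M borel) (\<lambda>(\<tau>, z). window L \<tau> z)" unfolding window_def by measurable
  then have "{x \<in> space (borel \<Otimes>\<^sub>M borel). case_prod (window L) x} \<in> sets (borel \<Otimes>\<^sub>M borel)" by (rule predE)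
  then have "indicator {x. case_prod (window L) x} \<in> borel_measurable (borel \<Otimes>\<^sub>M borel)"
    by (intro borel_measurable_indicator) (simp add: space_pair_measure)
  moreover have "(\<lambda>(\<tau>, z). indicator {z. window L \<tau> z} z :: ennreal) = indicator {x. case_prod (window L) x}"
    by (auto simp: fun_eq_iff indicator_def)
  ultimately show ?thesis by (simp only:)
qed

text \<open>The maximum risk is bounded below by a Bayes risk for the right Haar measure on location and
  logarithmic scale, truncated to a box. For fixed \<open>(\<tau>, z)\<close> the parameter is moved by right
  translation so that the estimator sees \<open>z\<close> only through its residual direction.\<close>

lemma box_average_le_max_risk:
  assumes T: "scale_mixture T" and d: "d \<in> estimators"
    and C: "\<And>v. norm v \<le> C * norm (fit v)" "C > 0"
    and J: "\<And>c. c > 0 \<Longrightarrow> J \<le> windowed_risk T L c"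
    and A: "A \<ge> 0" and K: "K \<ge> 0" and L: "L \<ge> 0"
  shows "ennreal (2 * K) * emeasure lborel (cball (0 :: real \<times> (real^'p)) A) * J
    \<le> ennreal (2 * (K + L)) * emeasure lborel (cball (0 :: real \<times> (real^'p)) (A + exp (K + L) * (C * L))) * max_risk T X d"
proof -
  let ?N = "std_normal_vec :: (real^'n) measure"
  \<comment> \<open>Right translation displaces the location parameter by at most the largest scale
    on the enlarged range, exp (K + L), times the bound C L on the location of the noise.\<close>
  let ?A' = "A + exp (K + L) * (C * L)"
  interpret T: prob_space T using T by (simp add: scale_mixture_def)
  have sT [measurable_cong]: "sets T = sets borel" using T by (simp add: scale_mixture_def)
  have dm [measurable]: "d \<in> borel_measurable borel" and dpos: "\<And>y. 0 < d y"
    using d by (auto simp: estimators_def)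
  interpret TN: pair_prob_space T ?N ..
  interpret TNL: pair_sigma_finite "T \<Otimes>\<^sub>M ?N" "lborel :: real measure" ..
  interpret TNV: pair_sigma_finite "T \<Otimes>\<^sub>M ?N" "lborel :: (real \<times> (real^'p)) measure" ..
  \<comment> \<open>The loss at (\<alpha>, \<beta>) = v and \<sigma> = exp \<kappa>. In these
    coordinates right Haar measure is Lebesgue measure.\<close>
  define G where "G = (\<lambda>\<kappa> v \<tau> z. ennreal (stein_loss (d (fit v + (exp \<kappa> * \<tau>) *\<^sub>R z)) ((exp \<kappa>)\<^sup>2)))"
  have Gm [measurable]: "(\<lambda>(\<kappa>, v, \<tau>, z). G \<kappa> v \<tau> z) \<in> borel_measurable (borel \<Otimes>\<^sub>M borel \<Otimes>\<^sub>M borel \<Otimes>\<^sub>M borel)"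
    unfolding G_def stein_loss_def by measurable
  have Gm' [measurable]: "(\<lambda>p. G (fst p) (snd p) \<tau> z) \<in> borel_measurable (borel \<Otimes>\<^sub>M borel)" for \<tau> z
    unfolding G_def stein_loss_def by measurable
  have Gv [measurable]: "(\<lambda>v. G \<kappa> v \<tau> z) \<in> borel_measurable borel" for \<kappa> \<tau> z
    unfolding G_def stein_loss_def by measurable
  have Gi [measurable]: "(\<lambda>\<kappa>. \<integral>\<^sup>+v. indicator S v * G \<kappa> v \<tau> z \<partial>lborel) \<in> borel_measurable borel"
    if [measurable]: "S \<in> sets borel" for S :: "(real \<times> (real^'p)) set" and \<tau> z
    by (rule lborel.borel_measurable_nn_integral) (use Gm'[of \<tau> z] in \<open>simp add: case_prod_beta'\<close>)
  \<comment> \<open>The estimate divided by the variance when the data consist of location v and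
    scale exp \<kappa> applied to a residual direction u. With it as multiplier of S, the loss is
    H.\<close>
  define c where "c = (\<lambda>\<kappa> v u. d (fit v + exp \<kappa> *\<^sub>R u) / (exp \<kappa>)\<^sup>2)"
  have cm [measurable]: "(\<lambda>(\<kappa>, v, u). c \<kappa> v u) \<in> borel_measurable (borel \<Otimes>\<^sub>M borel \<Otimes>\<^sub>M borel)"
    unfolding c_def by measurable
  have cpos: "c \<kappa> v u > 0" for \<kappa> v u using dpos by (simp add: c_def)
  define H where "H = (\<lambda>\<kappa> v \<tau> z. ennreal (stein_loss (c \<kappa> v (direction z) * (\<tau>\<^sup>2 * Vres z)) 1))"
  have Hm [measurable]: "(\<lambda>(\<kappa>, v, \<tau>, z). H \<kappa> v \<tau> z) \<in> borel_measurable (borel \<Otimes>\<^sub>M borel \<Otimes>\<^sub>M borel \<Otimes>\<^sub>M borel)"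
    unfolding H_def c_def stein_loss_def by measurable
  have cm' [measurable]: "c \<kappa> v \<in> borel_measurable borel" for \<kappa> v
    unfolding c_def by measurable
  have risk: "(\<integral>\<^sup>+x. G \<kappa> v (fst x) (snd x) \<partial>(T \<Otimes>\<^sub>M ?N)) \<le> max_risk T X d" for \<kappa> v
  proof -
    have "(\<integral>\<^sup>+x. G \<kappa> v (fst x) (snd x) \<partial>(T \<Otimes>\<^sub>M ?N)) = risk T X d (fst v) (snd v) (exp \<kappa>)"
      unfolding risk_def G_def fit_def
      by (subst std_normal.nn_integral_fst[symmetric]) (simp_all add: stein_loss_def)
    also have "\<dots> \<le> max_risk T X d"
      unfolding max_risk_def by (intro SUP_upper2[where i = "fst v"] SUP_upper2[where i = "snd v"] SUP_upper2[where i = "exp \<kappa>"]) auto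
    finally show ?thesis .
  qed
  \<comment> \<open>The window and S depend only on the two squared norms, so the multiplier, a
    function of the direction, is independent of them, and the bound J for constant multipliers
    applies to each of its values.\<close>
  have bracket: "J \<le> (\<integral>\<^sup>+x. indicator {z. window L (fst x) z} (snd x) * H \<kappa> v (fst x) (snd x) \<partial>(T \<Otimes>\<^sub>M ?N))" for \<kappa> v
  proof -
    have "J = (\<integral>\<^sup>+z'. J \<partial>?N)" by simp
    also have "\<dots> \<le> (\<integral>\<^sup>+z'. windowed_risk T L (c \<kappa> v (direction z')) \<partial>?N)"
      by (intro nn_integral_mono J cpos)
    also have "\<dots> = (\<integral>\<^sup>+\<tau>. (\<integral>\<^sup>+z'. (\<integral>\<^sup>+z. indicator {z. window L \<tau> z} z * ennreal (stein_loss (c \<kappa> v (direction z') * (\<tau>\<^sup>2 * Vres z)) 1) \<partial>?N) \<partial>?N) \<partial>T)"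
      unfolding windowed_risk_def by (rule TN.Fubini') (simp add: stein_loss_def)
    also have "\<dots> = (\<integral>\<^sup>+\<tau>. (\<integral>\<^sup>+z. indicator {z. window L \<tau> z} z * H \<kappa> v \<tau> z \<partial>?N) \<partial>T)"
    proof (rule nn_integral_cong)
      fix \<tau>
      define F where "F = (\<lambda>x. indicator {(w, s). 0 < \<tau> \<and> \<tau>\<^sup>2 * w \<le> L\<^sup>2 \<and> exp (- 2 * L) \<le> \<tau>\<^sup>2 * s \<and> \<tau>\<^sup>2 * s \<le> exp (2 * L)} (fst x) *
        ennreal (stein_loss (c \<kappa> v (snd x) * (\<tau>\<^sup>2 * snd (fst x))) 1))"
      have F: "F \<in> borel_measurable ((borel \<Otimes>\<^sub>M borel) \<Otimes>\<^sub>M borel)"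
      proof -
        have "Measurable.pred (borel \<Otimes>\<^sub>M borel) (\<lambda>(w, s). 0 < \<tau> \<and> \<tau>\<^sup>2 * w \<le> L\<^sup>2 \<and> exp (- 2 * L) \<le> \<tau>\<^sup>2 * s \<and> \<tau>\<^sup>2 * s \<le> exp (2 * L))"
          by measurable
        then have [measurable]: "{(w, s). 0 < \<tau> \<and> \<tau>\<^sup>2 * w \<le> L\<^sup>2 \<and> exp (- 2 * L) \<le> \<tau>\<^sup>2 * s \<and> \<tau>\<^sup>2 * s \<le> exp (2 * L)} \<in> sets (borel \<Otimes>\<^sub>M borel)"
          by (simp add: pred_def space_pair_measure)
        show ?thesis unfolding F_def stein_loss_def by measurable
      qed
      show "(\<integral>\<^sup>+z'. (\<integral>\<^sup>+z. indicator {z. window L \<tau> z} z * ennreal (stein_loss (c \<kappa> v (direction z') * (\<tau>\<^sup>2 * Vres z)) 1) \<partial>?N) \<partial>?N)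
        = (\<integral>\<^sup>+z. indicator {z. window L \<tau> z} z * H \<kappa> v \<tau> z \<partial>?N)"
        using direction_indep_integral[OF F] by (simp add: F_def H_def window_def indicator_def)
    qed
    also have "\<dots> = (\<integral>\<^sup>+x. indicator {z. window L (fst x) z} (snd x) * H \<kappa> v (fst x) (snd x) \<partial>(T \<Otimes>\<^sub>M ?N))"
      by (subst std_normal.nn_integral_fst[symmetric]) (simp_all add: case_prod_beta')
    finally show ?thesis .
  qed
  have transl: "(\<integral>\<^sup>+\<kappa>. indicator {- K..K} \<kappa> * (\<integral>\<^sup>+v. indicator (cball 0 A) v * H \<kappa> v \<tau> z \<partial>lborel) \<partial>lborel)
    \<le> (\<integral>\<^sup>+\<kappa>. indicator {- (K + L)..K + L} \<kappa> * (\<integral>\<^sup>+v. indicator (cball 0 ?A') v * G \<kappa> v \<tau> z \<partial>lborel) \<partial>lborel)"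
    if w: "window L \<tau> z" for \<tau> z
  proof -
    \<comment> \<open>Location and scale of the noise \<tau> z as a group element.\<close>
    define a where "a = \<tau> *\<^sub>R loc z"
    define \<rho> where "\<rho> = \<tau> * sqrt (Vres z)"
    have \<tau>: "\<tau> > 0" and Q: "exp (- 2 * L) \<le> \<tau>\<^sup>2 * Vres z" "\<tau>\<^sup>2 * Vres z \<le> exp (2 * L)" and W: "\<tau>\<^sup>2 * Vloc z \<le> L\<^sup>2"
      using w by (auto simp: window_def)
    have "0 < \<tau>\<^sup>2 * Vres z" using Q(1) exp_gt_zero less_le_trans by blast
    then have Vp: "Vres z > 0" using \<tau> by (simp add: zero_less_mult_iff)
    have \<rho>: "\<rho> > 0" "\<rho>\<^sup>2 = \<tau>\<^sup>2 * Vres z" using \<tau> Vp by (auto simp: \<rho>_def power_mult_distrib)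
    have ln2: "2 * ln \<rho> = ln (\<tau>\<^sup>2 * Vres z)" using \<rho> by (simp add: ln_realpow flip: \<rho>(2))
    have "ln (exp (- 2 * L)) \<le> ln (\<tau>\<^sup>2 * Vres z)" using Q Vp \<tau> by (subst ln_le_cancel_iff) auto
    moreover have "ln (\<tau>\<^sup>2 * Vres z) \<le> ln (exp (2 * L))" using Q Vp \<tau> by (subst ln_le_cancel_iff) auto
    ultimately have ln\<rho>: "- L \<le> ln \<rho>" "ln \<rho> \<le> L" using ln2 by auto
    have na: "norm a \<le> C * L"
    proof -
      have "norm (fit (loc z)) = sqrt (Vloc z)" using norm_fit_loc[of z] by (metis norm_ge_zero real_sqrt_unique)
      moreover have "\<tau> * sqrt (Vloc z) \<le> L"
      proof (rule power2_le_imp_le)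
        show "(\<tau> * sqrt (Vloc z))\<^sup>2 \<le> L\<^sup>2" using W V_nonneg(3)[of z] by (simp add: power_mult_distrib)
      qed (rule L)
      ultimately have "\<tau> * norm (fit (loc z)) \<le> L" by simp
      moreover have "norm a \<le> \<tau> * (C * norm (fit (loc z)))"
        unfolding a_def using C(1)[of "loc z"] \<tau> by simp
      moreover have "C * (\<tau> * norm (fit (loc z))) \<le> C * L"
        using \<open>\<tau> * norm (fit (loc z)) \<le> L\<close> C(2) by simp
      ultimately show ?thesis by (simp add: mult.left_commute)
    qed
    have zdec: "\<tau> *\<^sub>R z = fit a + \<rho> *\<^sub>R direction z"
      by (subst polar_decomposition[of z]) (simp add: a_def \<rho>_def scaleR_add_right linear_cmul[OF linear_fit])
    \<comment> \<open>Right translation of the parameter by the inverse of the noise: the location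
      of the noise is subtracted at the new scale, and its own scale is absorbed into
      \<kappa>.\<close>
    have GH: "G (\<kappa> - ln \<rho>) (v - exp (\<kappa> - ln \<rho>) *\<^sub>R a) \<tau> z = H \<kappa> v \<tau> z" for \<kappa> v
    proof -
      have e: "exp (\<kappa> - ln \<rho>) * \<rho> = exp \<kappa>" using \<rho> by (simp add: exp_diff)
      have "fit (v - exp (\<kappa> - ln \<rho>) *\<^sub>R a) + (exp (\<kappa> - ln \<rho>) * \<tau>) *\<^sub>R z = fit v + exp \<kappa> *\<^sub>R direction z"
        using zdec e by (simp add: linear_diff[OF linear_fit] linear_cmul[OF linear_fit] scaleR_scaleR[symmetric] scaleR_add_right del: scaleR_scaleR)
           (simp add: e)
      moreover have "(exp (\<kappa> - ln \<rho>))\<^sup>2 = (exp \<kappa>)\<^sup>2 / (\<tau>\<^sup>2 * Vres z)"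
        using \<rho> by (simp add: exp_diff power_divide)
      ultimately show ?thesis unfolding G_def H_def c_def stein_loss_def by simp
    qed
    have "(\<integral>\<^sup>+\<kappa>. indicator {- (K + L)..K + L} \<kappa> * (\<integral>\<^sup>+v. indicator (cball 0 ?A') v * G \<kappa> v \<tau> z \<partial>lborel) \<partial>lborel)
      = (\<integral>\<^sup>+\<kappa>. indicator {- (K + L)..K + L} (- ln \<rho> + \<kappa>) * (\<integral>\<^sup>+v. indicator (cball 0 ?A') v * G (- ln \<rho> + \<kappa>) v \<tau> z \<partial>lborel) \<partial>lborel)"
      by (rule nn_integral_translate[symmetric]) (intro borel_measurable_times_ennreal borel_measurable_indicator Gi, auto)
    also have "\<dots> = (\<integral>\<^sup>+\<kappa>. indicator {- (K + L)..K + L} (\<kappa> - ln \<rho>) * (\<integral>\<^sup>+v. indicator (cball 0 ?A') (v - exp (\<kappa> - ln \<rho>) *\<^sub>R a) * H \<kappa> v \<tau> z \<partial>lborel) \<partial>lborel)"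
    proof (rule nn_integral_cong)
      fix \<kappa>
      have "(\<integral>\<^sup>+v. indicator (cball 0 ?A') v * G (- ln \<rho> + \<kappa>) v \<tau> z \<partial>lborel)
        = (\<integral>\<^sup>+v. indicator (cball 0 ?A') (- (exp (\<kappa> - ln \<rho>) *\<^sub>R a) + v) * G (- ln \<rho> + \<kappa>) (- (exp (\<kappa> - ln \<rho>) *\<^sub>R a) + v) \<tau> z \<partial>lborel)"
        by (rule nn_integral_translate[symmetric]) (intro borel_measurable_times_ennreal borel_measurable_indicator Gv, auto)
      then show "indicator {- (K + L)..K + L} (- ln \<rho> + \<kappa>) * (\<integral>\<^sup>+v. indicator (cball 0 ?A') v * G (- ln \<rho> + \<kappa>) v \<tau> z \<partial>lborel)
        = indicator {- (K + L)..K + L} (\<kappa> - ln \<rho>) * (\<integral>\<^sup>+v. indicator (cball 0 ?A') (v - exp (\<kappa> - ln \<rho>) *\<^sub>R a) * H \<kappa> v \<tau> z \<partial>lborel)"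
        by (simp add: GH[symmetric])
    qed
    also have "\<dots> \<ge> (\<integral>\<^sup>+\<kappa>. indicator {- K..K} \<kappa> * (\<integral>\<^sup>+v. indicator (cball 0 A) v * H \<kappa> v \<tau> z \<partial>lborel) \<partial>lborel)"
    proof (rule nn_integral_mono)
      fix \<kappa> :: real
      show "indicator {- K..K} \<kappa> * (\<integral>\<^sup>+v. indicator (cball 0 A) v * H \<kappa> v \<tau> z \<partial>lborel)
        \<le> indicator {- (K + L)..K + L} (\<kappa> - ln \<rho>) * (\<integral>\<^sup>+v. indicator (cball 0 ?A') (v - exp (\<kappa> - ln \<rho>) *\<^sub>R a) * H \<kappa> v \<tau> z \<partial>lborel)"
      proof (cases "\<kappa> \<in> {- K..K}")
        case True
        then have k: "\<kappa> - ln \<rho> \<in> {- (K + L)..K + L}" using ln\<rho> by auto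
        have "indicator (cball 0 A) v \<le> (indicator (cball 0 ?A') (v - exp (\<kappa> - ln \<rho>) *\<^sub>R a) :: ennreal)" for v
        proof (cases "norm v \<le> A")
          case True
          have "norm (v - exp (\<kappa> - ln \<rho>) *\<^sub>R a) \<le> norm v + exp (\<kappa> - ln \<rho>) * norm a"
            using norm_triangle_ineq4[of v "exp (\<kappa> - ln \<rho>) *\<^sub>R a"] by simp
          also have "\<dots> \<le> A + exp (K + L) * (C * L)"
            using True k na C(2) L by (intro add_mono mult_mono) auto
          finally show ?thesis by (simp add: indicator_def)
        qed (simp add: indicator_def)
        then show ?thesis using True k by (simp add: nn_integral_mono mult_right_mono)
      qed simp
    qed
    finally show ?thesis .
  qed
  have swap: "(\<integral>\<^sup>+\<kappa>. indicator I \<kappa> * (\<integral>\<^sup>+v. indicator S v * (\<integral>\<^sup>+x. f x * g \<kappa> v (fst x) (snd x) \<partial>(T \<Otimes>\<^sub>M ?N)) \<partial>lborel) \<partial>lborel)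
    = (\<integral>\<^sup>+x. f x * (\<integral>\<^sup>+\<kappa>. indicator I \<kappa> * (\<integral>\<^sup>+v. indicator S v * g \<kappa> v (fst x) (snd x) \<partial>lborel) \<partial>lborel) \<partial>(T \<Otimes>\<^sub>M ?N))"
    if [measurable]: "I \<in> sets borel" "S \<in> sets borel" "f \<in> borel_measurable (borel \<Otimes>\<^sub>M borel)"
      "(\<lambda>(\<kappa>, v, \<tau>, z). g \<kappa> v \<tau> z) \<in> borel_measurable (borel \<Otimes>\<^sub>M borel \<Otimes>\<^sub>M borel \<Otimes>\<^sub>M borel)"
    for I :: "real set" and S :: "(real \<times> (real^'p)) set" and f :: "real \<times> (real^'n) \<Rightarrow> ennreal" and g
  proof -
    have gm: "(\<lambda>y. g (k y) (v y) (t y) (z y)) \<in> borel_measurable M"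
      if "k \<in> borel_measurable M" "v \<in> borel_measurable M" "t \<in> borel_measurable M" "z \<in> borel_measurable M"
      for k v t z and M :: "'x measure"
    proof -
      have "(\<lambda>y. (k y, v y, t y, z y)) \<in> M \<rightarrow>\<^sub>M borel \<Otimes>\<^sub>M borel \<Otimes>\<^sub>M borel \<Otimes>\<^sub>M borel"
        using that by (intro measurable_Pair)
      from measurable_compose[OF this \<open>(\<lambda>(\<kappa>, v, \<tau>, z). g \<kappa> v \<tau> z) \<in> _\<close>] show ?thesis by simp
    qed
    have [measurable]:
      "\<And>\<kappa>. (\<lambda>y. g \<kappa> (snd y) (fst (fst y)) (snd (fst y))) \<in> borel_measurable ((borel \<Otimes>\<^sub>M borel) \<Otimes>\<^sub>M borel)"
      "(\<lambda>y. g (snd (fst y)) (snd y) (fst (fst (fst y))) (snd (fst (fst y)))) \<in> borel_measurable (((borel \<Otimes>\<^sub>M borel) \<Otimes>\<^sub>M borel) \<Otimes>\<^sub>M borel)"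
      "\<And>\<kappa> v. (\<lambda>x. g \<kappa> v (fst x) (snd x)) \<in> borel_measurable (borel \<Otimes>\<^sub>M borel)"
      "\<And>\<kappa> \<tau> z. (\<lambda>v. g \<kappa> v \<tau> z) \<in> borel_measurable borel"
      "\<And>\<tau> z. (\<lambda>y. g (fst y) (snd y) \<tau> z) \<in> borel_measurable (borel \<Otimes>\<^sub>M borel)"
      by (rule gm; measurable)+
    have "(\<integral>\<^sup>+\<kappa>. indicator I \<kappa> * (\<integral>\<^sup>+v. indicator S v * (\<integral>\<^sup>+x. f x * g \<kappa> v (fst x) (snd x) \<partial>(T \<Otimes>\<^sub>M ?N)) \<partial>lborel) \<partial>lborel)
      = (\<integral>\<^sup>+\<kappa>. indicator I \<kappa> * (\<integral>\<^sup>+v. (\<integral>\<^sup>+x. indicator S v * (f x * g \<kappa> v (fst x) (snd x)) \<partial>(T \<Otimes>\<^sub>M ?N)) \<partial>lborel) \<partial>lborel)"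
      by (simp add: nn_integral_cmult)
    also have "\<dots> = (\<integral>\<^sup>+\<kappa>. indicator I \<kappa> * (\<integral>\<^sup>+x. (\<integral>\<^sup>+v. indicator S v * (f x * g \<kappa> v (fst x) (snd x)) \<partial>lborel) \<partial>(T \<Otimes>\<^sub>M ?N)) \<partial>lborel)"
      by (subst TNV.Fubini') (simp_all add: case_prod_beta')
    also have "\<dots> = (\<integral>\<^sup>+\<kappa>. (\<integral>\<^sup>+x. indicator I \<kappa> * (\<integral>\<^sup>+v. indicator S v * (f x * g \<kappa> v (fst x) (snd x)) \<partial>lborel) \<partial>(T \<Otimes>\<^sub>M ?N)) \<partial>lborel)"
      by (simp add: nn_integral_cmult)
    also have "\<dots> = (\<integral>\<^sup>+x. (\<integral>\<^sup>+\<kappa>. indicator I \<kappa> * (\<integral>\<^sup>+v. indicator S v * (f x * g \<kappa> v (fst x) (snd x)) \<partial>lborel) \<partial>lborel) \<partial>(T \<Otimes>\<^sub>M ?N))"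
      by (subst TNL.Fubini') (simp_all add: case_prod_beta')
    also have "\<dots> = (\<integral>\<^sup>+x. f x * (\<integral>\<^sup>+\<kappa>. indicator I \<kappa> * (\<integral>\<^sup>+v. indicator S v * g \<kappa> v (fst x) (snd x) \<partial>lborel) \<partial>lborel) \<partial>(T \<Otimes>\<^sub>M ?N))"
      by (simp add: nn_integral_cmult[symmetric] mult.left_commute)
    finally show ?thesis .
  qed
  have wm: "(\<lambda>x. indicator {z. window L (fst x) z} (snd x) :: ennreal) \<in> borel_measurable (borel \<Otimes>\<^sub>M borel)"
    using window_measurable[of L] by (simp add: case_prod_beta')
  have cb: "(\<integral>\<^sup>+v. indicator (cball (0 :: real \<times> (real^'p)) r) v * e \<partial>lborel) = emeasure lborel (cball (0 :: real \<times> (real^'p)) r) * e" for r e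
    by (subst nn_integral_multc, intro borel_measurable_indicator, auto)
  have "ennreal (2 * K) * emeasure lborel (cball (0 :: real \<times> (real^'p)) A) * J
    = (\<integral>\<^sup>+\<kappa>. indicator {- K..K} \<kappa> * (\<integral>\<^sup>+v. indicator (cball (0 :: real \<times> (real^'p)) A) v * J \<partial>lborel) \<partial>lborel)"
    using K unfolding cb by (subst nn_integral_multc) (simp_all add: mult.assoc)
  also have "\<dots> \<le> (\<integral>\<^sup>+\<kappa>. indicator {- K..K} \<kappa> * (\<integral>\<^sup>+v. indicator (cball 0 A) v *
      (\<integral>\<^sup>+x. indicator {z. window L (fst x) z} (snd x) * H \<kappa> v (fst x) (snd x) \<partial>(T \<Otimes>\<^sub>M ?N)) \<partial>lborel) \<partial>lborel)"
    by (intro nn_integral_mono mult_left_mono bracket) auto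
  also have "\<dots> = (\<integral>\<^sup>+x. indicator {z. window L (fst x) z} (snd x) *
     (\<integral>\<^sup>+\<kappa>. indicator {- K..K} \<kappa> * (\<integral>\<^sup>+v. indicator (cball 0 A) v * H \<kappa> v (fst x) (snd x) \<partial>lborel) \<partial>lborel) \<partial>(T \<Otimes>\<^sub>M ?N))"
    by (rule swap[OF _ _ wm Hm]) auto
  also have "\<dots> \<le> (\<integral>\<^sup>+x. 1 *
     (\<integral>\<^sup>+\<kappa>. indicator {- (K + L)..K + L} \<kappa> * (\<integral>\<^sup>+v. indicator (cball 0 ?A') v * G \<kappa> v (fst x) (snd x) \<partial>lborel) \<partial>lborel) \<partial>(T \<Otimes>\<^sub>M ?N))"
  proof (rule nn_integral_mono)
    fix x
    show "indicator {z. window L (fst x) z} (snd x) *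
     (\<integral>\<^sup>+\<kappa>. indicator {- K..K} \<kappa> * (\<integral>\<^sup>+v. indicator (cball 0 A) v * H \<kappa> v (fst x) (snd x) \<partial>lborel) \<partial>lborel)
     \<le> 1 * (\<integral>\<^sup>+\<kappa>. indicator {- (K + L)..K + L} \<kappa> * (\<integral>\<^sup>+v. indicator (cball 0 ?A') v * G \<kappa> v (fst x) (snd x) \<partial>lborel) \<partial>lborel)"
      using transl[of "fst x" "snd x"] by (cases "window L (fst x) (snd x)") simp_all
  qed
  also have "\<dots> = (\<integral>\<^sup>+\<kappa>. indicator {- (K + L)..K + L} \<kappa> * (\<integral>\<^sup>+v. indicator (cball 0 ?A') v *
      (\<integral>\<^sup>+x. 1 * G \<kappa> v (fst x) (snd x) \<partial>(T \<Otimes>\<^sub>M ?N)) \<partial>lborel) \<partial>lborel)"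
    by (rule swap[symmetric, OF _ _ _ Gm]) auto
  also have "\<dots> \<le> (\<integral>\<^sup>+\<kappa>. indicator {- (K + L)..K + L} \<kappa> * (\<integral>\<^sup>+v. indicator (cball (0 :: real \<times> (real^'p)) ?A') v * max_risk T X d \<partial>lborel) \<partial>lborel)"
    using risk by (intro nn_integral_mono mult_left_mono) auto
  also have "\<dots> = ennreal (2 * (K + L)) * emeasure lborel (cball (0 :: real \<times> (real^'p)) ?A') * max_risk T X d"
    using K L unfolding cb by (subst nn_integral_multc) (simp_all add: mult.assoc)
  finally show ?thesis .
qed

text \<open>The two boxes have volume ratio (1 + L / K) (1 + D K / A)^N, with D K growing
  exponentially in K. It tends to 1 if A goes to infinity for fixed K and K goes to infinity
  afterwards.\<close>

lemma le_max_risk: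
  assumes T: "scale_mixture T" and d: "d \<in> estimators"
    and J: "\<And>c. c > 0 \<Longrightarrow> J \<le> windowed_risk T L c" and L: "L \<ge> 0"
  shows "J \<le> max_risk T X d"
proof (cases "max_risk T X d")
  case (real \<mu>)
  obtain C where C: "C > 0" "\<And>v. norm v \<le> C * norm (fit v)" using fit_bounded_below by blast
  define N where "N = DIM(real \<times> (real^'p))"
  define u where "u = unit_ball_vol (real N)"
  have u: "u > 0" by (simp add: u_def)
  define D where "D = (\<lambda>K. exp (K + L) * (C * L))"
  have D: "D K \<ge> 0" for K using C L by (simp add: D_def)
  have ball: "emeasure lborel (cball (0 :: real \<times> (real^'p)) r) = ennreal (u * r ^ N)" if "r \<ge> 0" for r
    using that by (simp add: emeasure_cball u_def N_def)
  have ineq: "ennreal (2 * K * (u * A ^ N)) * J \<le> ennreal (2 * (K + L) * (u * (A + D K) ^ N) * \<mu>)"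
    if "A > 0" "K > 0" for A K
  proof -
    have AD: "0 \<le> A + D K" using that D[of K] by simp
    have "ennreal (2 * K) * emeasure lborel (cball (0 :: real \<times> (real^'p)) A) * J
      \<le> ennreal (2 * (K + L)) * emeasure lborel (cball (0 :: real \<times> (real^'p)) (A + D K)) * max_risk T X d"
      unfolding D_def by (rule box_average_le_max_risk[OF T d C(2,1) J]) (use that L in auto)
    then show ?thesis using that u L real AD
      by (simp add: ball ennreal_mult mult.assoc)
  qed
  have "J \<noteq> top"
  proof
    assume "J = top"
    then have "ennreal (2 * 1 * (u * 1 ^ N)) * J = top" using u by (simp add: ennreal_mult_top)
    then show False using ineq[of 1 1] by (simp add: top_unique)
  qed
  then obtain j where j: "J = ennreal j" "j \<ge> 0" by (cases J) auto
  have step: "j \<le> (1 + L / K) * (1 + D K / A) ^ N * \<mu>" if A: "A > 0" and K: "K > 0" for A K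
  proof -
    have "ennreal (2 * K * (u * A ^ N) * j) \<le> ennreal (2 * (K + L) * (u * (A + D K) ^ N) * \<mu>)"
      using ineq[OF A K] A K u j by (simp add: ennreal_mult)
    then have "2 * K * (u * A ^ N) * j \<le> 2 * (K + L) * (u * (A + D K) ^ N) * \<mu>"
      using A K u L D[of K] real by (subst (asm) ennreal_le_iff) auto
    then have "(2 * u * K * A ^ N) * j \<le> (2 * u * K * A ^ N) * ((1 + L / K) * (1 + D K / A) ^ N * \<mu>)"
    proof -
      have e1: "K + L = K * (1 + L / K)" using K by (simp add: field_simps)
      have e2: "A + D K = A * (1 + D K / A)" using A by (simp add: field_simps)
      assume "2 * K * (u * A ^ N) * j \<le> 2 * (K + L) * (u * (A + D K) ^ N) * \<mu>"
      then show ?thesis unfolding e1 e2 power_mult_distrib by (simp only: mult_ac)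
    qed
    then show ?thesis using u A K by (subst (asm) mult_le_cancel_left_pos) auto
  qed
  have inv: "(\<lambda>k. x / (real k + 1)) \<longlonglongrightarrow> 0" for x
    using tendsto_mult[OF tendsto_const[of x] LIMSEQ_inverse_real_of_nat]
    by (simp add: divide_inverse add.commute)
  have step2: "j \<le> (1 + L / K) * \<mu>" if K: "K > 0" for K
  proof (rule LIMSEQ_le_const)
    have "(\<lambda>k. (1 + L / K) * (1 + D K / (real k + 1)) ^ N * \<mu>) \<longlonglongrightarrow> (1 + L / K) * (1 + 0) ^ N * \<mu>"
      by (intro tendsto_intros inv)
    then show "(\<lambda>k. (1 + L / K) * (1 + D K / (real k + 1)) ^ N * \<mu>) \<longlonglongrightarrow> (1 + L / K) * \<mu>" by simp
    show "\<exists>N0. \<forall>k\<ge>N0. j \<le> (1 + L / K) * (1 + D K / (real k + 1)) ^ N * \<mu>"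
      using step[OF _ K] by (intro exI allI impI) auto
  qed
  have "j \<le> \<mu>"
  proof (rule LIMSEQ_le_const)
    have "(\<lambda>k. (1 + L / (real k + 1)) * \<mu>) \<longlonglongrightarrow> (1 + 0) * \<mu>"
      by (intro tendsto_intros inv)
    then show "(\<lambda>k. (1 + L / (real k + 1)) * \<mu>) \<longlonglongrightarrow> \<mu>" by simp
    show "\<exists>N0. \<forall>k\<ge>N0. j \<le> (1 + L / (real k + 1)) * \<mu>"
      using step2 by (intro exI allI impI) auto
  qed
  then show ?thesis using j real by (simp add: ennreal_leI)
qed simp

section \<open>Removing the truncation of the noise\<close>

definition window_int :: "real measure \<Rightarrow> real \<Rightarrow> (real \<Rightarrow> real^'n \<Rightarrow> ennreal) \<Rightarrow> ennreal" where
  "window_int T L f = (\<integral>\<^sup>+x. indicator {z. window L (fst x) z} (snd x) * f (fst x) (snd x) \<partial>(T \<Otimes>\<^sub>M std_normal_vec))"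

lemma window_measurable' [measurable]:
  "(\<lambda>x. indicator {z. window L (fst x) z} (snd x) :: ennreal) \<in> borel_measurable (borel \<Otimes>\<^sub>M borel)"
  using window_measurable[of L] by (simp add: case_prod_beta')

lemma windowed_risk_eq:
  assumes T: "scale_mixture T"
  shows "windowed_risk T L c = window_int T L (\<lambda>\<tau> z. ennreal (stein_loss (c * (\<tau>\<^sup>2 * Vres z)) 1))"
proof -
  have sT [measurable_cong]: "sets T = sets borel" using T by (simp add: scale_mixture_def)
  show ?thesis
    unfolding windowed_risk_def window_int_def stein_loss_def
    by (subst std_normal.nn_integral_fst[symmetric]) simp_all
qed

text \<open>Monotone convergence: the windows increase to the set where \<tau> and the residual norm
  are positive, which has full measure.\<close>

lemma window_int_tendsto:
  assumes T: "scale_mixture T" and f [measurable]: "(\<lambda>x. f (fst x) (snd x)) \<in> borel_measurable (borel \<Otimes>\<^sub>M borel)"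
  shows "(\<lambda>k. window_int T (real k) f) \<longlonglongrightarrow> (\<integral>\<^sup>+\<tau>. (\<integral>\<^sup>+z. f \<tau> z \<partial>std_normal_vec) \<partial>T)"
proof -
  let ?P = "T \<Otimes>\<^sub>M (std_normal_vec :: (real^'n) measure)"
  have sT [measurable_cong]: "sets T = sets borel" and posT: "AE \<tau> in T. 0 < \<tau>"
    using T by (auto simp: scale_mixture_def)
  define G where "G = {x :: real \<times> (real^'n). 0 < fst x \<and> 0 < Vres (snd x)}"
  have "Measurable.pred (borel \<Otimes>\<^sub>M borel) (\<lambda>x :: real \<times> (real^'n). 0 < fst x \<and> 0 < Vres (snd x))" by measurable
  then have G [measurable]: "G \<in> sets (borel \<Otimes>\<^sub>M borel)" by (simp add: G_def pred_def space_pair_measure)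
  have "(\<lambda>k. window_int T (real k) f) \<longlonglongrightarrow> (\<integral>\<^sup>+x. indicator G x * f (fst x) (snd x) \<partial>?P)"
    unfolding window_int_def
  proof (rule nn_integral_LIMSEQ)
    show "incseq (\<lambda>k x. indicator {z. window (real k) (fst x) z} (snd x) * f (fst x) (snd x))"
    proof (intro incseq_SucI le_funI mult_right_mono)
      fix k and x :: "real \<times> (real^'n)"
      have "window (real k) (fst x) (snd x) \<Longrightarrow> window (real (Suc k)) (fst x) (snd x)"
      proof -
        assume w: "window (real k) (fst x) (snd x)"
        have "(real k)\<^sup>2 \<le> (real (Suc k))\<^sup>2" by (intro power_mono) auto
        moreover have "exp (- 2 * real (Suc k)) \<le> exp (- 2 * real k)" "exp (2 * real k) \<le> exp (2 * real (Suc k))" by auto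
        ultimately show ?thesis using w unfolding window_def by linarith
      qed
      then show "indicator {z. window (real k) (fst x) z} (snd x) \<le> (indicator {z. window (real (Suc k)) (fst x) z} (snd x) :: ennreal)"
        by (auto simp: indicator_def)
    qed simp
    show "(\<lambda>x. indicator {z. window (real k) (fst x) z} (snd x) * f (fst x) (snd x)) \<in> borel_measurable ?P" for k
      by measurable
    show "(\<lambda>k. indicator {z. window (real k) (fst x) z} (snd x) * f (fst x) (snd x)) \<longlonglongrightarrow> indicator G x * f (fst x) (snd x)" for x
    proof (cases "x \<in> G")
      case True
      define q where "q = (fst x)\<^sup>2 * Vres (snd x)"
      have q: "q > 0" "fst x > 0" using True by (auto simp: G_def q_def)
      define B where "B = max ((fst x)\<^sup>2 * Vloc (snd x)) (max \<bar>ln q\<bar> 1)"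
      obtain N where N: "B \<le> real N" using real_arch_simple by blast
      have "\<forall>\<^sub>F k in sequentially. indicator {z. window (real k) (fst x) z} (snd x) * f (fst x) (snd x) = indicator G x * f (fst x) (snd x)"
        using eventually_ge_at_top[of N]
      proof eventually_elim
        case (elim k)
        then have k: "B \<le> real k" using N by (simp add: le_trans)
        have "(fst x)\<^sup>2 * Vloc (snd x) \<le> real k" "1 \<le> real k" "\<bar>ln q\<bar> \<le> real k" using k by (auto simp: B_def)
        \<comment> \<open>The window bounds the squared location by the square of k, hence the 1
          inside the maximum defining B.\<close>
        then have "real k \<le> (real k)\<^sup>2" by (simp add: power2_eq_square)
        then have "(fst x)\<^sup>2 * Vloc (snd x) \<le> (real k)\<^sup>2" using \<open>(fst x)\<^sup>2 * Vloc (snd x) \<le> real k\<close> by linarith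
        moreover have "exp (- 2 * real k) \<le> q" "q \<le> exp (2 * real k)"
          using \<open>\<bar>ln q\<bar> \<le> real k\<close> by (subst exp_ln[OF q(1), symmetric], simp)+
        ultimately have "window (real k) (fst x) (snd x)"
          using q(2) unfolding window_def q_def by blast
        then show ?case using True by simp
      qed
      then show ?thesis by (rule tendsto_eventually)
    next
      case False
      have "\<not> window (real k) (fst x) (snd x)" for k
      proof
        assume w: "window (real k) (fst x) (snd x)"
        then have "0 < (fst x)\<^sup>2 * Vres (snd x)" using less_le_trans[OF exp_gt_zero] by (auto simp: window_def)
        then show False using w False by (auto simp: G_def window_def zero_less_mult_iff)
      qed
      then show ?thesis using False by simp
    qed
  qed
  also have "(\<integral>\<^sup>+x. indicator G x * f (fst x) (snd x) \<partial>?P) = (\<integral>\<^sup>+\<tau>. (\<integral>\<^sup>+z. indicator G (\<tau>, z) * f \<tau> z \<partial>std_normal_vec) \<partial>T)"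
    by (subst std_normal.nn_integral_fst[symmetric]) simp_all
  also have "\<dots> = (\<integral>\<^sup>+\<tau>. (\<integral>\<^sup>+z. f \<tau> z \<partial>std_normal_vec) \<partial>T)"
  proof (rule nn_integral_cong_AE, use posT in eventually_elim)
    fix \<tau> :: real assume "0 < \<tau>"
    then show "(\<integral>\<^sup>+z. indicator G (\<tau>, z) * f \<tau> z \<partial>std_normal_vec) = (\<integral>\<^sup>+z. f \<tau> z \<partial>std_normal_vec)"
      using AE_std_normal_vec[OF AE_Vres] by (intro nn_integral_cong_AE) (auto elim!: eventually_mono simp: G_def)
  qed
  finally show ?thesis .
qed

lemma window_int_add:
  assumes T: "scale_mixture T" and [measurable]: "(\<lambda>x. f (fst x) (snd x)) \<in> borel_measurable (borel \<Otimes>\<^sub>M borel)"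
    "(\<lambda>x. g (fst x) (snd x)) \<in> borel_measurable (borel \<Otimes>\<^sub>M borel)"
  shows "window_int T L (\<lambda>\<tau> z. f \<tau> z + g \<tau> z) = window_int T L f + window_int T L g"
proof -
  have sT [measurable_cong]: "sets T = sets borel" using T by (simp add: scale_mixture_def)
  show ?thesis unfolding window_int_def by (simp add: distrib_left nn_integral_add)
qed

lemma window_int_cmult:
  assumes T: "scale_mixture T" and [measurable]: "(\<lambda>x. f (fst x) (snd x)) \<in> borel_measurable (borel \<Otimes>\<^sub>M borel)"
  shows "window_int T L (\<lambda>\<tau> z. c * f \<tau> z) = c * window_int T L f"
proof -
  have sT [measurable_cong]: "sets T = sets borel" using T by (simp add: scale_mixture_def)
  show ?thesis unfolding window_int_def by (simp add: mult.left_commute nn_integral_cmult)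
qed

lemma window_int_cong:
  assumes "\<And>\<tau> z. window L \<tau> z \<Longrightarrow> f \<tau> z = g \<tau> z"
  shows "window_int T L f = window_int T L g"
  unfolding window_int_def by (rule nn_integral_cong) (use assms in \<open>auto simp: indicator_def\<close>)

lemma expectation_scaled_Vres:
  assumes T: "scale_mixture T"
  shows "(\<integral>\<^sup>+\<tau>. (\<integral>\<^sup>+z. ennreal (\<tau>\<^sup>2 * Vres z / dof) \<partial>std_normal_vec) \<partial>T) = 1"
proof -
  have T2: "(\<integral>\<^sup>+\<tau>. ennreal (\<tau>\<^sup>2) \<partial>T) = 1" using T by (auto simp: scale_mixture_def)
  have "(\<integral>\<^sup>+z. ennreal (\<tau>\<^sup>2 * Vres z / dof) \<partial>std_normal_vec) = ennreal (\<tau>\<^sup>2)" for \<tau>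
  proof -
    have "(\<integral>\<^sup>+z. ennreal (\<tau>\<^sup>2 * Vres z / dof) \<partial>std_normal_vec) = (\<integral>\<^sup>+z. ennreal (\<tau>\<^sup>2 / dof) * ennreal (Vres z) \<partial>std_normal_vec)"
      using dof_eq V_nonneg by (intro nn_integral_cong) (simp add: ennreal_mult[symmetric])
    also have "\<dots> = ennreal (\<tau>\<^sup>2 / dof) * ennreal dof" by (simp add: nn_integral_cmult expectation_Vres)
    also have "\<dots> = ennreal (\<tau>\<^sup>2)" using dof_eq by (simp add: ennreal_mult[symmetric])
    finally show ?thesis .
  qed
  then show ?thesis using T2 by simp
qed

text \<open>Minimising \<open>E[1\<^sub>H (c Q - ln (c Q) - 1)]\<close> over \<open>c\<close> gives \<open>c = b / E[1\<^sub>H Q]\<close> with \<open>b = P(H)\<close>; the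
  loss of using \<open>c = 1 / E[Q]\<close> instead is at most \<open>(b - a)\<^sup>2 / a\<close>, where \<open>a = E[1\<^sub>H Q] / E[Q]\<close>.\<close>

lemma windowed_risk_near_min:
  assumes T: "scale_mixture T" and c: "c > 0"
    and a: "window_int T L (\<lambda>\<tau> z. ennreal (\<tau>\<^sup>2 * Vres z / dof)) = ennreal a" "a > 0"
    and b: "window_int T L (\<lambda>\<tau> z. 1) = ennreal b" "b > 0"
  shows "windowed_risk T L (1 / dof) \<le> windowed_risk T L c + ennreal ((b - a)\<^sup>2 / a)"
proof -
  define x where "x = c * dof"
  have x: "x > 0" using c dof_eq by (simp add: x_def)
  define q where "q = (\<lambda>\<tau> z. \<tau>\<^sup>2 * Vres z / dof)"
  have qm [measurable]: "(\<lambda>y. q (fst y) (snd y)) \<in> borel_measurable (borel \<Otimes>\<^sub>M borel)" unfolding q_def by measurable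
  have q: "q \<tau> z > 0" if "window L \<tau> z" for \<tau> z
  proof -
    have "0 < \<tau>\<^sup>2 * Vres z" using that less_le_trans[OF exp_gt_zero] by (auto simp: window_def)
    then show ?thesis using dof_eq by (simp add: q_def)
  qed
  define l where "l = (\<lambda>s \<tau> z. ennreal (s * q \<tau> z - ln (s * q \<tau> z) - 1))"
  have [measurable]: "(\<lambda>y. l s (fst y) (snd y)) \<in> borel_measurable (borel \<Otimes>\<^sub>M borel)" for s unfolding l_def by measurable
  have W: "windowed_risk T L c = window_int T L (l x)" "windowed_risk T L (1 / dof) = window_int T L (l 1)"
    unfolding windowed_risk_eq[OF T] l_def q_def x_def stein_loss_def using dof_eq by (simp_all add: mult.assoc)
  have nn: "s * q \<tau> z - ln (s * q \<tau> z) - 1 \<ge> 0" if "s > 0" "window L \<tau> z" for s \<tau> z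
    using ln_le_minus_one[of "s * q \<tau> z"] q[OF that(2)] that by simp
  have a': "window_int T L (\<lambda>\<tau> z. ennreal (q \<tau> z)) = ennreal a" using a by (simp add: q_def)
  have c1: "window_int T L (\<lambda>\<tau> z. ennreal s) = ennreal s * ennreal b" for s
    using window_int_cmult[OF T, of "\<lambda>_ _. 1" L "ennreal s"] b by simp
  have cq: "window_int T L (\<lambda>\<tau> z. ennreal s * ennreal (q \<tau> z)) = ennreal s * ennreal a" for s
    using window_int_cmult[OF T, of "\<lambda>\<tau> z. ennreal (q \<tau> z)" L "ennreal s"] a' by simp
  show ?thesis
  proof (cases "window_int T L (l x)")
    case top
    then show ?thesis by (simp add: W)
  next
    case (real j)
    \<comment> \<open>ln x is split at the minimiser b / a, and ln u \<le> u - 1 is applied to both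
      factors.\<close>
    have "b * ln x - x * a + a \<le> (b - a)\<^sup>2 / a"
    proof -
      have "ln x = ln (x * a / b) + ln (b / a)" using x a b by (simp add: ln_mult ln_div)
      also have "\<dots> \<le> (x * a / b - 1) + (b / a - 1)"
        using x a b by (intro add_mono ln_le_minus_one) auto
      finally have "b * ln x \<le> b * ((x * a / b - 1) + (b / a - 1))" using b by (intro mult_left_mono) auto
      also have "\<dots> = x * a + b\<^sup>2 / a - 2 * b" using b by (simp add: algebra_simps power2_eq_square)
      finally have "b * ln x - x * a + a \<le> b\<^sup>2 / a - 2 * b + a" by simp
      also have "\<dots> = (b - a)\<^sup>2 / a" using a by (simp add: power2_eq_square field_simps)
      finally show ?thesis .
    qed
    moreover have "window_int T L (l 1) \<le> ennreal (j + b * ln x - x * a + a)"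
    \<comment> \<open>The sign of ln x decides on which side of the identity between l x and l 1 it
      can stand as a nonnegative term.\<close>
    proof (cases "x \<ge> 1")
      case True
      have "window_int T L (\<lambda>\<tau> z. l x \<tau> z + (ennreal (q \<tau> z) + ennreal (ln x))) = window_int T L (\<lambda>\<tau> z. l 1 \<tau> z + ennreal x * ennreal (q \<tau> z))"
      proof (rule window_int_cong)
        fix \<tau> z assume w: "window L \<tau> z"
        show "l x \<tau> z + (ennreal (q \<tau> z) + ennreal (ln x)) = l 1 \<tau> z + ennreal x * ennreal (q \<tau> z)"
          unfolding l_def using nn[OF x w] nn[OF zero_less_one w] q[OF w] x True
          by (simp add: ennreal_plus[symmetric] ennreal_mult[symmetric] del: ennreal_plus) (simp add: ln_mult)
      qed
      then have "ennreal j + (ennreal a + ennreal (ln x) * ennreal b) = window_int T L (l 1) + ennreal x * ennreal a"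
        by (simp add: window_int_add[OF T] c1 cq a' real)
      moreover then obtain i where i: "window_int T L (l 1) = ennreal i" "i \<ge> 0"
        by (cases "window_int T L (l 1)") (auto simp: ennreal_plus[symmetric] ennreal_mult_eq_top_iff simp del: ennreal_plus)
      ultimately have "ennreal (j + (a + ln x * b)) = ennreal (i + x * a)"
        using a b x True real by (simp add: ennreal_mult)
      then have "j + (a + ln x * b) = i + x * a" using a b x True real i by (subst (asm) ennreal_inj) auto
      then show ?thesis using i by (simp add: ennreal_leI mult.commute)
    next
      case False
      have "window_int T L (\<lambda>\<tau> z. l x \<tau> z + ennreal (q \<tau> z)) = window_int T L (\<lambda>\<tau> z. l 1 \<tau> z + (ennreal x * ennreal (q \<tau> z) + ennreal (- ln x)))"
      proof (rule window_int_cong)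
        fix \<tau> z assume w: "window L \<tau> z"
        have ln0: "- ln x \<ge> 0" using False x by simp
        moreover have "0 \<le> x * q \<tau> z" using x q[OF w] by simp
        ultimately have "0 \<le> x * q \<tau> z - ln x" by simp
        with ln0 show "l x \<tau> z + ennreal (q \<tau> z) = l 1 \<tau> z + (ennreal x * ennreal (q \<tau> z) + ennreal (- ln x))"
          unfolding l_def using nn[OF x w] nn[OF zero_less_one w] q[OF w] x
          by (simp add: ennreal_plus[symmetric] ennreal_mult[symmetric] del: ennreal_plus) (simp add: ln_mult)
      qed
      then have "ennreal j + ennreal a = window_int T L (l 1) + (ennreal x * ennreal a + ennreal (- ln x) * ennreal b)"
        by (simp add: window_int_add[OF T] c1 cq a' real)
      moreover then obtain i where i: "window_int T L (l 1) = ennreal i" "i \<ge> 0"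
        by (cases "window_int T L (l 1)") (auto simp: ennreal_plus[symmetric] simp del: ennreal_plus)
      moreover have ln0: "- ln x \<ge> 0" using False x by simp
      ultimately have "ennreal (j + a) = ennreal (i + (x * a + (- ln x) * b))"
      proof -
        have "ennreal (i + (x * a + m * b)) = ennreal i + (ennreal x * ennreal a + ennreal m * ennreal b)" if "m \<ge> 0" for m
          using a b x i that by (simp add: ennreal_mult)
        from this[OF ln0] show ?thesis
          using \<open>ennreal j + ennreal a = _\<close> \<open>window_int T L (l 1) = ennreal i\<close> a real by (simp only: ennreal_plus less_imp_le)
      qed
      then have "j + a = i + (x * a + (- ln x) * b)"
      proof (subst (asm) ennreal_inj)
        show "0 \<le> j + a" using real a by simp
        show "0 \<le> i + (x * a + (- ln x) * b)"
          by (intro add_nonneg_nonneg mult_nonneg_nonneg ln0) (use i x a b in auto)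
      qed
      then show ?thesis using i by (simp add: ennreal_leI mult.commute)
    qed
    moreover have "j + b * ln x - x * a + a \<le> j + (b - a)\<^sup>2 / a"
      using \<open>b * ln x - x * a + a \<le> _\<close> by linarith
    ultimately have "window_int T L (l 1) \<le> ennreal (j + (b - a)\<^sup>2 / a)"
      by (meson ennreal_leI order_trans)
    then show ?thesis using real a by (simp add: W)
  qed
qed

text \<open>The mass of the window and its share of E[\<tau>^2 S / m] both tend to 1, so on large
  windows S / m is optimal among the multiples of S up to an error that vanishes.
  \<open>le_max_risk\<close> is used with the windowed risk less this error, the difference being
  cut off at 0.\<close>

theorem base_risk_le_max_risk:
  assumes T: "scale_mixture T" and d: "d \<in> estimators"
  shows "base_risk T \<le> max_risk T X d"
proof -
  interpret T: prob_space T using T by (simp add: scale_mixture_def)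
  define a where "a = (\<lambda>k. window_int T (real k) (\<lambda>\<tau> z. ennreal (\<tau>\<^sup>2 * Vres z / dof)))"
  define b where "b = (\<lambda>k. window_int T (real k) (\<lambda>\<tau> z. 1))"
  have a: "a \<longlonglongrightarrow> 1"
    unfolding a_def using window_int_tendsto[OF T, of "\<lambda>\<tau> z. ennreal (\<tau>\<^sup>2 * Vres z / dof)"]
    by (simp add: expectation_scaled_Vres[OF T])
  have b: "b \<longlonglongrightarrow> 1"
    unfolding b_def using window_int_tendsto[OF T, of "\<lambda>\<tau> z. 1"] by (simp add: T.emeasure_space_1)
  define a' where "a' = (\<lambda>k. enn2real (a k))"
  define b' where "b' = (\<lambda>k. enn2real (b k))"
  have a': "a' \<longlonglongrightarrow> 1" unfolding a'_def using tendsto_enn2real[OF a[unfolded ennreal_1[symmetric]]] by simp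
  have b': "b' \<longlonglongrightarrow> 1" unfolding b'_def using tendsto_enn2real[OF b[unfolded ennreal_1[symmetric]]] by simp
  have ev: "\<forall>\<^sub>F k in sequentially. a k = ennreal (a' k) \<and> a' k > 0 \<and> b k = ennreal (b' k) \<and> b' k > 0"
  proof -
    have "\<forall>\<^sub>F k in sequentially. a k < 2" "\<forall>\<^sub>F k in sequentially. b k < 2"
      using order_tendstoD(2)[OF a, of 2] order_tendstoD(2)[OF b, of 2] by auto
    moreover have "\<forall>\<^sub>F k in sequentially. a' k > 0" "\<forall>\<^sub>F k in sequentially. b' k > 0"
      using order_tendstoD(1)[OF a', of 0] order_tendstoD(1)[OF b', of 0] by auto
    ultimately show ?thesis
    proof eventually_elim
      case (elim k)
      then show ?case by (auto simp: a'_def b'_def ennreal_enn2real_if)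
    qed
  qed
  define err where "err = (\<lambda>k. (b' k - a' k)\<^sup>2 / a' k)"
  have "err \<longlonglongrightarrow> (1 - 1)\<^sup>2 / 1" unfolding err_def by (intro tendsto_intros a' b') simp
  then have "(\<lambda>k. max_risk T X d + ennreal (err k)) \<longlonglongrightarrow> max_risk T X d + ennreal 0"
    by (intro tendsto_add tendsto_const tendsto_ennrealI) simp
  moreover have "(\<lambda>k. windowed_risk T (real k) (1 / dof)) \<longlonglongrightarrow> base_risk T"
    unfolding windowed_risk_eq[OF T] base_risk_def
    using window_int_tendsto[OF T, of "\<lambda>\<tau> z. ennreal (stein_loss (1 / dof * (\<tau>\<^sup>2 * Vres z)) 1)"]
    by (simp add: stein_loss_def)
  moreover have "\<forall>\<^sub>F k in sequentially. windowed_risk T (real k) (1 / dof) \<le> max_risk T X d + ennreal (err k)"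
    using ev
  proof eventually_elim
    case (elim k)
    have "windowed_risk T (real k) (1 / dof) - ennreal (err k) \<le> max_risk T X d"
    proof (rule le_max_risk[OF T d])
      fix c :: real assume "c > 0"
      then have "windowed_risk T (real k) (1 / dof) \<le> windowed_risk T (real k) c + ennreal (err k)"
        unfolding err_def using elim by (intro windowed_risk_near_min[OF T]) (auto simp: a_def b_def)
      then show "windowed_risk T (real k) (1 / dof) - ennreal (err k) \<le> windowed_risk T (real k) c"
        by (simp add: ennreal_minus_le_iff add.commute)
    qed simp
    then show ?case by (simp add: ennreal_minus_le_iff add.commute)
  qed
  ultimately have "base_risk T \<le> max_risk T X d + ennreal 0"
    by (intro tendsto_le[OF sequentially_bot]) auto
  then show ?thesis by simp
qed

end

section \<open>The generalized Bayes property\<close>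

lemma nn_integral_affine:
  fixes h :: "'a::euclidean_space \<Rightarrow> ennreal"
  assumes [measurable]: "h \<in> borel_measurable borel" and c: "c \<noteq> 0"
  shows "(\<integral>\<^sup>+x. h x \<partial>lborel) = ennreal (\<bar>c\<bar> ^ DIM('a)) * (\<integral>\<^sup>+x. h (t + c *\<^sub>R x) \<partial>lborel)"
proof -
  have "(\<integral>\<^sup>+x. h x \<partial>lborel) = (\<integral>\<^sup>+x. h x \<partial>density (distr lborel borel (\<lambda>x. t + c *\<^sub>R x)) (\<lambda>_. \<bar>c\<bar> ^ DIM('a)))"
    using lborel_affine[OF c, of t] by simp
  also have "\<dots> = ennreal (\<bar>c\<bar> ^ DIM('a)) * (\<integral>\<^sup>+x. h (t + c *\<^sub>R x) \<partial>lborel)"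
    by (simp add: nn_integral_density nn_integral_cmult nn_integral_distr)
  finally show ?thesis .
qed

text \<open>Inversion carries du / u^2 on the half-line to Lebesgue measure there. It is enough to
  compare masses of the half-lines \<open>{..a}\<close>, where the antiderivative -1 / u gives
  \<open>max a 0\<close>.\<close>

lemma nn_integral_inverse:
  fixes f :: "real \<Rightarrow> ennreal"
  assumes [measurable]: "f \<in> borel_measurable borel"
  shows "(\<integral>\<^sup>+u. f (1 / u) * (ennreal (1 / u\<^sup>2) * indicator {0<..} u) \<partial>lborel) = (\<integral>\<^sup>+x. f x * indicator {0<..} x \<partial>lborel)"
proof -
  define q :: "real \<Rightarrow> ennreal" where "q = (\<lambda>u. ennreal (1 / u\<^sup>2) * indicator {0<..} u)"
  have [measurable]: "q \<in> borel_measurable borel" unfolding q_def by measurable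
  define M where "M = distr (density lborel q) borel (\<lambda>u. 1 / u)"
  define N :: "real measure" where "N = density lborel (indicator {0<..})"
  have Mat: "emeasure M {..a} = ennreal (max a 0)" for a
  proof -
    have "emeasure M {..a} = (\<integral>\<^sup>+x. indicator {..a} x \<partial>M)" by (simp add: M_def)
    also have "\<dots> = (\<integral>\<^sup>+u. q u * indicator {..a} (1 / u) \<partial>lborel)"
      unfolding M_def by (subst nn_integral_distr) (simp_all add: nn_integral_density)
    also have "\<dots> = ennreal (max a 0)"
    proof (cases "a > 0")
      case True
      have "(\<integral>\<^sup>+u. q u * indicator {..a} (1 / u) \<partial>lborel) = (\<integral>\<^sup>+u. ennreal (1 / u\<^sup>2) * indicator {1 / a..} u \<partial>lborel)"
      proof (rule nn_integral_cong)
        fix u :: real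
        have "u > 0" if "1 / a \<le> u" using that True by (smt (verit) divide_pos_pos)
        moreover have "1 / u \<le> a \<longleftrightarrow> 1 / a \<le> u" if "u > 0" using that True by (simp add: field_simps)
        ultimately show "q u * indicator {..a} (1 / u) = ennreal (1 / u\<^sup>2) * indicator {1 / a..} u"
          by (auto simp: q_def indicator_def)
      qed
      also have "\<dots> = ennreal (0 - (- inverse (1 / a)))"
      proof (rule nn_integral_FTC_atLeast[where F = "\<lambda>u. - inverse u" and T = 0])
        fix x assume "1 / a \<le> x"
        then have "x > 0" using True by (smt (verit) divide_pos_pos)
        then show "((\<lambda>u. - inverse u) has_real_derivative 1 / x\<^sup>2) (at x)"
          by (auto intro!: derivative_eq_intros simp: power2_eq_square divide_inverse)
      next
        show "((\<lambda>u::real. - inverse u) \<longlongrightarrow> 0) at_top"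
          using tendsto_minus[OF tendsto_inverse_0_at_top[OF filterlim_ident[of "at_top :: real filter"]]] by simp
      qed auto
      finally show ?thesis using True by simp
    next
      case False
      have "(\<integral>\<^sup>+u. q u * indicator {..a} (1 / u) \<partial>lborel) = (\<integral>\<^sup>+u. 0 \<partial>(lborel :: real measure))"
      proof (rule nn_integral_cong)
        fix u :: real
        have "\<not> 1 / u \<le> a" if "u > 0" using that False by (smt (verit) divide_pos_pos)
        then show "q u * indicator {..a} (1 / u) = 0" by (auto simp: q_def indicator_def)
      qed
      then show ?thesis using False by simp
    qed
    finally show ?thesis .
  qed
  have Nat: "emeasure N {..a} = ennreal (max a 0)" for a
  proof -
    have "emeasure N {..a} = (\<integral>\<^sup>+x. indicator {0<..a} x \<partial>lborel)"
    proof -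
      have "indicator {0<..} x * indicator {..a} x = (indicator {0<..a} x :: ennreal)" for x
        by (auto simp: indicator_def)
      then show ?thesis unfolding N_def by (subst emeasure_density) simp_all
    qed
    then show ?thesis by (cases "a > 0") auto
  qed
  have "M = N"
    by (rule measure_eqI_atMost) (simp_all add: M_def[symmetric] N_def[symmetric] Mat Nat, simp_all add: M_def N_def)
  have "(\<integral>\<^sup>+u. f (1 / u) * q u \<partial>lborel) = (\<integral>\<^sup>+x. f x \<partial>M)"
    unfolding M_def by (subst nn_integral_distr) (simp_all add: nn_integral_density mult.commute)
  also have "\<dots> = (\<integral>\<^sup>+x. f x * indicator {0<..} x \<partial>lborel)"
    unfolding \<open>M = N\<close> N_def by (subst nn_integral_density) (simp_all add: mult.commute)
  finally show ?thesis by (simp add: q_def)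
qed

lemma nn_integral_inverse_gamma:
  assumes c: "c > 0" and B: "B > 0"
  shows "(\<integral>\<^sup>+u. ennreal (u powr (- c - 1) * exp (- B / u)) * indicator {0<..} u \<partial>lborel) = ennreal (Gamma c * B powr (- c))"
proof -
  have "(\<integral>\<^sup>+u. ennreal (u powr (- c - 1) * exp (- B / u)) * indicator {0<..} u \<partial>lborel)
    = (\<integral>\<^sup>+u. (ennreal (exp (- B * (1 / u))) * powr_density c (1 / u)) * (ennreal (1 / u\<^sup>2) * indicator {0<..} u) \<partial>lborel)"
  proof (rule nn_integral_cong)
    fix u :: real
    show "ennreal (u powr (- c - 1) * exp (- B / u)) * indicator {0<..} u
      = (ennreal (exp (- B * (1 / u))) * powr_density c (1 / u)) * (ennreal (1 / u\<^sup>2) * indicator {0<..} u)"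
    proof (cases "u > 0")
      case True
      have "(1 / u) powr (c - 1) * (1 / u\<^sup>2) = u powr (- (c - 1)) * u powr (- 2)"
        using True by (simp add: powr_divide powr_minus_divide powr_numeral del: minus_diff_eq)
      also have "\<dots> = u powr (- c - 1)"
        by (subst powr_add[symmetric], rule arg_cong2[where f = "(powr)"]) simp_all
      finally have E: "(1 / u) powr (c - 1) * (1 / u\<^sup>2) = u powr (- c - 1)" .
      have "u powr (- c - 1) * exp (- B / u) = (exp (- B * (1 / u)) * (1 / u) powr (c - 1)) * (1 / u\<^sup>2)"
        unfolding E[symmetric] by simp
      then show ?thesis using True by (simp add: powr_density_def ennreal_mult[symmetric])
    qed simp
  qed
  also have "\<dots> = (\<integral>\<^sup>+x. (ennreal (exp (- B * x)) * powr_density c x) * indicator {0<..} x \<partial>lborel)"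
    by (rule nn_integral_inverse) measurable
  also have "\<dots> = (\<integral>\<^sup>+x. ennreal (exp (- B * x)) * powr_density c x \<partial>lborel)"
    by (intro nn_integral_cong) (auto simp: powr_density_def indicator_def)
  also have "\<dots> = ennreal (Gamma c * B powr (- c))" by (rule nn_integral_gamma[OF c B])
  finally show ?thesis .
qed

lemma nn_integral_FTC_pos:
  fixes F f :: "real \<Rightarrow> real"
  assumes F: "\<And>x. x > 0 \<Longrightarrow> (F has_real_derivative f x) (at x)" and f: "\<And>x. x > 0 \<Longrightarrow> isCont f x" "\<And>x. x > 0 \<Longrightarrow> 0 \<le> f x"
    and lim: "(F \<longlongrightarrow> A) (at_right 0)" "(F \<longlongrightarrow> B) at_top"
  shows "(\<integral>\<^sup>+x. ennreal (f x) * indicator {0<..} x \<partial>lborel) = ennreal (B - A)"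
proof -
  have e: "einterval 0 \<infinity> = {0<..}" by (auto simp: einterval_def zero_ereal_def)
  have l0: "((F \<circ> real_of_ereal) \<longlongrightarrow> A) (at_right (0::ereal))"
    using lim(1) unfolding zero_ereal_def by (simp add: ereal_tendsto_simps)
  have l1: "((F \<circ> real_of_ereal) \<longlongrightarrow> B) (at_left (\<infinity>::ereal))"
    using lim(2) by (simp add: ereal_tendsto_simps)
  have AE: "AE x in lborel. (0::ereal) < ereal x \<longrightarrow> ereal x < \<infinity> \<longrightarrow> 0 \<le> f x"
    using f(2) by (auto simp: zero_ereal_def)
  note FTC = interval_integral_FTC_nonneg[where a = 0 and b = "\<infinity>" and F = F and f = f, OF _ _ _ AE l0 l1]
  have int: "set_integrable lborel {0<..} f" and eq: "(LBINT x=0..\<infinity>. f x) = B - A"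
    using FTC F f(1) by (auto simp: e zero_ereal_def)
  have "(\<integral>\<^sup>+x. ennreal (f x) * indicator {0<..} x \<partial>lborel) = (\<integral>\<^sup>+x. ennreal (indicator {0<..} x *\<^sub>R f x) \<partial>lborel)"
    by (intro nn_integral_cong) (auto simp: indicator_def)
  also have "\<dots> = ennreal (\<integral>x. indicator {0<..} x *\<^sub>R f x \<partial>lborel)"
    using int f(2) by (intro nn_integral_eq_integral) (auto simp: set_integrable_def indicator_def)
  also have "(\<integral>x. indicator {0<..} x *\<^sub>R f x \<partial>lborel) = B - A"
    using eq by (simp add: interval_lebesgue_integral_def set_lebesgue_integral_def e zero_ereal_def)
  finally show ?thesis .
qed

text \<open>The map from v to W v / (S (1 + v)) is increasing from (0, \<infinity>) onto (0, W / S).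
  It turns the Gamma mixing variable, which ranges over the half-line, into the integration variable
  of \<open>beta_cdf\<close>.\<close>

lemma odds_image_integral:
  fixes \<Phi> \<phi> :: "real \<Rightarrow> real"
  assumes S: "S > 0" and W: "W > 0" and \<Phi>: "\<And>x. x > 0 \<Longrightarrow> (\<Phi> has_real_derivative \<phi> x) (at x)"
    and \<phi>: "\<And>x. x > 0 \<Longrightarrow> isCont \<phi> x" "\<And>x. x > 0 \<Longrightarrow> 0 \<le> \<phi> x" and cont: "continuous_on {0..W / S} \<Phi>"
  shows "(\<integral>\<^sup>+v. ennreal (\<phi> (W * v / (S * (1 + v))) * (W / (S * (1 + v)\<^sup>2))) * indicator {0<..} v \<partial>lborel) = ennreal (\<Phi> (W / S) - \<Phi> 0)"
proof -
  define g where "g = (\<lambda>v. W * v / (S * (1 + v)))"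
  have gd: "(g has_real_derivative W / (S * (1 + v)\<^sup>2)) (at v)" if "v > 0" for v
  proof -
    have "(g has_real_derivative (W * (S * (1 + v)) - W * v * (S * 1)) / (S * (1 + v) * (S * (1 + v)))) (at v)"
      unfolding g_def using that S by (auto intro!: derivative_eq_intros)
    also have "(W * (S * (1 + v)) - W * v * (S * 1)) / (S * (1 + v) * (S * (1 + v))) = W / (S * (1 + v)\<^sup>2)"
    proof -
      have "W * (S * (1 + v)) - W * v * (S * 1) = S * W" by (simp add: algebra_simps)
      then show ?thesis using that S by (simp add: power2_eq_square)
    qed
    finally show ?thesis .
  qed
  have gp: "g v > 0" if "v > 0" for v using that S W by (simp add: g_def)
  have gr: "g v \<in> {0..W / S}" if "v \<ge> 0" for v
  proof -
    have "g v = W / S * (v / (1 + v))" by (simp add: g_def)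
    moreover have "0 \<le> v / (1 + v)" "v / (1 + v) \<le> 1" using that by auto
    ultimately have "0 \<le> g v" "g v \<le> W / S"
      using S W mult_left_le[of "v / (1 + v)" "W / S"] by (simp_all only: divide_nonneg_nonneg mult_nonneg_nonneg less_imp_le)
    then show ?thesis by simp
  qed
  show ?thesis
    unfolding g_def[symmetric]
  proof (rule nn_integral_FTC_pos)
    fix v :: real assume v: "v > 0"
    show "((\<lambda>v. \<Phi> (g v)) has_real_derivative \<phi> (W * v / (S * (1 + v))) * (W / (S * (1 + v)\<^sup>2))) (at v)"
      using DERIV_chain2[OF \<Phi>[OF gp[OF v]] gd[OF v]] by (simp add: g_def)
    have "isCont g v" using gd[OF v] by (rule DERIV_isCont)
    then have "isCont (\<lambda>v. \<phi> (g v)) v" by (rule isCont_o2) (rule \<phi>(1)[OF gp[OF v]])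
    then show "isCont (\<lambda>v. \<phi> (W * v / (S * (1 + v))) * (W / (S * (1 + v)\<^sup>2))) v"
      unfolding g_def using v S by (intro continuous_intros) auto
    show "0 \<le> \<phi> (W * v / (S * (1 + v))) * (W / (S * (1 + v)\<^sup>2))"
      using \<phi>(2)[OF gp[OF v]] S W by (simp add: g_def)
  next
    have "(g \<longlongrightarrow> W * 0 / (S * (1 + 0))) (at_right 0)"
      unfolding g_def using S by (intro tendsto_intros) auto
    then have g0: "(g \<longlongrightarrow> 0) (at_right 0)" by simp
    show "((\<lambda>v. \<Phi> (g v)) \<longlongrightarrow> \<Phi> 0) (at_right 0)"
      by (rule continuous_on_tendsto_compose[OF cont g0])
         (use S W gr in \<open>auto simp: eventually_at_filter intro!: always_eventually\<close>)
    have "((\<lambda>v. W / S * (1 - 1 / (1 + v))) \<longlongrightarrow> W / S * (1 - 0)) at_top"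
      by (intro tendsto_intros tendsto_divide_0[OF tendsto_const] filterlim_at_top_imp_at_infinity filterlim_tendsto_add_at_top[OF tendsto_const] filterlim_ident)
    moreover have "\<forall>\<^sub>F v in at_top. W / S * (1 - 1 / (1 + v)) = g v"
      using eventually_gt_at_top[of 0] by eventually_elim (use S in \<open>simp add: g_def field_simps\<close>)
    ultimately have "(g \<longlongrightarrow> W / S * (1 - 0)) at_top" by (rule Lim_transform_eventually)
    then have g1: "(g \<longlongrightarrow> W / S) at_top" by simp
    show "((\<lambda>v. \<Phi> (g v)) \<longlongrightarrow> \<Phi> (W / S)) at_top"
    proof (rule continuous_on_tendsto_compose[OF cont g1])
      show "W / S \<in> {0..W / S}" using S W by simp
      show "\<forall>\<^sub>F v in at_top. g v \<in> {0..W / S}"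
        using eventually_ge_at_top[of 0] by eventually_elim (rule gr)
    qed
  qed
qed

text \<open>What remains to be integrated over the mixing variable v when \<alpha>, \<beta> and
  \<sigma>^2 are gone. Completing the square in \<beta> leaves S + v W / (1 + v), and the Gaussian
  integral in \<beta> leaves the power - p / 2 = - (a + 1) of 1 + v.\<close>

definition post_kernel :: "real \<Rightarrow> real \<Rightarrow> real \<Rightarrow> real \<Rightarrow> ennreal" where
  "post_kernel a c S W = (\<integral>\<^sup>+v. powr_density a v * ennreal ((1 + v) powr (- (a + 1)) * (S + v * W / (1 + v)) powr (- c)) \<partial>lborel)"

text \<open>For x = W v / (S (1 + v)) one has S + v W / (1 + v) = S (1 + x) and dx = W / (S (1 +
  v)^2) dv; the rest is a count of exponents.\<close>

lemma post_kernel_integrand: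
  fixes S W v a c :: real
  assumes S: "S > 0" and W: "W > 0" and v: "v > 0"
  shows "v powr (a - 1) * ((1 + v) powr (- (a + 1)) * (S + v * W / (1 + v)) powr (- c))
    = W powr (- a) * S powr (a - c) * (((W * v / (S * (1 + v))) powr (a - 1) * (1 + W * v / (S * (1 + v))) powr (- c)) * (W / (S * (1 + v)\<^sup>2)))"
proof -
  have 1: "(W * v / (S * (1 + v))) powr (a - 1) = W powr (a - 1) * v powr (a - 1) * S powr (1 - a) * (1 + v) powr (1 - a)"
  proof -
    have "(W * v / (S * (1 + v))) powr (a - 1) = W powr (a - 1) * v powr (a - 1) / (S powr (a - 1) * (1 + v) powr (a - 1))"
      by (simp add: powr_divide powr_mult)
    then show ?thesis using powr_minus_divide[of S "a - 1"] powr_minus_divide[of "1 + v" "a - 1"] by simp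
  qed
  have "S + v * W / (1 + v) = S * (1 + W * v / (S * (1 + v)))"
  proof -
    have "S + v * W / x = S * (1 + W * v / (S * x))" for x
      using S by (simp add: distrib_left mult.commute)
    then show ?thesis .
  qed
  then have 2: "(S + v * W / (1 + v)) powr (- c) = S powr (- c) * (1 + W * v / (S * (1 + v))) powr (- c)"
    using assms by (simp add: powr_mult)
  have 3: "W powr (- a) * W powr (a - 1) * W = 1"
  proof -
    have "W powr (- a) * W powr (a - 1) * W powr 1 = W powr (- a + (a - 1) + 1)" by (simp only: powr_add)
    then show ?thesis using W by simp
  qed
  have 4: "S powr (a - c) * S powr (1 - a) / S = S powr (- c)"
  proof -
    have "S powr (a - c) * S powr (1 - a) * S powr (- 1) = S powr ((a - c) + (1 - a) + (- 1))" by (simp only: powr_add)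
    then show ?thesis using S by (simp add: powr_minus_divide)
  qed
  have 5: "(1 + v) powr (1 - a) / (1 + v)\<^sup>2 = (1 + v) powr (- (a + 1))"
  proof -
    have "(1 + v) powr (1 - a) * (1 + v) powr (- 2) = (1 + v) powr ((1 - a) + (- 2))" by (simp only: powr_add)
    moreover have "(1 + v) powr (- 2) = 1 / (1 + v)\<^sup>2" using v by (simp add: powr_minus_divide powr_numeral)
    ultimately show ?thesis by (simp add: algebra_simps)
  qed
  define P where "P = (1 + W * v / (S * (1 + v))) powr (- c)"
  have "W powr (- a) * S powr (a - c) * (((W * v / (S * (1 + v))) powr (a - 1) * P) * (W / (S * (1 + v)\<^sup>2)))
    = (W powr (- a) * W powr (a - 1) * W) * (S powr (a - c) * S powr (1 - a) / S) * ((1 + v) powr (1 - a) / (1 + v)\<^sup>2) * v powr (a - 1) * P"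
    unfolding 1 by simp
  also have "\<dots> = v powr (a - 1) * ((1 + v) powr (- (a + 1)) * (S powr (- c) * P))"
    unfolding 3 4 5 by simp
  finally show ?thesis unfolding 2 P_def by simp
qed

text \<open>The antiderivative is left open because two are needed: \<open>beta_cdf\<close> for the
  posterior mass, and b / (a + b) times the sum of \<open>beta_cdf\<close> and
  \<open>beta_corr\<close> for the integral of 1 / \<sigma>^2.\<close>

lemma post_kernel_eq:
  assumes S: "S > 0" and W: "W > 0" and \<Phi>: "\<And>x. x > 0 \<Longrightarrow> (\<Phi> has_real_derivative x powr (a - 1) * (1 + x) powr (- c)) (at x)"
    and cont: "continuous_on {0..W / S} \<Phi>" and \<Phi>0: "\<Phi> 0 = 0"
  shows "post_kernel a c S W = ennreal (W powr (- a) * S powr (a - c)) * ennreal (\<Phi> (W / S))"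
proof -
  let ?f = "\<lambda>v. ((W * v / (S * (1 + v))) powr (a - 1) * (1 + W * v / (S * (1 + v))) powr (- c)) * (W / (S * (1 + v)\<^sup>2))"
  have "post_kernel a c S W = (\<integral>\<^sup>+v. ennreal (W powr (- a) * S powr (a - c)) * (ennreal (?f v) * indicator {0<..} v) \<partial>lborel)"
    unfolding post_kernel_def
  proof (rule nn_integral_cong)
    fix v :: real
    show "powr_density a v * ennreal ((1 + v) powr (- (a + 1)) * (S + v * W / (1 + v)) powr (- c))
      = ennreal (W powr (- a) * S powr (a - c)) * (ennreal (?f v) * indicator {0<..} v)"
    proof (cases "v > 0")
      case True
      have "powr_density a v * ennreal ((1 + v) powr (- (a + 1)) * (S + v * W / (1 + v)) powr (- c))
        = ennreal (v powr (a - 1) * ((1 + v) powr (- (a + 1)) * (S + v * W / (1 + v)) powr (- c)))"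
        using True by (simp add: powr_density_def ennreal_mult del: minus_add_distrib)
      also have "\<dots> = ennreal (W powr (- a) * S powr (a - c)) * ennreal (?f v)"
        unfolding post_kernel_integrand[OF S W True] using S W by (intro ennreal_mult) auto
      finally show ?thesis using True by simp
    qed (simp add: powr_density_def)
  qed
  also have "\<dots> = ennreal (W powr (- a) * S powr (a - c)) * (\<integral>\<^sup>+v. ennreal (?f v) * indicator {0<..} v \<partial>lborel)"
    by (rule nn_integral_cmult) measurable
  also have "(\<integral>\<^sup>+v. ennreal (?f v) * indicator {0<..} v \<partial>lborel) = ennreal (\<Phi> (W / S) - \<Phi> 0)"
    by (rule odds_image_integral[OF S W \<Phi> _ _ cont]) (auto intro!: continuous_intros)
  finally show ?thesis by (simp add: \<Phi>0)
qed

section \<open>Integrating the posterior over scale, coefficients and intercept\<close>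

context wide_design
begin

text \<open>Substituting s = u / \<tau>^2 preserves ds / s and turns \<open>s powr (- k)\<close>
  into \<open>(\<tau>\<^sup>2) powr k * u powr (- k)\<close>. The error law survives only through
  the moment of order k of \<tau>^2, which is 1 for k = 0 and k = 1, the two exponents that Stein's
  loss calls for.\<close>

lemma post_int_inner:
  assumes T: "scale_mixture T" and Q: "Q \<ge> 0"
  shows "(\<integral>\<^sup>+s\<in>{0<..}. ennreal (s powr (- k) * (Q / s)) *
      (\<integral>\<^sup>+\<tau>. ennreal ((2 * pi * s * \<tau>\<^sup>2) powr (- real CARD('n) / 2) * exp (- D / (2 * s * \<tau>\<^sup>2))) \<partial>T) \<partial>lborel)
    = (\<integral>\<^sup>+\<tau>. ennreal ((\<tau>\<^sup>2) powr k) \<partial>T) *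
      (\<integral>\<^sup>+u\<in>{0<..}. ennreal (u powr (- k) * (Q / u) * ((2 * pi * u) powr (- real CARD('n) / 2) * exp (- D / (2 * u)))) \<partial>lborel)"
proof -
  interpret T: prob_space T using T by (simp add: scale_mixture_def)
  have sT [measurable_cong]: "sets T = sets borel" and posT: "AE \<tau> in T. 0 < \<tau>" using T by (auto simp: scale_mixture_def)
  interpret TL: pair_sigma_finite T "lborel :: real measure" ..
  define f where "f = (\<lambda>u. ennreal (u powr (- k) * (Q / u) * ((2 * pi * u) powr (- real CARD('n) / 2) * exp (- D / (2 * u)))) * indicator {0<..} u)"
  have [measurable]: "f \<in> borel_measurable borel" unfolding f_def by measurable
  have "(\<integral>\<^sup>+s\<in>{0<..}. ennreal (s powr (- k) * (Q / s)) *
      (\<integral>\<^sup>+\<tau>. ennreal ((2 * pi * s * \<tau>\<^sup>2) powr (- real CARD('n) / 2) * exp (- D / (2 * s * \<tau>\<^sup>2))) \<partial>T) \<partial>lborel)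
    = (\<integral>\<^sup>+s. (\<integral>\<^sup>+\<tau>. ennreal (s powr (- k) * (Q / s)) *
      ennreal ((2 * pi * s * \<tau>\<^sup>2) powr (- real CARD('n) / 2) * exp (- D / (2 * s * \<tau>\<^sup>2))) * indicator {0<..} s \<partial>T) \<partial>lborel)"
    by (simp add: nn_integral_cmult nn_integral_multc)
  also have "\<dots> = (\<integral>\<^sup>+\<tau>. (\<integral>\<^sup>+s. ennreal (s powr (- k) * (Q / s)) *
      ennreal ((2 * pi * s * \<tau>\<^sup>2) powr (- real CARD('n) / 2) * exp (- D / (2 * s * \<tau>\<^sup>2))) * indicator {0<..} s \<partial>lborel) \<partial>T)"
    by (rule TL.Fubini') measurable
  also have "\<dots> = (\<integral>\<^sup>+\<tau>. ennreal ((\<tau>\<^sup>2) powr k) * (\<integral>\<^sup>+u. f u \<partial>lborel) \<partial>T)"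
  proof (rule nn_integral_cong_AE, use posT in eventually_elim)
    fix \<tau> :: real assume \<tau>: "0 < \<tau>"
    define c where "c = 1 / \<tau>\<^sup>2"
    have c: "c > 0" using \<tau> by (simp add: c_def)
    have "(\<integral>\<^sup>+s. ennreal (s powr (- k) * (Q / s)) *
      ennreal ((2 * pi * s * \<tau>\<^sup>2) powr (- real CARD('n) / 2) * exp (- D / (2 * s * \<tau>\<^sup>2))) * indicator {0<..} s \<partial>lborel)
      = ennreal \<bar>c\<bar> * (\<integral>\<^sup>+u. ennreal ((0 + c * u) powr (- k) * (Q / (0 + c * u))) *
      ennreal ((2 * pi * (0 + c * u) * \<tau>\<^sup>2) powr (- real CARD('n) / 2) * exp (- D / (2 * (0 + c * u) * \<tau>\<^sup>2))) * indicator {0<..} (0 + c * u) \<partial>lborel)"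
      by (rule nn_integral_real_affine) (use c in auto)
    also have "\<dots> = (\<integral>\<^sup>+u. ennreal \<bar>c\<bar> * (ennreal ((0 + c * u) powr (- k) * (Q / (0 + c * u))) *
      ennreal ((2 * pi * (0 + c * u) * \<tau>\<^sup>2) powr (- real CARD('n) / 2) * exp (- D / (2 * (0 + c * u) * \<tau>\<^sup>2))) * indicator {0<..} (0 + c * u)) \<partial>lborel)"
      by (rule nn_integral_cmult[symmetric]) measurable
    also have "\<dots> = (\<integral>\<^sup>+u. ennreal ((\<tau>\<^sup>2) powr k) * f u \<partial>lborel)"
    proof (rule nn_integral_cong)
      fix u :: real
      show "ennreal \<bar>c\<bar> * (ennreal ((0 + c * u) powr (- k) * (Q / (0 + c * u))) *
      ennreal ((2 * pi * (0 + c * u) * \<tau>\<^sup>2) powr (- real CARD('n) / 2) * exp (- D / (2 * (0 + c * u) * \<tau>\<^sup>2))) * indicator {0<..} (0 + c * u))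
        = ennreal ((\<tau>\<^sup>2) powr k) * f u"
      proof (cases "u > 0")
        case True
        have e1: "2 * pi * (0 + c * u) * \<tau>\<^sup>2 = 2 * pi * u" "2 * (0 + c * u) * \<tau>\<^sup>2 = 2 * u"
          using \<tau> by (simp_all add: c_def)
        have e2: "(0 + c * u) powr (- k) = (\<tau>\<^sup>2) powr k * u powr (- k)"
          using \<tau> True by (simp add: c_def powr_divide powr_mult powr_minus_divide)
        have e3: "c * (Q / (0 + c * u)) = Q / u" using c by simp
        have "c * (((0 + c * u) powr (- k) * (Q / (0 + c * u))) * ((2 * pi * u) powr (- real CARD('n) / 2) * exp (- D / (2 * u))))
          = (\<tau>\<^sup>2) powr k * (u powr (- k) * (c * (Q / (0 + c * u))) * ((2 * pi * u) powr (- real CARD('n) / 2) * exp (- D / (2 * u))))"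
          unfolding e2 by simp
        then have E: "c * (((0 + c * u) powr (- k) * (Q / (0 + c * u))) * ((2 * pi * u) powr (- real CARD('n) / 2) * exp (- D / (2 * u))))
          = (\<tau>\<^sup>2) powr k * (u powr (- k) * (Q / u) * ((2 * pi * u) powr (- real CARD('n) / 2) * exp (- D / (2 * u))))"
          unfolding e3 .
        have "ennreal c * (ennreal ((0 + c * u) powr (- k) * (Q / (0 + c * u))) * ennreal ((2 * pi * u) powr (- real CARD('n) / 2) * exp (- D / (2 * u))))
          = ennreal (c * (((0 + c * u) powr (- k) * (Q / (0 + c * u))) * ((2 * pi * u) powr (- real CARD('n) / 2) * exp (- D / (2 * u)))))"
        proof -
          have "ennreal c * (ennreal P * ennreal R) = ennreal (c * (P * R))" if "0 \<le> P" "0 \<le> R" for P R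
            using c that by (simp add: ennreal_mult)
          then show ?thesis using c True Q by simp
        qed
        also have "\<dots> = ennreal ((\<tau>\<^sup>2) powr k) * ennreal (u powr (- k) * (Q / u) * ((2 * pi * u) powr (- real CARD('n) / 2) * exp (- D / (2 * u))))"
          unfolding E using True Q by (intro ennreal_mult) auto
        finally show ?thesis unfolding e1 f_def using c True by simp
      next
        case False
        then have "\<not> 0 < 0 + c * u" using c by (simp add: zero_less_mult_iff)
        then show ?thesis using False by (simp add: f_def)
      qed
    qed
    also have "\<dots> = ennreal ((\<tau>\<^sup>2) powr k) * (\<integral>\<^sup>+u. f u \<partial>lborel)" by (rule nn_integral_cmult) measurable
    finally show "(\<integral>\<^sup>+s. ennreal (s powr (- k) * (Q / s)) *
      ennreal ((2 * pi * s * \<tau>\<^sup>2) powr (- real CARD('n) / 2) * exp (- D / (2 * s * \<tau>\<^sup>2))) * indicator {0<..} s \<partial>lborel)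
      = ennreal ((\<tau>\<^sup>2) powr k) * (\<integral>\<^sup>+u. f u \<partial>lborel)" .
  qed
  also have "\<dots> = (\<integral>\<^sup>+\<tau>. ennreal ((\<tau>\<^sup>2) powr k) \<partial>T) * (\<integral>\<^sup>+u. f u \<partial>lborel)" by (rule nn_integral_multc) measurable
  finally show ?thesis by (simp add: f_def)
qed

lemma quadratic_integral_affine:
  fixes w :: real and v :: "real^'p"
  assumes w: "w > 0"
  shows "(\<integral>\<^sup>+\<beta>. ennreal (exp (- (norm (X *v (\<beta> - v)))\<^sup>2 * w / 2)) \<partial>lborel)
    = ennreal (w powr (- real CARD('p) / 2)) * (\<integral>\<^sup>+\<beta>. ennreal (exp (- (norm (X *v \<beta>))\<^sup>2 / 2)) \<partial>lborel)"
proof -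
  define c where "c = w powr (- 1 / 2)"
  have c: "c > 0" using w by (simp add: c_def)
  have c2: "c\<^sup>2 * w = 1"
  proof -
    have "c\<^sup>2 * w = w powr (- 1 / 2) * w powr (- 1 / 2) * w powr 1" using w by (simp add: c_def power2_eq_square)
    also have "\<dots> = w powr (- 1 / 2 + - 1 / 2 + 1)" by (simp only: powr_add)
    finally show ?thesis using w by simp
  qed
  have "(\<integral>\<^sup>+\<beta>. ennreal (exp (- (norm (X *v (\<beta> - v)))\<^sup>2 * w / 2)) \<partial>lborel)
    = ennreal (\<bar>c\<bar> ^ DIM(real^'p)) * (\<integral>\<^sup>+\<beta>. ennreal (exp (- (norm (X *v ((v + c *\<^sub>R \<beta>) - v)))\<^sup>2 * w / 2)) \<partial>lborel)"
    by (rule nn_integral_affine) (use c in auto)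
  also have "\<bar>c\<bar> ^ DIM(real^'p) = w powr (- real CARD('p) / 2)"
    using w by (simp add: c_def powr_power)
  also have "(\<integral>\<^sup>+\<beta>. ennreal (exp (- (norm (X *v ((v + c *\<^sub>R \<beta>) - v)))\<^sup>2 * w / 2)) \<partial>lborel) = (\<integral>\<^sup>+\<beta>. ennreal (exp (- (norm (X *v \<beta>))\<^sup>2 / 2)) \<partial>lborel)"
  proof (rule nn_integral_cong)
    fix \<beta>
    have "(norm (X *v ((v + c *\<^sub>R \<beta>) - v)))\<^sup>2 * w = (norm (X *v \<beta>))\<^sup>2 * (c\<^sup>2 * w)"
      by (simp add: matrix_vector_mult_scaleR power_mult_distrib)
    then show "ennreal (exp (- (norm (X *v ((v + c *\<^sub>R \<beta>) - v)))\<^sup>2 * w / 2)) = ennreal (exp (- (norm (X *v \<beta>))\<^sup>2 / 2))"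
      by (simp add: c2)
  qed
  finally show ?thesis .
qed

lemma complete_square:
  fixes \<beta> b :: "real^'p"
  assumes v: "v \<ge> 0"
  shows "(norm (X *v (b - \<beta>)))\<^sup>2 + v * (norm (X *v \<beta>))\<^sup>2 =
    (1 + v) * (norm (X *v (\<beta> - (1 / (1 + v)) *\<^sub>R b)))\<^sup>2 + v / (1 + v) * (norm (X *v b))\<^sup>2"
proof -
  define x where "x = X *v \<beta>"
  define y where "y = X *v b"
  define r where "r = 1 / (1 + v)"
  have r: "(1 + v) * r = 1" "v / (1 + v) = 1 - r" using v by (auto simp: r_def field_simps)
  have "(1 + v) * (norm (x - r *\<^sub>R y))\<^sup>2 = (1 + v) * (x \<bullet> x) - 2 * ((1 + v) * r) * (x \<bullet> y) + ((1 + v) * r) * r * (y \<bullet> y)"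
    by (simp add: power2_norm_eq_inner inner_diff_left inner_diff_right inner_commute algebra_simps)
  also have "\<dots> = (1 + v) * (x \<bullet> x) - 2 * (x \<bullet> y) + r * (y \<bullet> y)" unfolding r by simp
  finally have "(1 + v) * (norm (x - r *\<^sub>R y))\<^sup>2 + (1 - r) * (norm y)\<^sup>2 = (norm (y - x))\<^sup>2 + v * (norm x)\<^sup>2"
    by (simp add: power2_norm_eq_inner inner_diff_left inner_diff_right inner_commute algebra_simps)
  then show ?thesis
    by (simp add: x_def y_def r r_def[symmetric] matrix_vector_mult_diff_distrib matrix_vector_mult_scaleR)
qed

text \<open>The power \<open>|X\<beta>|\<close> to the \<open>-(p-2)\<close> is a Gamma mixture of Gaussians in \<open>\<beta>\<close>, so that the
  integral over \<open>\<beta>\<close> reduces to a Gaussian one.\<close>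

lemma harmonic_integral:
  fixes b :: "real^'p"
  defines "a0 \<equiv> real CARD('p) / 2 - 1"
  assumes a0: "a0 > 0" and u: "u > 0"
  shows "ennreal (Gamma a0 * 2 powr a0) *
     (\<integral>\<^sup>+\<beta>. ennreal ((norm (X *v \<beta>))\<^sup>2 powr (- a0) * exp (- (norm (X *v (b - \<beta>)))\<^sup>2 / (2 * u))) \<partial>lborel)
    = ennreal u * (\<integral>\<^sup>+\<beta>. ennreal (exp (- (norm (X *v \<beta>))\<^sup>2 / 2)) \<partial>lborel) *
      (\<integral>\<^sup>+v. powr_density a0 v * ennreal ((1 + v) powr (- (a0 + 1)) * exp (- (v / (1 + v) * (norm (X *v b))\<^sup>2) / (2 * u))) \<partial>lborel)"
proof -
  let ?K = "(\<integral>\<^sup>+\<beta>. ennreal (exp (- (norm (X *v \<beta>))\<^sup>2 / 2)) \<partial>(lborel :: (real^'p) measure))"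
  define g where "g = Gamma a0 * 2 powr a0"
  have g: "g > 0" using a0 by (simp add: g_def Gamma_real_pos)
  \<comment> \<open>At \<beta> = 0 the Gamma representation diverges while the power of 0 is 0 by
    convention; a single point is a null set.\<close>
  have ne: "AE \<beta> in lborel. \<beta> \<noteq> (0 :: real^'p)" by (rule AE_lborel_singleton)
  \<comment> \<open>Gamma integral with rate |X\<beta>|^2 / (2 u). Including u in the rate puts the
    mixing Gaussian on the scale of the likelihood, so that completing the square involves v
    alone.\<close>
  have rep: "ennreal (g * (norm (X *v \<beta>))\<^sup>2 powr (- a0)) =
      ennreal (u powr (- a0)) * (\<integral>\<^sup>+v. ennreal (exp (- (v * (norm (X *v \<beta>))\<^sup>2) / (2 * u))) * powr_density a0 v \<partial>lborel)"
    if \<beta>: "\<beta> \<noteq> 0" for \<beta> :: "real^'p"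
  proof -
    define B where "B = (norm (X *v \<beta>))\<^sup>2"
    have B: "B > 0" using \<beta> by (simp add: B_def)
    have "(\<integral>\<^sup>+v. ennreal (exp (- (v * B) / (2 * u))) * powr_density a0 v \<partial>lborel) = (\<integral>\<^sup>+v. ennreal (exp (- (B / (2 * u)) * v)) * powr_density a0 v \<partial>lborel)"
      by (simp add: mult.commute)
    also have "\<dots> = ennreal (Gamma a0 * (B / (2 * u)) powr (- a0))"
      using B u by (intro nn_integral_gamma a0) auto
    finally have I: "(\<integral>\<^sup>+v. ennreal (exp (- (v * B) / (2 * u))) * powr_density a0 v \<partial>lborel) = ennreal (Gamma a0 * (B / (2 * u)) powr (- a0))" .
    have "(B / (2 * u)) powr (- a0) = B powr (- a0) * 2 powr a0 * u powr a0"
      using B u by (simp add: powr_divide powr_mult powr_minus_divide)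
    moreover have "u powr (- a0) * u powr a0 = 1" using u by (simp add: powr_add[symmetric])
    ultimately have "u powr (- a0) * (Gamma a0 * (B / (2 * u)) powr (- a0)) = g * B powr (- a0)"
      unfolding g_def by (metis (no_types, lifting) mult.assoc mult.commute mult.left_commute mult.right_neutral)
    then show ?thesis unfolding B_def[symmetric] I
      using a0 by (simp add: ennreal_mult[symmetric] Gamma_real_pos less_imp_le)
  qed
  have "ennreal g * (\<integral>\<^sup>+\<beta>. ennreal ((norm (X *v \<beta>))\<^sup>2 powr (- a0) * exp (- (norm (X *v (b - \<beta>)))\<^sup>2 / (2 * u))) \<partial>lborel)
    = (\<integral>\<^sup>+\<beta>. ennreal (g * (norm (X *v \<beta>))\<^sup>2 powr (- a0)) * ennreal (exp (- (norm (X *v (b - \<beta>)))\<^sup>2 / (2 * u))) \<partial>lborel)"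
    using g by (subst nn_integral_cmult[symmetric]) (auto simp: ennreal_mult mult.assoc)
  also have "\<dots> = (\<integral>\<^sup>+\<beta>. ennreal (u powr (- a0)) * (\<integral>\<^sup>+v. powr_density a0 v * ennreal (exp (- ((norm (X *v (b - \<beta>)))\<^sup>2 + v * (norm (X *v \<beta>))\<^sup>2) / (2 * u))) \<partial>lborel) \<partial>lborel)"
  proof (rule nn_integral_cong_AE, use ne in eventually_elim)
    fix \<beta> :: "real^'p" assume \<beta>: "\<beta> \<noteq> 0"
    have "(\<integral>\<^sup>+v. powr_density a0 v * ennreal (exp (- ((norm (X *v (b - \<beta>)))\<^sup>2 + v * (norm (X *v \<beta>))\<^sup>2) / (2 * u))) \<partial>lborel)
      = (\<integral>\<^sup>+v. (ennreal (exp (- (v * (norm (X *v \<beta>))\<^sup>2) / (2 * u))) * powr_density a0 v) * ennreal (exp (- (norm (X *v (b - \<beta>)))\<^sup>2 / (2 * u))) \<partial>lborel)"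
    proof (rule nn_integral_cong)
      fix v
      have "- ((norm (X *v (b - \<beta>)))\<^sup>2 + v * (norm (X *v \<beta>))\<^sup>2) / (2 * u) = - (v * (norm (X *v \<beta>))\<^sup>2) / (2 * u) + - (norm (X *v (b - \<beta>)))\<^sup>2 / (2 * u)"
        by (simp add: add_divide_distrib diff_divide_distrib)
      then have "exp (- ((norm (X *v (b - \<beta>)))\<^sup>2 + v * (norm (X *v \<beta>))\<^sup>2) / (2 * u)) = exp (- (v * (norm (X *v \<beta>))\<^sup>2) / (2 * u)) * exp (- (norm (X *v (b - \<beta>)))\<^sup>2 / (2 * u))"
        by (simp only: exp_add)
      then show "powr_density a0 v * ennreal (exp (- ((norm (X *v (b - \<beta>)))\<^sup>2 + v * (norm (X *v \<beta>))\<^sup>2) / (2 * u)))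
        = (ennreal (exp (- (v * (norm (X *v \<beta>))\<^sup>2) / (2 * u))) * powr_density a0 v) * ennreal (exp (- (norm (X *v (b - \<beta>)))\<^sup>2 / (2 * u)))"
        by (simp only: ennreal_mult[OF exp_ge_zero exp_ge_zero] mult_ac)
    qed
    also have "\<dots> = (\<integral>\<^sup>+v. ennreal (exp (- (v * (norm (X *v \<beta>))\<^sup>2) / (2 * u))) * powr_density a0 v \<partial>lborel) * ennreal (exp (- (norm (X *v (b - \<beta>)))\<^sup>2 / (2 * u)))"
      by (rule nn_integral_multc) measurable
    finally show "ennreal (g * (norm (X *v \<beta>))\<^sup>2 powr (- a0)) * ennreal (exp (- (norm (X *v (b - \<beta>)))\<^sup>2 / (2 * u)))
      = ennreal (u powr (- a0)) * (\<integral>\<^sup>+v. powr_density a0 v * ennreal (exp (- ((norm (X *v (b - \<beta>)))\<^sup>2 + v * (norm (X *v \<beta>))\<^sup>2) / (2 * u))) \<partial>lborel)"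
      using rep[OF \<beta>] by (simp only: mult.assoc)
  qed
  also have "\<dots> = ennreal (u powr (- a0)) * (\<integral>\<^sup>+\<beta>. (\<integral>\<^sup>+v. powr_density a0 v * ennreal (exp (- ((norm (X *v (b - \<beta>)))\<^sup>2 + v * (norm (X *v \<beta>))\<^sup>2) / (2 * u))) \<partial>lborel) \<partial>lborel)"
    by (rule nn_integral_cmult) measurable
  also have "(\<integral>\<^sup>+\<beta>. (\<integral>\<^sup>+v. powr_density a0 v * ennreal (exp (- ((norm (X *v (b - \<beta>)))\<^sup>2 + v * (norm (X *v \<beta>))\<^sup>2) / (2 * u))) \<partial>lborel) \<partial>(lborel :: (real^'p) measure))
    = (\<integral>\<^sup>+v. (\<integral>\<^sup>+\<beta>. powr_density a0 v * ennreal (exp (- ((norm (X *v (b - \<beta>)))\<^sup>2 + v * (norm (X *v \<beta>))\<^sup>2) / (2 * u))) \<partial>lborel) \<partial>lborel)"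
    by (rule lborel_pair.Fubini') measurable
  also have "\<dots> = (\<integral>\<^sup>+v. (ennreal (u powr (a0 + 1)) * ?K) * (powr_density a0 v * ennreal ((1 + v) powr (- (a0 + 1)) * exp (- (v / (1 + v) * (norm (X *v b))\<^sup>2) / (2 * u)))) \<partial>lborel)"
  proof (rule nn_integral_cong)
    fix v :: real
    show "(\<integral>\<^sup>+\<beta>. powr_density a0 v * ennreal (exp (- ((norm (X *v (b - \<beta>)))\<^sup>2 + v * (norm (X *v \<beta>))\<^sup>2) / (2 * u))) \<partial>lborel)
      = (ennreal (u powr (a0 + 1)) * ?K) * (powr_density a0 v * ennreal ((1 + v) powr (- (a0 + 1)) * exp (- (v / (1 + v) * (norm (X *v b))\<^sup>2) / (2 * u))))"
    proof (cases "v > 0")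
      case v: True
      define E where "E = exp (- (v / (1 + v) * (norm (X *v b))\<^sup>2) / (2 * u))"
      define w where "w = (1 + v) / u"
      have w: "w > 0" using v u by (simp add: w_def)
      have ex: "exp (- ((norm (X *v (b - \<beta>)))\<^sup>2 + v * (norm (X *v \<beta>))\<^sup>2) / (2 * u)) = E * exp (- (norm (X *v (\<beta> - (1 / (1 + v)) *\<^sub>R b)))\<^sup>2 * w / 2)" for \<beta>
      proof -
        have "- ((norm (X *v (b - \<beta>)))\<^sup>2 + v * (norm (X *v \<beta>))\<^sup>2) / (2 * u)
          = - (v / (1 + v) * (norm (X *v b))\<^sup>2) / (2 * u) + - (norm (X *v (\<beta> - (1 / (1 + v)) *\<^sub>R b)))\<^sup>2 * w / 2"
        proof -
          have "- (c * A + r) / (2 * u) = - r / (2 * u) + - A * (c / u) / 2" for c A r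
            by (simp add: add_divide_distrib diff_divide_distrib mult.commute)
          then show ?thesis unfolding complete_square[OF less_imp_le[OF v]] w_def .
        qed
        then show ?thesis by (simp only: exp_add E_def)
      qed
      have "(\<integral>\<^sup>+\<beta>. powr_density a0 v * ennreal (exp (- ((norm (X *v (b - \<beta>)))\<^sup>2 + v * (norm (X *v \<beta>))\<^sup>2) / (2 * u))) \<partial>lborel)
        = (\<integral>\<^sup>+\<beta>. (powr_density a0 v * ennreal E) * ennreal (exp (- (norm (X *v (\<beta> - (1 / (1 + v)) *\<^sub>R b)))\<^sup>2 * w / 2)) \<partial>lborel)"
        unfolding ex by (simp add: ennreal_mult E_def mult.assoc)
      also have "\<dots> = (powr_density a0 v * ennreal E) * (\<integral>\<^sup>+\<beta>. ennreal (exp (- (norm (X *v (\<beta> - (1 / (1 + v)) *\<^sub>R b)))\<^sup>2 * w / 2)) \<partial>lborel)"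
        by (rule nn_integral_cmult) measurable
      also have "\<dots> = (powr_density a0 v * ennreal E) * (ennreal (w powr (- real CARD('p) / 2)) * ?K)"
        unfolding quadratic_integral_affine[OF w] ..
      also have "w powr (- real CARD('p) / 2) = u powr (a0 + 1) * (1 + v) powr (- (a0 + 1))"
      proof -
        have p: "- real CARD('p) / 2 = - (a0 + 1)" by (simp add: a0_def)
        have "1 / u powr (- (a0 + 1)) = u powr (a0 + 1)"
          using powr_minus_divide[of u "- (a0 + 1)"] unfolding minus_minus by (rule sym)
        then have "(1 + v) powr (- (a0 + 1)) / u powr (- (a0 + 1)) = u powr (a0 + 1) * (1 + v) powr (- (a0 + 1))"
          by (metis divide_inverse inverse_eq_divide mult.commute)
        then show ?thesis unfolding p w_def powr_divide .
      qed
      finally show ?thesis unfolding E_def[symmetric] using u v by (simp add: ennreal_mult E_def mult_ac)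
    qed (simp add: powr_density_def)
  qed
  also have "\<dots> = (ennreal (u powr (a0 + 1)) * ?K) * (\<integral>\<^sup>+v. (powr_density a0 v * ennreal ((1 + v) powr (- (a0 + 1)) * exp (- (v / (1 + v) * (norm (X *v b))\<^sup>2) / (2 * u)))) \<partial>lborel)"
    by (rule nn_integral_cmult) measurable
  also have "ennreal (u powr (- a0)) * \<dots> = ennreal (u powr (- a0) * u powr (a0 + 1)) * ?K * (\<integral>\<^sup>+v. (powr_density a0 v * ennreal ((1 + v) powr (- (a0 + 1)) * exp (- (v / (1 + v) * (norm (X *v b))\<^sup>2) / (2 * u)))) \<partial>lborel)"
    by (simp add: ennreal_mult mult.assoc)
  also have "u powr (- a0) * u powr (a0 + 1) = u" using u by (simp add: powr_add[symmetric])
  finally show ?thesis by (simp add: g_def)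
qed

text \<open>Both integrals are common factors of the two posterior integrals, and their cancellation
  requires them to be positive and finite. The one over \<beta> is finite since \<open>fit\<close>
  is bounded below at intercept 0.\<close>

lemma finite_pos_gaussian_constants:
  "0 < (\<integral>\<^sup>+\<beta>. ennreal (exp (- (norm (X *v \<beta>))\<^sup>2 / 2)) \<partial>lborel)"
  "(\<integral>\<^sup>+\<beta>. ennreal (exp (- (norm (X *v \<beta>))\<^sup>2 / 2)) \<partial>lborel) < \<infinity>"
  "0 < (\<integral>\<^sup>+\<alpha>. ennreal (exp (- real CARD('n) * \<alpha>\<^sup>2 / 2)) \<partial>lborel)"
  "(\<integral>\<^sup>+\<alpha>. ennreal (exp (- real CARD('n) * \<alpha>\<^sup>2 / 2)) \<partial>lborel) < \<infinity>"
proof -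
  have pos: "0 < (\<integral>\<^sup>+x. ennreal (exp (g x)) \<partial>lborel)" if [measurable]: "g \<in> borel_measurable borel"
    for g :: "'a::euclidean_space \<Rightarrow> real"
  proof (rule ccontr)
    assume "\<not> ?thesis"
    then have "(\<integral>\<^sup>+x. ennreal (exp (g x)) \<partial>lborel) = 0" by (simp add: not_gr_zero)
    then have "AE x in lborel. ennreal (exp (g x)) = 0" by (subst (asm) nn_integral_0_iff_AE) auto
    then have "AE x in (lborel :: 'a measure). False" by simp
    then have "emeasure lborel (UNIV :: 'a set) = 0"
      by (subst (asm) AE_iff_measurable[of UNIV]) auto
    then show False by simp
  qed
  show "0 < (\<integral>\<^sup>+\<beta>. ennreal (exp (- (norm (X *v \<beta>))\<^sup>2 / 2)) \<partial>lborel)" by (rule pos) measurable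
  show "0 < (\<integral>\<^sup>+\<alpha>. ennreal (exp (- real CARD('n) * \<alpha>\<^sup>2 / 2)) \<partial>lborel)" by (rule pos) measurable
  obtain C where C: "C > 0" "\<And>v. norm v \<le> C * norm (fit v)" using fit_bounded_below by blast
  have "(\<integral>\<^sup>+\<beta>. ennreal (exp (- (norm (X *v \<beta>))\<^sup>2 / 2)) \<partial>lborel) \<le> (\<integral>\<^sup>+\<beta>. ennreal (exp (- (norm ((1 / C) *\<^sub>R \<beta>))\<^sup>2 / 2)) \<partial>(lborel :: (real^'p) measure))"
  proof (rule nn_integral_mono)
    fix \<beta> :: "real^'p"
    have "norm \<beta> \<le> C * norm (X *v \<beta>)" using C(2)[of "(0, \<beta>)"] by (simp add: fit_def norm_Pair)
    then have "norm ((1 / C) *\<^sub>R \<beta>) \<le> norm (X *v \<beta>)" using C(1) by (simp add: field_simps)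
    then have "(norm ((1 / C) *\<^sub>R \<beta>))\<^sup>2 \<le> (norm (X *v \<beta>))\<^sup>2" by (rule power_mono) simp
    then show "ennreal (exp (- (norm (X *v \<beta>))\<^sup>2 / 2)) \<le> ennreal (exp (- (norm ((1 / C) *\<^sub>R \<beta>))\<^sup>2 / 2))"
      by (intro ennreal_leI) simp
  qed
  also have "\<dots> = ennreal (\<bar>C\<bar> ^ DIM(real^'p)) * (\<integral>\<^sup>+\<beta>. ennreal (exp (- (norm ((1 / C) *\<^sub>R (0 + C *\<^sub>R \<beta>)))\<^sup>2 / 2)) \<partial>(lborel :: (real^'p) measure))"
    by (rule nn_integral_affine) (use C in auto)
  also have "\<dots> < \<infinity>" using C finite_gauss[where 'n = 'p] by (simp add: ennreal_mult_less_top)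
  finally show "(\<integral>\<^sup>+\<beta>. ennreal (exp (- (norm (X *v \<beta>))\<^sup>2 / 2)) \<partial>lborel) < \<infinity>" .
  have "(\<integral>\<^sup>+\<alpha>. ennreal (exp (- real CARD('n) * \<alpha>\<^sup>2 / 2)) \<partial>lborel) \<le> (\<integral>\<^sup>+\<alpha>. ennreal (sqrt (2 * pi)) * ennreal (std_normal_density \<alpha>) \<partial>lborel)"
  proof (rule nn_integral_mono)
    fix \<alpha> :: real
    have "1 * \<alpha>\<^sup>2 \<le> real CARD('n) * \<alpha>\<^sup>2" by (intro mult_right_mono) (auto simp: Suc_le_eq)
    then have "exp (- real CARD('n) * \<alpha>\<^sup>2 / 2) \<le> exp (- \<alpha>\<^sup>2 / 2)" by simp
    also have "\<dots> = sqrt (2 * pi) * std_normal_density \<alpha>" by (simp add: std_normal_density_def)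
    finally show "ennreal (exp (- real CARD('n) * \<alpha>\<^sup>2 / 2)) \<le> ennreal (sqrt (2 * pi)) * ennreal (std_normal_density \<alpha>)"
      by (simp add: ennreal_mult[symmetric] ennreal_leI)
  qed
  also have "\<dots> = ennreal (sqrt (2 * pi)) * (\<integral>\<^sup>+\<alpha>. ennreal (std_normal_density \<alpha>) \<partial>lborel)"
    by (rule nn_integral_cmult) simp
  also have "(\<integral>\<^sup>+\<alpha>. ennreal (std_normal_density \<alpha>) \<partial>lborel) = 1"
    using prob_space.emeasure_space_1[OF prob_space_normal_density[of 1 0]] by (simp add: emeasure_density)
  finally show "(\<integral>\<^sup>+\<alpha>. ennreal (exp (- real CARD('n) * \<alpha>\<^sup>2 / 2)) \<partial>lborel) < \<infinity>"
    by (rule le_less_trans) simp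
qed

lemma intercept_integral:
  assumes u: "u > 0"
  shows "(\<integral>\<^sup>+\<alpha>. ennreal (exp (- (real CARD('n) * (m - \<alpha>)\<^sup>2) / (2 * u))) \<partial>lborel) =
    ennreal (u powr (1 / 2)) * (\<integral>\<^sup>+\<alpha>. ennreal (exp (- real CARD('n) * \<alpha>\<^sup>2 / 2)) \<partial>lborel)"
proof -
  have "(\<integral>\<^sup>+\<alpha>. ennreal (exp (- (real CARD('n) * (m - \<alpha>)\<^sup>2) / (2 * u))) \<partial>lborel) =
    ennreal \<bar>sqrt u\<bar> * (\<integral>\<^sup>+\<alpha>. ennreal (exp (- (real CARD('n) * (m - (m + sqrt u * \<alpha>))\<^sup>2) / (2 * u))) \<partial>lborel)"
    by (rule nn_integral_real_affine) (use u in auto)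
  then show ?thesis using u by (simp add: power_mult_distrib powr_half_sqrt)
qed

text \<open>K is the same for every k, so it drops out of the quotient of the posterior integrals.
  The variables \<alpha> and \<beta> are integrated first, then the variance; the mixing variable v
  is kept outermost and ends up in \<open>post_kernel\<close>.\<close>

lemma post_int_eq:
  fixes y :: "real^'n"
  defines "a0 \<equiv> real CARD('p) / 2 - 1" and "b \<equiv> dof / 2"
  assumes T: "scale_mixture T" and p3: "3 \<le> CARD('p)" and S: "0 < Vres y" and W: "0 < Vfit y"
  obtains K where "0 < K" "K < \<infinity>" "\<And>k. k \<ge> 0 \<Longrightarrow> (\<integral>\<^sup>+\<tau>. ennreal ((\<tau>\<^sup>2) powr k) \<partial>T) = 1 \<Longrightarrow>
    post_int T X (\<lambda>s. s powr (- k)) y =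
    K * (ennreal (Gamma (a0 + b + k) * 2 powr (a0 + b + k)) * post_kernel a0 (a0 + b + k) (Vres y) (Vfit y))"
proof -
  have a0: "a0 > 0" and b: "b > 0" using p3 dof_eq by (auto simp: a0_def b_def)
  define K0 where "K0 = (\<integral>\<^sup>+\<alpha>. ennreal (exp (- real CARD('n) * \<alpha>\<^sup>2 / 2)) \<partial>lborel)"
  define K1 where "K1 = (\<integral>\<^sup>+\<beta>. ennreal (exp (- (norm (X *v \<beta>))\<^sup>2 / 2)) \<partial>lborel)"
  have Kpos: "0 < K0" "K0 < \<infinity>" "0 < K1" "K1 < \<infinity>"
    unfolding K0_def K1_def by (rule finite_pos_gaussian_constants)+
  define g where "g = Gamma a0 * 2 powr a0"
  have g: "g > 0" using a0 by (simp add: g_def Gamma_real_pos)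
  define d where "d = (2 * pi) powr (- real CARD('n) / 2)"
  have d: "d > 0" by (simp add: d_def)
  let ?b = "lscoef X y"
  show ?thesis
  proof
    show "0 < ennreal (d / g) * K0 * K1" using Kpos d g by (simp add: ennreal_zero_less_mult_iff)
    show "ennreal (d / g) * K0 * K1 < \<infinity>" using Kpos by (simp add: ennreal_mult_less_top)
    fix k :: real assume k: "k \<ge> 0" and mk: "(\<integral>\<^sup>+\<tau>. ennreal ((\<tau>\<^sup>2) powr k) \<partial>T) = 1"
    define c where "c = a0 + b + k"
    have c: "c > 0" using a0 b k by (simp add: c_def)
    define h where "h = (\<lambda>u. ennreal (u powr (- k) / u * (2 * pi * u) powr (- real CARD('n) / 2) * exp (- Vres y / (2 * u))) * indicator {0<..} u)"
    define g1 where "g1 = (\<lambda>\<alpha> u. ennreal (exp (- (real CARD('n) * (ybar y - \<alpha>)\<^sup>2) / (2 * u))))"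
    define g2 where "g2 = (\<lambda>\<beta> u. ennreal ((norm (X *v \<beta>))\<^sup>2 powr (- a0) * exp (- (norm (X *v (?b - \<beta>)))\<^sup>2 / (2 * u))))"
    have [measurable]: "h \<in> borel_measurable borel" unfolding h_def by measurable
    have [measurable]: "(\<lambda>p. g1 (fst p) (snd p)) \<in> borel_measurable (borel \<Otimes>\<^sub>M borel)" unfolding g1_def by measurable
    have [measurable]: "(\<lambda>p. g2 (fst p) (snd p)) \<in> borel_measurable (borel \<Otimes>\<^sub>M borel)" unfolding g2_def by measurable
    have [measurable]: "(\<lambda>p. g1 (snd p) (fst p)) \<in> borel_measurable (borel \<Otimes>\<^sub>M borel)" unfolding g1_def by measurable
    have [measurable]: "(\<lambda>p. g2 (snd p) (fst p)) \<in> borel_measurable (borel \<Otimes>\<^sub>M borel)" unfolding g2_def by measurable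
    have g1c [measurable]: "\<And>u. (\<lambda>\<alpha>. g1 \<alpha> u) \<in> borel_measurable borel" "\<And>\<alpha>. g1 \<alpha> \<in> borel_measurable borel" unfolding g1_def by measurable
    have g2c [measurable]: "\<And>u. (\<lambda>\<beta>. g2 \<beta> u) \<in> borel_measurable borel" "\<And>\<beta>. g2 \<beta> \<in> borel_measurable borel" unfolding g2_def by measurable
    have g2i [measurable]: "(\<lambda>u. \<integral>\<^sup>+\<beta>. g2 \<beta> u \<partial>lborel) \<in> borel_measurable borel"
      by (rule lborel.borel_measurable_nn_integral) (simp add: case_prod_beta')
    have [measurable]: "(\<lambda>p. \<integral>\<^sup>+\<beta>. g2 \<beta> (fst p) \<partial>lborel) \<in> borel_measurable (borel \<Otimes>\<^sub>M borel)"
      by (rule measurable_compose[OF measurable_fst g2i])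
    have D: "(norm (y - \<alpha> *\<^sub>R ones - X *v \<beta>))\<^sup>2 = real CARD('n) * (ybar y - \<alpha>)\<^sup>2 + (norm (X *v (?b - \<beta>)))\<^sup>2 + Vres y" for \<alpha> \<beta>
    proof -
      have "y - \<alpha> *\<^sub>R ones - X *v \<beta> = (- \<alpha>) *\<^sub>R ones + X *v (- \<beta>) + 1 *\<^sub>R y"
        using matrix_vector_mult_scaleR[of X "-1" \<beta>] by simp
      moreover have "(norm ((- \<alpha>) *\<^sub>R ones + X *v (- \<beta>) + 1 *\<^sub>R y))\<^sup>2 = real CARD('n) * (ybar y - \<alpha>)\<^sup>2 + (norm (X *v (?b - \<beta>)))\<^sup>2 + Vres y"
        by (subst norm_V(1)) (simp only: Vfit_def Vres_def equivariance, simp)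
      ultimately show ?thesis by (simp only:)
    qed
    have inner: "(\<integral>\<^sup>+s\<in>{0<..}. ennreal (s powr (- k) * harmonic_prior X \<beta> s) * samp_dens T X \<alpha> \<beta> s y \<partial>lborel)
      = (\<integral>\<^sup>+u. h u * (g1 \<alpha> u * g2 \<beta> u) \<partial>lborel)" for \<alpha> \<beta>
    proof -
      define Q where "Q = (norm (X *v \<beta>))\<^sup>2 powr (- a0)"
      define D' where "D' = (norm (y - \<alpha> *\<^sub>R ones - X *v \<beta>))\<^sup>2"
      have hp: "harmonic_prior X \<beta> s = Q / s" for s
        unfolding harmonic_prior_def gram_inner Q_def a0_def by (simp add: power2_norm_eq_inner diff_divide_distrib)
      have "(\<integral>\<^sup>+s\<in>{0<..}. ennreal (s powr (- k) * harmonic_prior X \<beta> s) * samp_dens T X \<alpha> \<beta> s y \<partial>lborel)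
        = (\<integral>\<^sup>+u\<in>{0<..}. ennreal (u powr (- k) * (Q / u) * ((2 * pi * u) powr (- real CARD('n) / 2) * exp (- D' / (2 * u)))) \<partial>lborel)"
        unfolding hp samp_dens_def D'_def[symmetric] using post_int_inner[OF T, of Q k D'] mk by (simp add: Q_def)
      also have "\<dots> = (\<integral>\<^sup>+u. h u * (g1 \<alpha> u * g2 \<beta> u) \<partial>lborel)"
      proof (rule nn_integral_cong)
        fix u :: real
        show "ennreal (u powr (- k) * (Q / u) * ((2 * pi * u) powr (- real CARD('n) / 2) * exp (- D' / (2 * u)))) * indicator {0<..} u = h u * (g1 \<alpha> u * g2 \<beta> u)"
        proof (cases "u > 0")
          case True
          have "- D' / (2 * u) = - Vres y / (2 * u) + (- (real CARD('n) * (ybar y - \<alpha>)\<^sup>2) / (2 * u) + - (norm (X *v (?b - \<beta>)))\<^sup>2 / (2 * u))"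
            unfolding D'_def D by (simp add: add_divide_distrib diff_divide_distrib)
          then have "exp (- D' / (2 * u)) = exp (- Vres y / (2 * u)) * (exp (- (real CARD('n) * (ybar y - \<alpha>)\<^sup>2) / (2 * u)) * exp (- (norm (X *v (?b - \<beta>)))\<^sup>2 / (2 * u)))"
            by (simp only: exp_add)
          then have e: "u powr (- k) * (Q / u) * ((2 * pi * u) powr (- real CARD('n) / 2) * exp (- D' / (2 * u))) =
            (u powr (- k) / u * (2 * pi * u) powr (- real CARD('n) / 2) * exp (- Vres y / (2 * u))) *
            (exp (- (real CARD('n) * (ybar y - \<alpha>)\<^sup>2) / (2 * u)) * (Q * exp (- (norm (X *v (?b - \<beta>)))\<^sup>2 / (2 * u))))"
            by simp
          have "0 \<le> u powr (- k) / u * (2 * pi * u) powr (- real CARD('n) / 2) * exp (- Vres y / (2 * u))" "0 \<le> Q * exp (- (norm (X *v (?b - \<beta>)))\<^sup>2 / (2 * u))"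
            using True by (simp_all add: Q_def)
          then show ?thesis unfolding e h_def g1_def g2_def Q_def[symmetric] using True
            by (simp only: ennreal_mult exp_ge_zero mult_nonneg_nonneg) simp
        qed (simp add: h_def)
      qed
      finally show ?thesis .
    qed
    have "post_int T X (\<lambda>s. s powr (- k)) y = (\<integral>\<^sup>+\<alpha>. (\<integral>\<^sup>+\<beta>. (\<integral>\<^sup>+u. h u * (g1 \<alpha> u * g2 \<beta> u) \<partial>lborel) \<partial>lborel) \<partial>lborel)"
      unfolding post_int_def by (simp only: inner)
    also have "\<dots> = (\<integral>\<^sup>+\<alpha>. (\<integral>\<^sup>+u. (\<integral>\<^sup>+\<beta>. h u * (g1 \<alpha> u * g2 \<beta> u) \<partial>lborel) \<partial>lborel) \<partial>lborel)"
      by (intro nn_integral_cong lborel_pair.Fubini') (simp add: case_prod_beta')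
    also have "\<dots> = (\<integral>\<^sup>+\<alpha>. (\<integral>\<^sup>+u. h u * (g1 \<alpha> u * (\<integral>\<^sup>+\<beta>. g2 \<beta> u \<partial>lborel)) \<partial>lborel) \<partial>lborel)"
      by (simp add: nn_integral_cmult)
    also have "\<dots> = (\<integral>\<^sup>+u. (\<integral>\<^sup>+\<alpha>. h u * (g1 \<alpha> u * (\<integral>\<^sup>+\<beta>. g2 \<beta> u \<partial>lborel)) \<partial>lborel) \<partial>lborel)"
      by (rule lborel_pair.Fubini') (simp add: case_prod_beta')
    also have "\<dots> = (\<integral>\<^sup>+u. h u * ((\<integral>\<^sup>+\<alpha>. g1 \<alpha> u \<partial>lborel) * (\<integral>\<^sup>+\<beta>. g2 \<beta> u \<partial>lborel)) \<partial>lborel)"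
      by (simp add: nn_integral_cmult nn_integral_multc)
    finally have P: "post_int T X (\<lambda>s. s powr (- k)) y = (\<integral>\<^sup>+u. h u * ((\<integral>\<^sup>+\<alpha>. g1 \<alpha> u \<partial>lborel) * (\<integral>\<^sup>+\<beta>. g2 \<beta> u \<partial>lborel)) \<partial>lborel)" .
    define E where "E = (\<lambda>v u. ennreal ((1 + v) powr (- (a0 + 1)) * exp (- (v / (1 + v) * Vfit y) / (2 * u))))"
    have Em [measurable]: "(\<lambda>p. E (fst p) (snd p)) \<in> borel_measurable (borel \<Otimes>\<^sub>M borel)" unfolding E_def by measurable
    have [measurable]: "(\<lambda>p. E (snd p) (fst p)) \<in> borel_measurable (borel \<Otimes>\<^sub>M borel)" unfolding E_def by measurable
    have Em' [measurable]: "\<And>u. (\<lambda>v. E v u) \<in> borel_measurable borel" "\<And>v. E v \<in> borel_measurable borel" unfolding E_def by measurable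
    have "ennreal g * post_int T X (\<lambda>s. s powr (- k)) y = (\<integral>\<^sup>+u. ennreal g * (h u * ((\<integral>\<^sup>+\<alpha>. g1 \<alpha> u \<partial>lborel) * (\<integral>\<^sup>+\<beta>. g2 \<beta> u \<partial>lborel))) \<partial>lborel)"
      unfolding P by (subst nn_integral_cmult) simp_all
    also have "\<dots> = (\<integral>\<^sup>+u. (K0 * K1) * (\<integral>\<^sup>+v. powr_density a0 v * (h u * ennreal (u powr (3 / 2)) * E v u) \<partial>lborel) \<partial>lborel)"
    proof (rule nn_integral_cong)
      fix u :: real
      show "ennreal g * (h u * ((\<integral>\<^sup>+\<alpha>. g1 \<alpha> u \<partial>lborel) * (\<integral>\<^sup>+\<beta>. g2 \<beta> u \<partial>lborel)))
        = (K0 * K1) * (\<integral>\<^sup>+v. powr_density a0 v * (h u * ennreal (u powr (3 / 2)) * E v u) \<partial>lborel)"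
      proof (cases "u > 0")
        case True
        have "u powr (1 / 2) * u = u powr (1 / 2) * u powr 1" using True by simp
        also have "\<dots> = u powr (3 / 2)" by (simp only: powr_add[symmetric]) simp
        finally have u32: "u powr (1 / 2) * u = u powr (3 / 2)" .
        have "ennreal g * (\<integral>\<^sup>+\<beta>. g2 \<beta> u \<partial>lborel) = ennreal u * K1 * (\<integral>\<^sup>+v. powr_density a0 v * E v u \<partial>lborel)"
          using harmonic_integral[OF a0[unfolded a0_def] True, of ?b] unfolding g2_def g_def K1_def E_def Vfit_def a0_def .
        moreover have "ennreal g * (h u * (A * I)) = h u * (A * (ennreal g * I))" for A I :: ennreal
          by (simp only: mult_ac)
        ultimately have "ennreal g * (h u * ((\<integral>\<^sup>+\<alpha>. g1 \<alpha> u \<partial>lborel) * (\<integral>\<^sup>+\<beta>. g2 \<beta> u \<partial>lborel)))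
          = h u * ((ennreal (u powr (1 / 2)) * K0) * (ennreal u * K1 * (\<integral>\<^sup>+v. powr_density a0 v * E v u \<partial>lborel)))"
          unfolding g1_def intercept_integral[OF True] K0_def[symmetric] by simp
        also have "\<dots> = (K0 * K1) * ((h u * ennreal (u powr (1 / 2) * u)) * (\<integral>\<^sup>+v. powr_density a0 v * E v u \<partial>lborel))"
          using True by (simp add: ennreal_mult mult_ac)
        also have "(h u * ennreal (u powr (1 / 2) * u)) * (\<integral>\<^sup>+v. powr_density a0 v * E v u \<partial>lborel)
          = (\<integral>\<^sup>+v. (h u * ennreal (u powr (1 / 2) * u)) * (powr_density a0 v * E v u) \<partial>lborel)"
          by (rule nn_integral_cmult[symmetric]) measurable
        finally show ?thesis unfolding u32 by (simp only: mult_ac)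
      qed (simp add: h_def)
    qed
    also have "\<dots> = (K0 * K1) * (\<integral>\<^sup>+u. (\<integral>\<^sup>+v. powr_density a0 v * (h u * ennreal (u powr (3 / 2)) * E v u) \<partial>lborel) \<partial>lborel)"
      by (rule nn_integral_cmult) measurable
    also have "(\<integral>\<^sup>+u. (\<integral>\<^sup>+v. powr_density a0 v * (h u * ennreal (u powr (3 / 2)) * E v u) \<partial>lborel) \<partial>lborel)
      = (\<integral>\<^sup>+v. (\<integral>\<^sup>+u. powr_density a0 v * (h u * ennreal (u powr (3 / 2)) * E v u) \<partial>lborel) \<partial>lborel)"
      by (rule lborel_pair.Fubini') (simp add: case_prod_beta')
    also have "\<dots> = (\<integral>\<^sup>+v. ennreal (d * (Gamma c * 2 powr c)) * (powr_density a0 v * ennreal ((1 + v) powr (- (a0 + 1)) * (Vres y + v * Vfit y / (1 + v)) powr (- c))) \<partial>lborel)"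
    proof (rule nn_integral_cong)
      fix v :: real
      show "(\<integral>\<^sup>+u. powr_density a0 v * (h u * ennreal (u powr (3 / 2)) * E v u) \<partial>lborel)
        = ennreal (d * (Gamma c * 2 powr c)) * (powr_density a0 v * ennreal ((1 + v) powr (- (a0 + 1)) * (Vres y + v * Vfit y / (1 + v)) powr (- c)))"
      proof (cases "v > 0")
        case True
        define B where "B = Vres y + v * Vfit y / (1 + v)"
        have B: "B > 0" using S W True by (simp add: B_def add_pos_nonneg)
        have pt: "h u * ennreal (u powr (3 / 2)) * E v u = ennreal (d * (1 + v) powr (- (a0 + 1))) * (ennreal (u powr (- c - 1) * exp (- (B / 2) / u)) * indicator {0<..} u)" for u
        proof (cases "u > 0")
          case u: True
          have "- Vres y / (2 * u) + - (v / (1 + v) * Vfit y) / (2 * u) = - (B / 2) / u"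
          proof -
            have "- s / (2 * u) + - t / (2 * u) = - ((s + t) / 2) / u" for s t
              by (simp add: add_divide_distrib diff_divide_distrib)
            then show ?thesis unfolding B_def times_divide_eq_left .
          qed
          then have ex: "exp (- Vres y / (2 * u)) * exp (- (v / (1 + v) * Vfit y) / (2 * u)) = exp (- (B / 2) / u)"
            by (simp only: exp_add[symmetric])
          \<comment> \<open>Negative powers of u: k + 1 from weight and prior and n / 2 from the
            density, reduced by 1 / 2 for the intercept and 1 for the coefficients. As a0 + b = (n -
            3) / 2, the total is c + 1.\<close>
          have pw: "u powr (- k) / u * u powr (- real CARD('n) / 2) * u powr (3 / 2) = u powr (- c - 1)"
          proof -
            have "u powr (- k) / u * u powr (- real CARD('n) / 2) * u powr (3 / 2) = u powr (- k) * u powr (- 1) * u powr (- real CARD('n) / 2) * u powr (3 / 2)"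
            proof -
              have "u powr (- 1) = inverse u" using u by (subst powr_minus) simp
              then show ?thesis by (simp only: divide_inverse)
            qed
            also have "\<dots> = u powr (- k + - 1 + - real CARD('n) / 2 + 3 / 2)" by (simp only: powr_add)
            also have "- k + - 1 + - real CARD('n) / 2 + 3 / 2 = - c - 1"
              by (simp add: c_def a0_def b_def dof_def field_simps)
            finally show ?thesis .
          qed
          have dd: "(2 * pi * u) powr (- real CARD('n) / 2) = d * u powr (- real CARD('n) / 2)"
            by (simp add: d_def powr_mult)
          have "(u powr (- k) / u * (2 * pi * u) powr (- real CARD('n) / 2) * exp (- Vres y / (2 * u))) * u powr (3 / 2) * ((1 + v) powr (- (a0 + 1)) * exp (- (v / (1 + v) * Vfit y) / (2 * u)))
            = (d * (1 + v) powr (- (a0 + 1))) * ((u powr (- k) / u * u powr (- real CARD('n) / 2) * u powr (3 / 2)) * (exp (- Vres y / (2 * u)) * exp (- (v / (1 + v) * Vfit y) / (2 * u))))"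
          proof -
            have "(p * (d * y) * e1) * z * (w * e2) = (d * w) * ((p * y * z) * (e1 * e2))" for p y z w e1 e2 :: real
              by (simp only: mult_ac)
            then show ?thesis unfolding dd .
          qed
          also have "\<dots> = (d * (1 + v) powr (- (a0 + 1))) * (u powr (- c - 1) * exp (- (B / 2) / u))"
            unfolding ex pw ..
          finally have e: "(u powr (- k) / u * (2 * pi * u) powr (- real CARD('n) / 2) * exp (- Vres y / (2 * u))) * u powr (3 / 2) * ((1 + v) powr (- (a0 + 1)) * exp (- (v / (1 + v) * Vfit y) / (2 * u)))
            = (d * (1 + v) powr (- (a0 + 1))) * (u powr (- c - 1) * exp (- (B / 2) / u))" .
          have "h u * ennreal (u powr (3 / 2)) * E v u = ennreal ((u powr (- k) / u * (2 * pi * u) powr (- real CARD('n) / 2) * exp (- Vres y / (2 * u))) * u powr (3 / 2) * ((1 + v) powr (- (a0 + 1)) * exp (- (v / (1 + v) * Vfit y) / (2 * u))))"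
            unfolding h_def E_def using u by (simp add: ennreal_mult'[symmetric] del: minus_add_distrib)
          also have "\<dots> = ennreal (d * (1 + v) powr (- (a0 + 1))) * ennreal (u powr (- c - 1) * exp (- (B / 2) / u))"
            unfolding e using d by (intro ennreal_mult) auto
          finally show ?thesis using u by simp
        qed (simp add: h_def)
        have "(\<integral>\<^sup>+u. powr_density a0 v * (h u * ennreal (u powr (3 / 2)) * E v u) \<partial>lborel)
          = (\<integral>\<^sup>+u. (powr_density a0 v * ennreal (d * (1 + v) powr (- (a0 + 1)))) * (ennreal (u powr (- c - 1) * exp (- (B / 2) / u)) * indicator {0<..} u) \<partial>lborel)"
          unfolding pt by (simp only: mult.assoc)
        also have "\<dots> = (powr_density a0 v * ennreal (d * (1 + v) powr (- (a0 + 1)))) * (\<integral>\<^sup>+u. ennreal (u powr (- c - 1) * exp (- (B / 2) / u)) * indicator {0<..} u \<partial>lborel)"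
          by (rule nn_integral_cmult) measurable
        also have "(\<integral>\<^sup>+u. ennreal (u powr (- c - 1) * exp (- (B / 2) / u)) * indicator {0<..} u \<partial>lborel) = ennreal (Gamma c * (B / 2) powr (- c))"
          using B by (intro nn_integral_inverse_gamma c) auto
        also have "(B / 2) powr (- c) = 2 powr c * B powr (- c)"
          by (simp add: powr_divide powr_minus_divide)
        finally show ?thesis unfolding B_def[symmetric] using d Gamma_real_pos[OF c]
          by (simp add: ennreal_mult mult_ac del: minus_add_distrib)
      qed (simp add: powr_density_def)
    qed
    also have "\<dots> = ennreal (d * (Gamma c * 2 powr c)) * post_kernel a0 c (Vres y) (Vfit y)"
      unfolding post_kernel_def by (rule nn_integral_cmult) measurable
    finally have main: "ennreal g * post_int T X (\<lambda>s. s powr (- k)) y = (K0 * K1) * (ennreal (d * (Gamma c * 2 powr c)) * post_kernel a0 c (Vres y) (Vfit y))" .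
    have "post_int T X (\<lambda>s. s powr (- k)) y = ennreal (1 / g) * (ennreal g * post_int T X (\<lambda>s. s powr (- k)) y)"
      using g by (simp add: mult.assoc[symmetric] ennreal_mult[symmetric])
    also have "\<dots> = ennreal (d / g) * K0 * K1 * (ennreal (Gamma c * 2 powr c) * post_kernel a0 c (Vres y) (Vfit y))"
    proof -
      have e: "ennreal (1 / g) * ennreal (d * (Gamma c * 2 powr c)) = ennreal (d / g) * ennreal (Gamma c * 2 powr c)"
        using g d Gamma_real_pos[OF c] by (simp add: ennreal_mult[symmetric])
      have l: "A * ((K0 * K1) * (B * P)) = (A * B) * (K0 * K1 * P)" for A B P :: ennreal
        by (simp only: mult_ac)
      have r: "(A * B) * (K0 * K1 * P) = A * K0 * K1 * (B * P)" for A B P :: ennreal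
        by (simp only: mult_ac)
      show ?thesis unfolding main l e r ..
    qed
    finally show "post_int T X (\<lambda>s. s powr (- k)) y =
      ennreal (d / g) * K0 * K1 * (ennreal (Gamma (a0 + b + k) * 2 powr (a0 + b + k)) * post_kernel a0 (a0 + b + k) (Vres y) (Vfit y))"
      unfolding c_def .
  qed
qed

text \<open>The constants for k = 1 and k = 0 differ by the factor 2 (a + b) / S, which combines
  with b / (a + b) so that the quotient becomes \<phi> S / (2 b), and 2 b = m. Agreement of \<delta>
  with \<open>est\<close> is asked only where both squared norms are positive, in keeping with the
  almost-everywhere form of the Bayes property.\<close>

theorem gen_bayes_est:
  fixes \<delta> :: "real^'n \<Rightarrow> real"
  assumes T: "scale_mixture T" and p3: "3 \<le> CARD('p)"
    and \<delta>: "\<And>y. 0 < Vfit y \<Longrightarrow> 0 < Vres y \<Longrightarrow> \<delta> y = est y"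
  shows "gen_bayes_stein T X \<delta>"
  unfolding gen_bayes_stein_def
proof (rule AE_mp[OF AE_V], intro AE_I2 impI)
  fix y :: "real^'n" assume "0 < Vfit y \<and> 0 < Vres y \<and> 0 < Vloc y"
  then have S: "0 < Vres y" and W: "0 < Vfit y" by auto
  interpret T: prob_space T using T by (simp add: scale_mixture_def)
  have posT: "AE \<tau> in T. 0 < \<tau>" and T2: "(\<integral>\<^sup>+\<tau>. ennreal (\<tau>\<^sup>2) \<partial>T) = 1" using T by (auto simp: scale_mixture_def)
  define a where "a = real CARD('p) / 2 - 1"
  define b where "b = dof / 2"
  have a: "a > 0" and b: "b > 0" using p3 dof_eq by (auto simp: a_def b_def)
  define x where "x = Vfit y / Vres y"
  have x: "x > 0" using S W by (simp add: x_def)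
  obtain K where K: "0 < K" "K < \<infinity>" "\<And>k. k \<ge> 0 \<Longrightarrow> (\<integral>\<^sup>+\<tau>. ennreal ((\<tau>\<^sup>2) powr k) \<partial>T) = 1 \<Longrightarrow>
    post_int T X (\<lambda>s. s powr (- k)) y =
    K * (ennreal (Gamma (a + b + k) * 2 powr (a + b + k)) * post_kernel a (a + b + k) (Vres y) (Vfit y))"
    using post_int_eq[OF T p3 S W] unfolding a_def b_def by blast
  have m0: "(\<integral>\<^sup>+\<tau>. ennreal ((\<tau>\<^sup>2) powr 0) \<partial>T) = 1"
  proof -
    have "(\<integral>\<^sup>+\<tau>. ennreal ((\<tau>\<^sup>2) powr 0) \<partial>T) = (\<integral>\<^sup>+\<tau>. 1 \<partial>T)"
      by (rule nn_integral_cong_AE) (use posT in eventually_elim, simp)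
    then show ?thesis by (simp add: T.emeasure_space_1)
  qed
  have m1: "(\<integral>\<^sup>+\<tau>. ennreal ((\<tau>\<^sup>2) powr 1) \<partial>T) = 1" using T2 by simp
  have p0: "post_int T X (\<lambda>s. 1) y = post_int T X (\<lambda>s. s powr (- 0)) y"
    unfolding post_int_def by (intro nn_integral_cong) (auto simp: indicator_def)
  have p1: "post_int T X (\<lambda>s. 1 / s) y = post_int T X (\<lambda>s. s powr (- 1)) y"
    unfolding post_int_def by (intro nn_integral_cong) (auto simp: indicator_def powr_minus_divide)
  define G where "G = beta_cdf a b x"
  define q where "q = beta_corr a b x"
  have Gq: "G > 0" "q > 0" using beta_cdf_pos beta_corr_pos a b x by (auto simp: G_def q_def)
  have k0: "post_kernel a (a + b) (Vres y) (Vfit y) = ennreal (Vfit y powr (- a) * Vres y powr (a - (a + b))) * ennreal G"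
    unfolding G_def x_def
  proof (rule post_kernel_eq[OF S W])
    show "(beta_cdf a b has_real_derivative u powr (a - 1) * (1 + u) powr (- (a + b))) (at u)" if "u > 0" for u
      using beta_cdf_deriv[OF a b that] by (simp add: beta_kernel_def)
  qed (auto intro: beta_cdf_continuous a b)
  have k1: "post_kernel a (a + b + 1) (Vres y) (Vfit y) = ennreal (Vfit y powr (- a) * Vres y powr (a - (a + b + 1))) * ennreal (b / (a + b) * (G + q))"
    unfolding G_def q_def x_def
  proof (rule post_kernel_eq[OF S W, where \<Phi> = "\<lambda>u. b / (a + b) * (beta_cdf a b u + beta_corr a b u)"])
    show "((\<lambda>u. b / (a + b) * (beta_cdf a b u + beta_corr a b u)) has_real_derivative u powr (a - 1) * (1 + u) powr (- (a + b + 1))) (at u)" if u: "u > 0" for u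
    proof -
      have "(1 + u) powr (- (a + b + 1)) = (1 + u) powr (- (a + b)) * (1 + u) powr (- 1)"
        by (subst powr_add[symmetric], rule arg_cong2[where f = "(powr)"]) simp_all
      then have e: "b / (a + b) * ((a + b) / b * beta_kernel a b u / (1 + u)) = u powr (a - 1) * (1 + u) powr (- (a + b + 1))"
        using a b u by (simp add: beta_kernel_def)
      show ?thesis using DERIV_cmult[OF beta_sum_deriv[OF a b u], of "b / (a + b)"] unfolding e .
    qed
    show "continuous_on {0..Vfit y / Vres y} (\<lambda>u. b / (a + b) * (beta_cdf a b u + beta_corr a b u))"
      by (intro continuous_intros beta_cdf_continuous beta_corr_continuous a b)
    show "b / (a + b) * (beta_cdf a b 0 + beta_corr a b 0) = 0" by (simp add: beta_corr_def)
  qed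
  define P0 where "P0 = Gamma (a + b) * 2 powr (a + b) * (Vfit y powr (- a) * Vres y powr (- b) * G)"
  define P1 where "P1 = Gamma (a + b + 1) * 2 powr (a + b + 1) * (Vfit y powr (- a) * Vres y powr (- b - 1) * (b / (a + b) * (G + q)))"
  have gp: "Gamma (a + b) > 0" "Gamma (a + b + 1) > 0" using a b by (simp_all add: Gamma_real_pos)
  have P: "P0 > 0" "P1 > 0" using gp S W Gq a b by (simp_all add: P0_def P1_def)
  have e0: "post_int T X (\<lambda>s. 1) y = K * ennreal P0"
    unfolding p0 using K(3)[OF _ m0] k0 gp Gq by (simp add: P0_def ennreal_mult mult.assoc)
  have e1: "post_int T X (\<lambda>s. 1 / s) y = K * ennreal P1"
  proof -
    have "a - (a + b + 1) = - b - 1" by simp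
    moreover have "K * (ennreal (Gamma (a + b + 1) * 2 powr (a + b + 1)) * (ennreal (Vfit y powr (- a) * Vres y powr (- b - 1)) * ennreal C))
      = K * ennreal (Gamma (a + b + 1) * 2 powr (a + b + 1) * (Vfit y powr (- a) * Vres y powr (- b - 1) * C))" if "C \<ge> 0" for C
      using that gp by (simp add: ennreal_mult mult.assoc)
    moreover have "b / (a + b) * (G + q) \<ge> 0" using Gq a b by simp
    ultimately show ?thesis unfolding p1 P1_def using K(3)[OF _ m1] k1 by simp
  qed
  have "est y = P0 / P1"
  proof -
    have G1: "Gamma (a + b + 1) = (a + b) * Gamma (a + b)" using a b by (intro Gamma_plus1) (auto elim!: nonpos_Ints_cases)
    have V1: "Vres y powr (- b) = Vres y * Vres y powr (- b - 1)" using S by (simp add: powr_diff)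
    have t1: "2 powr (a + b + 1) = 2 * (2::real) powr (a + b)" by (simp add: powr_add)
    define Z where "Z = Gamma (a + b) * 2 powr (a + b) * (Vfit y powr (- a) * Vres y powr (- b - 1))"
    have Z: "Z \<noteq> 0" using gp S W by (simp add: Z_def)
    have "P0 = Z * (Vres y * G)" unfolding P0_def V1 Z_def by (simp only: mult_ac)
    moreover have "P1 = Z * (2 * b * (G + q))"
    proof -
      have "P1 = Z * (2 * ((a + b) * (b / (a + b) * (G + q))))"
        unfolding P1_def G1 t1 Z_def by (simp only: mult_ac)
      also have "(a + b) * (b / (a + b) * (G + q)) = b * (G + q)" using a b by simp
      finally show ?thesis by simp
    qed
    ultimately have "P0 / P1 = G / (G + q) * Vres y / (2 * b)" using Z by (simp add: mult.commute)
    then show ?thesis using S W by (simp add: est_def shrink_def G_def q_def x_def a_def b_def)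
  qed
  moreover have "enn2real (K * ennreal P0) / enn2real (K * ennreal P1) = P0 / P1"
  proof -
    have "enn2real K > 0" using K by (simp add: enn2real_positive_iff)
    then show ?thesis using P by (simp add: enn2real_mult)
  qed
  ultimately have "\<delta> y = enn2real (K * ennreal P0) / enn2real (K * ennreal P1)" using \<delta>[OF W S] by simp
  then show "0 < post_int T X (\<lambda>s. 1) y \<and> post_int T X (\<lambda>s. 1) y < \<infinity> \<and>
        0 < post_int T X (\<lambda>s. 1 / s) y \<and> post_int T X (\<lambda>s. 1 / s) y < \<infinity> \<and>
        \<delta> y = enn2real (post_int T X (\<lambda>s. 1) y) / enn2real (post_int T X (\<lambda>s. 1 / s) y)"
    unfolding e0 e1 using K P by (simp add: ennreal_zero_less_mult_iff ennreal_mult_less_top)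
qed

text \<open>With r equal to R squared, the odds r / (1 - r) are W / S. The prefactor (n - p - 1) /
  (n - 3) is b / (a + b) and cancels the same factor in the second integral; the powers of r cancel
  between the two.\<close>

lemma deltaH_eq_est:
  assumes p3: "3 \<le> CARD('p)" and W: "0 < Vfit y" and S: "0 < Vres y"
  shows "deltaH X y = est y"
proof -
  define a where "a = real CARD('p) / 2 - 1"
  define b where "b = dof / 2"
  have a: "a > 0" and b: "b > 0" using p3 dof_eq by (auto simp: a_def b_def)
  define r where "r = Rsq X y"
  have r_eq: "r = Vfit y / (Vfit y + Vres y)"
    unfolding r_def Rsq_def norm_centered hat_centered Vfit_def Vres_def ..
  have "1 - r = Vres y / (Vfit y + Vres y)" using S W by (simp add: r_eq field_simps)
  then have r: "0 < r" "r < 1" "r / (1 - r) = Vfit y / Vres y" using S W by (simp_all add: r_eq)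
  define G where "G = beta_cdf a b (Vfit y / Vres y)"
  define q where "q = beta_corr a b (Vfit y / Vres y)"
  have Gq: "G > 0" "q > 0" using beta_cdf_pos beta_corr_pos a b S W by (auto simp: G_def q_def)
  have e: "real CARD('p) / 2 - 2 = a - 1" "(real CARD('n) - real CARD('p) - 3) / 2 = b - 1"
    "(real CARD('n) - real CARD('p) - 1) / 2 = b"
    by (simp_all add: a_def b_def dof_def field_simps)
  have i0: "integral {0..1} (\<lambda>t. t powr (a - 1) * (1 - r * t) powr (b - 1)) = G / r powr a"
    using integral_unique[OF incomplete_beta_integral[OF a b r(1,2)]] by (simp add: r(3) G_def)
  have i1: "integral {0..1} (\<lambda>t. t powr (a - 1) * (1 - r * t) powr b) = b / (a + b) * (G + q) / r powr a"
    using integral_unique[OF incomplete_beta_integral_Suc[OF a b r(1,2)]] by (simp add: r(3) G_def q_def)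
  have n3: "real CARD('n) - 3 = 2 * (a + b)" "real CARD('n) - real CARD('p) - 1 = 2 * b"
    by (simp_all add: a_def b_def dof_def field_simps)
  have "phiH CARD('n) CARD('p) r = 2 * b / (2 * (a + b)) * ((G / r powr a) / (b / (a + b) * (G + q) / r powr a))"
    unfolding phiH_def e i0 i1 unfolding n3 ..
  also have "\<dots> = G / (G + q)"
  proof -
    have "2 * b / (2 * c) * ((G / R) / (b / c * (G + q) / R)) = G / (G + q)" if "c > 0" "R > 0" for c R
      using that b Gq by simp
    from this[of "a + b" "r powr a"] show ?thesis using a b r by simp
  qed
  finally show ?thesis
    using S W unfolding deltaH_def r_def[symmetric] RSS_eq Vres_def[symmetric]
    by (simp add: est_def shrink_def G_def q_def a_def b_def dof_def)
qed

text \<open>The two estimators agree wherever both squared norms are positive, hence almost surely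
  at every parameter point.\<close>

lemma risk_deltaH:
  assumes p3: "3 \<le> CARD('p)" and T: "scale_mixture T" and \<sigma>: "\<sigma> > 0"
  shows "risk T X (deltaH X) \<alpha> \<beta> \<sigma> = risk T X est \<alpha> \<beta> \<sigma>"
proof -
  have posT: "AE \<tau> in T. 0 < \<tau>" using T by (auto simp: scale_mixture_def)
  show ?thesis
    unfolding risk_def
  proof (rule nn_integral_cong_AE, use posT in eventually_elim)
    fix \<tau> :: real assume \<tau>: "0 < \<tau>"
    have st: "\<sigma> * \<tau> > 0" using \<sigma> \<tau> by simp
    have "AE z in (std_normal_vec :: (real^'n) measure). 0 < Vfit (X *v ((1 / (\<sigma> * \<tau>)) *\<^sub>R \<beta>) + z) \<and> 0 < Vres z"
      by (rule AE_std_normal_vec[OF AE_model])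
    then have "AE z in (std_normal_vec :: (real^'n) measure). deltaH X (\<alpha> *\<^sub>R ones + X *v \<beta> + (\<sigma> * \<tau>) *\<^sub>R z) = est (\<alpha> *\<^sub>R ones + X *v \<beta> + (\<sigma> * \<tau>) *\<^sub>R z)"
    proof eventually_elim
      case (elim z)
      then show ?case using st \<sigma> \<tau> by (intro deltaH_eq_est p3) (auto simp: V_model[OF st])
    qed
    then show "(\<integral>\<^sup>+z. ennreal (stein_loss (deltaH X (\<alpha> *\<^sub>R ones + X *v \<beta> + (\<sigma> * \<tau>) *\<^sub>R z)) (\<sigma>\<^sup>2)) \<partial>std_normal_vec)
      = (\<integral>\<^sup>+z. ennreal (stein_loss (est (\<alpha> *\<^sub>R ones + X *v \<beta> + (\<sigma> * \<tau>) *\<^sub>R z)) (\<sigma>\<^sup>2)) \<partial>std_normal_vec)"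
      by (intro nn_integral_cong_AE) (auto elim!: eventually_mono)
  qed
qed

text \<open>\<open>base_risk T\<close> bounds the maximum risk of \<open>est\<close> from above and
  that of every estimator from below. The infimum is reached through \<open>est\<close>, since
  \<open>deltaH X\<close> vanishes where the residual does and so is not itself a member of
  \<open>estimators\<close>.\<close>

lemma minimax_deltaH:
  assumes p3: "3 \<le> CARD('p)" and T: "scale_mixture T"
  shows "minimax T X (deltaH X)"
proof -
  have eq: "max_risk T X (deltaH X) = max_risk T X est"
    unfolding max_risk_def by (simp add: risk_deltaH[OF p3 T])
  have "est \<in> estimators" using est_measurable[OF p3] est_pos[OF p3] by (simp add: estimators_def)
  then have "(INF d\<in>estimators. max_risk T X d) \<le> max_risk T X est" by (rule INF_lower)
  moreover have "max_risk T X est \<le> base_risk T"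
    unfolding max_risk_def by (intro SUP_least risk_est_le[OF p3 T]) simp
  moreover have "base_risk T \<le> (INF d\<in>estimators. max_risk T X d)"
    by (intro INF_greatest base_risk_le_max_risk[OF T])
  ultimately show ?thesis unfolding minimax_def eq by (intro antisym) (auto intro: order_trans)
qed

end

theorem theorem3p2:
  fixes X :: "real^'p^'n" and T :: "real measure"
  assumes "3 \<le> CARD('p)" and "CARD('p) < CARD('n) - 1"
    and "\<forall>j. (\<Sum>i\<in>UNIV. X $ i $ j) = 0"
    and "rank X = CARD('p)"
    and "scale_mixture T"
  shows "minimax T X (deltaH X) \<and> gen_bayes_stein T X (deltaH X)"
proof -
  interpret wide_design X
    using assms by unfold_locales auto
  show ?thesis
    using minimax_deltaH gen_bayes_est[OF assms(5,1) deltaH_eq_est] assms by blast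
qed

end
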